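(* Let $(R,{}^-)$ be a unital associative $\Bbbk$-superalgebra with superinvolution such that $R$ contains a homogeneous element $e$ with $\bar e=-e$, $e$ in the center of $R$, and $e$ a unit of $R$. Then, as $\Bbbk$-modules, $$\mathrm H_2(\mathfrak{osp}_{2|2}(R,{}^-),\Bbbk)\cong{}_{-}\mathrm{HD}_1(R,{}^-)\oplus R/([R,R]R).$$
   Context: **Base conventions.** $\Bbbk$ is a unital commutative associative ring in which $2$ is invertible; all modules and (super)algebras are over $\Bbbk$. Superalgebras are $\mathbb{Z}/2\mathbb{Z}$-graded, $|x|$ is the degree of a homogeneous $x$, and formulas involving degrees are for homogeneous elements, extended linearly. A Lie superalgebra has an even bilinear bracket with $[x,y]=-(-1)^{|x||y|}[y,x]$ and $(-1)^{|x||z|}[[x,y],z]+(-1)^{|y||x|}[[y,z],x]+(-1)^{|z||y|}[[z,x],y]=0$. A superinvolution on $R$ is a degree-preserving $\Bbbk$-linear map $a\mapsto\bar a$ with $\overline{ab}=(-1)^{|a||b|}\bar b\bar a$, $\bar{\bar a}=a$. In $R$, $[a,b]=ab-(-1)^{|a||b|}ba$, and $[R,R]R$ is the span of all $[a,b]c$. Put $\rho(a)=(-1)^{|a|}a$. **$\mathfrak{osp}_{m|2n}(R,{}^-)$** (used here with $m=2$, $n=1$). $\mathrm{M}_{m|2n}(R)$ is the superalgebra of $(m+2n)\times(m+2n)$ matrices over $R$ with usual matrix multiplication; $e_{ij}(a)$ (entry $a$ at $(i,j)$) has degree $|i|+|j|+|a|$, with $|i|=0$ for $i\le m$, $|i|=1$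 for $i>m$. With blocks of sizes $m,n,n$ let $$\begin{pmatrix}A&B_1&C_2\\ C_1&D_{11}&D_{12}\\ B_2&D_{21}&D_{22}\end{pmatrix}^{\mathrm{osp}}=\begin{pmatrix}\overline{A}^t&-\overline{\rho(B_2)}^t&\overline{\rho(C_1)}^t\\ \overline{\rho(C_2)}^t&\overline{D_{22}}^t&-\overline{D_{12}}^t\\ -\overline{\rho(B_1)}^t&-\overline{D_{21}}^t&\overline{D_{11}}^t\end{pmatrix}$$ ($\rho$ and ${}^-$ applied entrywise). $\widetilde{\mathfrak{osp}}_{m|2n}(R,{}^-)=\{X: X^{\mathrm{osp}}=-X\}$ is a Lie superalgebra under the supercommutator, and $\mathfrak{osp}_{m|2n}(R,{}^-)=[\widetilde{\mathfrak{osp}}_{m|2n}(R,{}^-),\widetilde{\mathfrak{osp}}_{m|2n}(R,{}^-)]$; this is a perfect Lie superalgebra. **Second homology.** For a Lie superalgebra $L$, $\mathrm H_2(L,\Bbbk)$ is the kernel of the map $(L\otimes_\Bbbk L)/B\to L$, $x\otimes y\mapsto[x,y]$, where $B$ is spanned by $x\otimes y+(-1)^{|x||y|}y\otimes x$ and $(-1)^{|x||z|}[x,y]\otimes z+(-1)^{|y||x|}[y,z]\otimes x+(-1)^{|z||y|}[z,x]\otimes y$ for homogeneous $x,y,z\in L$; for perfect $L$ this is the kernel of the universal central extension of $L$. **First $\mathbb{Z}/2\mathbb{Z}$-graded skew-dihedral homology.** Let $I_{\mathsf d}^-\subseteq R\otimes_\Bbbk R$ be the submodule spanned by $a\otimes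 b-\bar a\otimes\bar b$, $a\otimes b+(-1)^{|a||b|}b\otimes a$ and $(-1)^{|a||c|}ab\otimes c+(-1)^{|a||b|}bc\otimes a+(-1)^{|b||c|}ca\otimes b$; let $\langle R,R\rangle_{\mathsf d}^-=(R\otimes_\Bbbk R)/I_{\mathsf d}^-$ with $\langle a,b\rangle_{\mathsf d}^-$ the class of $a\otimes b$. Then ${}_{-}\mathrm{HD}_1(R,{}^-)=\{\sum_i\langle a_i,b_i\rangle_{\mathsf d}^-:\ \sum_i[a_i,b_i]=\sum_i\overline{[a_i,b_i]}\}$. *)

theory Defs
  imports
    "HOL-Analysis.Finite_Cartesian_Product"
    "HOL-Algebra.Module"
    "HOL-Library.Numeral_Type"
    "HOL-Library.Poly_Mapping"
    "HOL-Library.Set_Algebras"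
    "HOL-Library.Z2"
begin

section \<open>Quotients, direct sums and isomorphism of modules\<close>

text \<open>
  Modules over a commutative ring (a type \<open>'k\<close>) live on types, with an explicit scalar
  multiplication. Quotients and direct sums are returned as module records of HOL-Algebra,
  whose \<open>mult\<close> and \<open>one\<close> fields carry no meaning for a module.
\<close>

text \<open>The quotient \<open>M / N\<close> of submodules \<open>N \<subseteq> M\<close> of an ambient module, as a set of cosets.\<close>

definition quotient_module ::
    "('k \<Rightarrow> 'a \<Rightarrow> 'a) \<Rightarrow> 'a set \<Rightarrow> 'a::ab_group_add set \<Rightarrow> ('k, 'a set) module" where
  "quotient_module sc M N =
     \<lparr>carrier = (\<lambda>x. x +o N) ` M, mult = undefined, one = undefined,
      zero = N, add = (\<lambda>A B. A + B), smult = (\<lambda>c A. \<Union>x\<in>A. sc c x +o N)\<rparr>"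

definition module_direct_sum :: "('k, 'a) module \<Rightarrow> ('k, 'b) module \<Rightarrow> ('k, 'a \<times> 'b) module" where
  "module_direct_sum M N =
     \<lparr>carrier = carrier M \<times> carrier N, mult = undefined, one = undefined,
      zero = (\<zero>\<^bsub>M\<^esub>, \<zero>\<^bsub>N\<^esub>),
      add = (\<lambda>(x, y) (x', y'). (x \<oplus>\<^bsub>M\<^esub> x', y \<oplus>\<^bsub>N\<^esub> y')),
      smult = (\<lambda>c (x, y). (c \<odot>\<^bsub>M\<^esub> x, c \<odot>\<^bsub>N\<^esub> y))\<rparr>"

definition module_isomorphic :: "('k, 'a) module \<Rightarrow> ('k, 'b) module \<Rightarrow> bool" where
  "module_isomorphic M N \<longleftrightarrow>
     (\<exists>f \<in> iso (add_monoid M) (add_monoid N).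
        \<forall>c. \<forall>x\<in>carrier M. f (c \<odot>\<^bsub>M\<^esub> x) = c \<odot>\<^bsub>N\<^esub> f x)"

section \<open>Superalgebras with superinvolution\<close>

text \<open>Degrees are elements of the two-element field \<open>bit\<close>; \<open>signed p x\<close> is $(-1)^p x$.\<close>

definition signed :: "bit \<Rightarrow> 'a::group_add \<Rightarrow> 'a" where
  "signed p x = (if p = 0 then x else - x)"

locale superalgebra = Modules.module sc
  for sc :: "'k::comm_ring_1 \<Rightarrow> 'r::ring_1 \<Rightarrow> 'r" +
  fixes V :: "bit \<Rightarrow> 'r set"
  assumes scale_mult_left: "sc c x * y = sc c (x * y)"
    and scale_mult_right: "x * sc c y = sc c (x * y)"
    and subspace_V: "subspace (V p)"
    and V_disjoint: "V 0 \<inter> V 1 = {0}"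
    and V_sum: "\<exists>y\<in>V 0. \<exists>z\<in>V 1. x = y + z"
    and V_one: "1 \<in> V 0"
    and V_mult: "x \<in> V p \<Longrightarrow> y \<in> V q \<Longrightarrow> x * y \<in> V (p + q)"

locale superinvolution = superalgebra sc V
  for sc :: "'k::comm_ring_1 \<Rightarrow> 'r::ring_1 \<Rightarrow> 'r" and V :: "bit \<Rightarrow> 'r set" +
  fixes bar :: "'r \<Rightarrow> 'r"
  assumes bar_linear: "module_hom sc sc bar"
    and bar_V: "x \<in> V p \<Longrightarrow> bar x \<in> V p"
    and bar_mult: "x \<in> V p \<Longrightarrow> y \<in> V q \<Longrightarrow> bar (x * y) = signed (p * q) (bar y * bar x)"
    and bar_bar: "bar (bar x) = x"

text \<open>The homogeneous component of degree \<open>p\<close> with respect to a grading \<open>V\<close>.\<close>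

definition component :: "(bit \<Rightarrow> 'a::ab_group_add set) \<Rightarrow> bit \<Rightarrow> 'a \<Rightarrow> 'a" where
  "component V p x = (THE y. y \<in> V p \<and> x - y \<in> V (p + 1))"

definition rho :: "(bit \<Rightarrow> 'a::ab_group_add set) \<Rightarrow> 'a \<Rightarrow> 'a" where
  "rho V x = component V 0 x - component V 1 x"

text \<open>
  The supercommutator for a product \<open>mul\<close>, extended bilinearly from homogeneous elements.
  The product is a parameter because that of matrices is \<open>(**)\<close>, not \<open>(*)\<close>.
\<close>

definition supercommutator ::
    "('a \<Rightarrow> 'a \<Rightarrow> 'a) \<Rightarrow> (bit \<Rightarrow> 'a::ab_group_add set) \<Rightarrow> 'a \<Rightarrow> 'a \<Rightarrow> 'a" where
  "supercommutator mul V x y =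
     (\<Sum>p\<in>{0, 1}. \<Sum>q\<in>{0, 1}.
        mul (component V p x) (component V q y)
        - signed (p * q) (mul (component V q y) (component V p x)))"

section \<open>Quotients of the tensor square\<close>

definition free_scale :: "'k::comm_ring_1 \<Rightarrow> ('b \<Rightarrow>\<^sub>0 'k) \<Rightarrow> ('b \<Rightarrow>\<^sub>0 'k)" where
  "free_scale c f = Poly_Mapping.map ((*) c) f"

text \<open>The free module on \<open>L \<times> L\<close>, and its generator for the pair \<open>(x, y)\<close>.\<close>

definition free_square :: "'a set \<Rightarrow> ('a \<times> 'a \<Rightarrow>\<^sub>0 'k::comm_ring_1) set" where
  "free_square L = {f. Poly_Mapping.keys f \<subseteq> L \<times> L}"

definition gen :: "'a \<Rightarrow> 'a \<Rightarrow> ('a \<times> 'a \<Rightarrow>\<^sub>0 'k::comm_ring_1)" where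
  "gen x y = Poly_Mapping.single (x, y) 1"

text \<open>
  Generators of the submodule \<open>T\<close> of the free module on \<open>L \<times> L\<close> whose quotient is the tensor
  square of the submodule \<open>L\<close>.
\<close>

definition bilinear_relations ::
    "('k::comm_ring_1 \<Rightarrow> 'a \<Rightarrow> 'a) \<Rightarrow> 'a::ab_group_add set \<Rightarrow> ('a \<times> 'a \<Rightarrow>\<^sub>0 'k) set" where
  "bilinear_relations sc L =
     {gen (x + x') y - gen x y - gen x' y | x x' y. x \<in> L \<and> x' \<in> L \<and> y \<in> L} \<union>
     {gen x (y + y') - gen x y - gen x y' | x y y'. x \<in> L \<and> y \<in> L \<and> y' \<in> L} \<union>
     {gen (sc c x) y - free_scale c (gen x y) | c x y. x \<in> L \<and> y \<in> L} \<union>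
     {gen x (sc c y) - free_scale c (gen x y) | c x y. x \<in> L \<and> y \<in> L}"

text \<open>
  Let \<open>S\<close> be a set of elements of the free module on \<open>L \<times> L\<close>, and \<open>T\<close> as above. The quotient of
  the tensor square of \<open>L\<close> by the span of the image of \<open>S\<close> is the quotient of the free module by
  \<open>T + span S\<close>. The following is the submodule of this quotient consisting of the classes of
  the elements of \<open>Z\<close>.
\<close>

definition tensor_square_subquotient ::
    "('k::comm_ring_1 \<Rightarrow> 'a \<Rightarrow> 'a) \<Rightarrow> 'a::ab_group_add set \<Rightarrow> ('a \<times> 'a \<Rightarrow>\<^sub>0 'k) set \<Rightarrow>
     ('a \<times> 'a \<Rightarrow>\<^sub>0 'k) set \<Rightarrow> ('k, ('a \<times> 'a \<Rightarrow>\<^sub>0 'k) set) module" where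
  "tensor_square_subquotient sc L S Z =
     quotient_module free_scale Z (module.span free_scale (bilinear_relations sc L \<union> S))"

text \<open>The linear extension of \<open>b\<close> to the free module: \<open>gen x y\<close> is sent to \<open>b x y\<close>.\<close>

definition free_lift ::
    "('k::comm_ring_1 \<Rightarrow> 'c \<Rightarrow> 'c) \<Rightarrow> ('a \<Rightarrow> 'a \<Rightarrow> 'c::ab_group_add) \<Rightarrow>
     ('a \<times> 'a \<Rightarrow>\<^sub>0 'k) \<Rightarrow> 'c" where
  "free_lift sc b f =
     (\<Sum>(x, y)\<in>Poly_Mapping.keys f. sc (Poly_Mapping.lookup f (x, y)) (b x y))"

section \<open>Second homology of a Lie superalgebra\<close>

text \<open>
  The Lie superalgebra is a submodule \<open>L\<close> of an ambient module with scalar multiplication \<open>sc\<close>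
  and grading \<open>V\<close>; its homogeneous parts are the sets \<open>L \<inter> V p\<close>, and its bracket is the
  restriction of \<open>br\<close>.
\<close>

definition lie_homology_relations ::
    "(bit \<Rightarrow> 'a set) \<Rightarrow> ('a \<Rightarrow> 'a \<Rightarrow> 'a) \<Rightarrow> 'a set \<Rightarrow> ('a \<times> 'a \<Rightarrow>\<^sub>0 'k::comm_ring_1) set" where
  "lie_homology_relations V br L =
     {gen x y + signed (p * q) (gen y x) | x y p q. x \<in> L \<inter> V p \<and> y \<in> L \<inter> V q} \<union>
     {signed (p * r) (gen (br x y) z) + signed (q * p) (gen (br y z) x)
        + signed (r * q) (gen (br z x) y) | x y z p q r.
        x \<in> L \<inter> V p \<and> y \<in> L \<inter> V q \<and> z \<in> L \<inter> V r}"

definition lie_H2 ::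
    "('k::comm_ring_1 \<Rightarrow> 'a \<Rightarrow> 'a) \<Rightarrow> (bit \<Rightarrow> 'a set) \<Rightarrow> ('a \<Rightarrow> 'a \<Rightarrow> 'a) \<Rightarrow>
     'a::ab_group_add set \<Rightarrow> ('k, ('a \<times> 'a \<Rightarrow>\<^sub>0 'k) set) module" where
  "lie_H2 sc V br L =
     tensor_square_subquotient sc L (lie_homology_relations V br L)
       {f \<in> free_square L. free_lift sc br f = 0}"

section \<open>First graded skew-dihedral homology\<close>

definition skew_dihedral_relations ::
    "(bit \<Rightarrow> 'r::ring_1 set) \<Rightarrow> ('r \<Rightarrow> 'r) \<Rightarrow> ('r \<times> 'r \<Rightarrow>\<^sub>0 'k::comm_ring_1) set" where
  "skew_dihedral_relations V bar =
     {gen a b - gen (bar a) (bar b) | a b. True} \<union>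
     {gen a b + signed (p * q) (gen b a) | a b p q. a \<in> V p \<and> b \<in> V q} \<union>
     {signed (p * r) (gen (a * b) c) + signed (p * q) (gen (b * c) a)
        + signed (q * r) (gen (c * a) b) | a b c p q r. a \<in> V p \<and> b \<in> V q \<and> c \<in> V r}"

definition skew_dihedral_HD1 ::
    "('k::comm_ring_1 \<Rightarrow> 'r \<Rightarrow> 'r) \<Rightarrow> (bit \<Rightarrow> 'r::ring_1 set) \<Rightarrow> ('r \<Rightarrow> 'r) \<Rightarrow>
     ('k, ('r \<times> 'r \<Rightarrow>\<^sub>0 'k) set) module" where
  "skew_dihedral_HD1 sc V bar =
     tensor_square_subquotient sc UNIV (skew_dihedral_relations V bar)
       {f. free_lift sc (supercommutator (*) V) f
           = free_lift sc (\<lambda>a b. bar (supercommutator (*) V a b)) f}"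

text \<open>The submodule $[R,R]R$.\<close>

definition commutator_ideal ::
    "('k::comm_ring_1 \<Rightarrow> 'r \<Rightarrow> 'r) \<Rightarrow> (bit \<Rightarrow> 'r::ring_1 set) \<Rightarrow> 'r set" where
  "commutator_ideal sc V = module.span sc {supercommutator (*) V a b * c | a b c. True}"

section \<open>The ortho-symplectic Lie superalgebra\<close>

text \<open>
  Matrices of size $m + 2n$ are indexed by \<open>'m + 'n + 'n\<close> with \<open>CARD('m) = m\<close> and
  \<open>CARD('n) = n\<close>, the three summands being the three blocks.
\<close>

type_synonym ('r, 'm, 'n) block_matrix = "'r^('m + 'n + 'n)^('m + 'n + 'n)"

definition index_parity :: "'m + 'n + 'n \<Rightarrow> bit" where
  "index_parity i = (case i of Inl _ \<Rightarrow> 0 | Inr _ \<Rightarrow> 1)"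

definition matrix_scale :: "('k \<Rightarrow> 'r \<Rightarrow> 'r) \<Rightarrow> 'k \<Rightarrow> 'r^'i^'j \<Rightarrow> 'r^'i^'j" where
  "matrix_scale sc c X = (\<chi> i j. sc c (X $ i $ j))"

definition matrix_grading ::
    "(bit \<Rightarrow> 'r set) \<Rightarrow> bit \<Rightarrow> ('r, 'm::finite, 'n::finite) block_matrix set" where
  "matrix_grading V p = {X. \<forall>i j. X $ i $ j \<in> V (p + index_parity i + index_parity j)}"

fun osp_entry ::
    "(bit \<Rightarrow> 'r::ring_1 set) \<Rightarrow> ('r \<Rightarrow> 'r) \<Rightarrow>
     ('r, 'm::finite, 'n::finite) block_matrix \<Rightarrow> 'm + 'n + 'n \<Rightarrow> 'm + 'n + 'n \<Rightarrow> 'r" where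
  "osp_entry V bar X (Inl i) (Inl j) = bar (X $ Inl j $ Inl i)"
| "osp_entry V bar X (Inl i) (Inr (Inl j)) = - bar (rho V (X $ Inr (Inr j) $ Inl i))"
| "osp_entry V bar X (Inl i) (Inr (Inr j)) = bar (rho V (X $ Inr (Inl j) $ Inl i))"
| "osp_entry V bar X (Inr (Inl i)) (Inl j) = bar (rho V (X $ Inl j $ Inr (Inr i)))"
| "osp_entry V bar X (Inr (Inl i)) (Inr (Inl j)) = bar (X $ Inr (Inr j) $ Inr (Inr i))"
| "osp_entry V bar X (Inr (Inl i)) (Inr (Inr j)) = - bar (X $ Inr (Inl j) $ Inr (Inr i))"
| "osp_entry V bar X (Inr (Inr i)) (Inl j) = - bar (rho V (X $ Inl j $ Inr (Inl i)))"
| "osp_entry V bar X (Inr (Inr i)) (Inr (Inl j)) = - bar (X $ Inr (Inr j) $ Inr (Inl i))"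
| "osp_entry V bar X (Inr (Inr i)) (Inr (Inr j)) = bar (X $ Inr (Inl j) $ Inr (Inl i))"

definition osp_tilde ::
    "(bit \<Rightarrow> 'r::ring_1 set) \<Rightarrow> ('r \<Rightarrow> 'r) \<Rightarrow>
     ('r, 'm::finite, 'n::finite) block_matrix set" where
  "osp_tilde V bar = {X. (\<chi> i j. osp_entry V bar X i j) = - X}"

definition matrix_bracket ::
    "(bit \<Rightarrow> 'r::ring_1 set) \<Rightarrow> ('r, 'm::finite, 'n::finite) block_matrix \<Rightarrow>
     ('r, 'm, 'n) block_matrix \<Rightarrow> ('r, 'm, 'n) block_matrix" where
  "matrix_bracket V = supercommutator (**) (matrix_grading V)"

definition osp ::
    "('k::comm_ring_1 \<Rightarrow> 'r \<Rightarrow> 'r) \<Rightarrow> (bit \<Rightarrow> 'r::ring_1 set) \<Rightarrow> ('r \<Rightarrow> 'r) \<Rightarrow>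
     ('r, 'm::finite, 'n::finite) block_matrix set" where
  "osp sc V bar =
     module.span (matrix_scale sc)
       {matrix_bracket V X Y | X Y. X \<in> osp_tilde V bar \<and> Y \<in> osp_tilde V bar}"

end

theory Submission
  imports
    Defs
    "HOL-Analysis.Cartesian_Space"
begin

text \<open>
  If \<open>e\<close> is odd, replace it by its square; so let \<open>e\<close> be even. On the Lie superalgebra \<open>L\<close> there are two
  explicit cocycles: the supertrace form with values in $\langle R,R\rangle_{\mathsf d}^-$, which is
  defined on all matrices, and the polarized determinant of the upper right $2 \times 2$ block with
  values in $R/[R,R]R$, which is a cocycle because supertraces of elements of \<open>L\<close> lie in $[R,R]R$.
  They define the map from the second homology. For its injectivity consider an arbitrary cocycle
  \<open>\<beta>\<close> on \<open>L\<close>. Its values on pairs of root vectors of weights $1$ and $-1$ are determined by the Jacobi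
  identity up to a coboundary and two parameters: a bilinear map that satisfies the relations of
  $\langle R,R\rangle_{\mathsf d}^-$, and, by the action of the skew central unit \<open>e\<close>, an additive map
  that kills $[R,R]R$. Hence on these pairs \<open>\<beta>\<close> is a coboundary plus a combination of the two explicit
  cocycles. The difference is a cocycle that vanishes on these pairs, and such a cocycle is zero
  because \<open>L\<close> is generated by its parts of weights $1$ and $-1$. The universal cocycle is of this form,
  which proves injectivity.
\<close>

section \<open>Quotients of abelian groups inside a type\<close>

text \<open>The universal cocycle takes values in the quotient of a free module by a span that
  depends on the data. The type representing this quotient has no scalar multiplication, so cocycles
  are only additive in each argument. Linearity over the ground ring is restored by linear maps
  between the free modules themselves. The unit \<open>e\<close> with inverse \<open>ei\<close>
  enters as follows. Replacing \<open>a\<close>, \<open>b\<close> by \<open>a * ei\<close>,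
  \<open>e * b\<close> keeps \<open>b * a\<close>, hence the bracket of \<open>xx i1 a\<close> and
  \<open>yy i2 b\<close>, but changes the sign of their determinant, as
  \<open>bar ei * e = - 1\<close>. The difference of the two pairs yields cycles for the summand
  R/[R,R]R, and the same replacement splits the values of a cocycle on such pairs into a part that
  is a coboundary and a part that factors through the determinant. The diagonal matrix
  \<open>TT\<close> with entries \<open>e\<close> and \<open>- e\<close> is a second torus element
  besides \<open>hh\<close>; it also covers the total weights 3 and -3, where \<open>hh\<close>
  alone would require division by 3. The factor 1/2 in the supertrace form comes from the two
  nonzero entries of a root vector of weight 1 or -1, which the involution exchanges.\<close>

definition add_subgroup :: "'a::ab_group_add set \<Rightarrow> bool" where
  "add_subgroup N \<longleftrightarrow> 0 \<in> N \<and> (\<forall>x\<in>N. \<forall>y\<in>N. x - y \<in> N)"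

lemma add_subgroup_zero: "add_subgroup N \<Longrightarrow> 0 \<in> N"
  by (simp add: add_subgroup_def)

lemma add_subgroup_diff: "add_subgroup N \<Longrightarrow> x \<in> N \<Longrightarrow> y \<in> N \<Longrightarrow> x - y \<in> N"
  by (simp add: add_subgroup_def)

lemma add_subgroup_minus: "add_subgroup N \<Longrightarrow> x \<in> N \<Longrightarrow> - x \<in> N"
  using add_subgroup_diff[OF _ add_subgroup_zero, of N x] by simp

lemma add_subgroup_add: "add_subgroup N \<Longrightarrow> x \<in> N \<Longrightarrow> y \<in> N \<Longrightarrow> x + y \<in> N"
  using add_subgroup_diff[OF _ _ add_subgroup_minus, of N x y] by simp

lemma add_subgroup_diff_diff:
  "add_subgroup N \<Longrightarrow> x - x' \<in> N \<Longrightarrow> y - y' \<in> N \<Longrightarrow> (x - y) - (x' - y') \<in> N"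
  using add_subgroup_diff[of N "x - x'" "y - y'"] by (simp add: algebra_simps)

lemma (in Modules.module) add_subgroup_subspace: "subspace N \<Longrightarrow> add_subgroup N"
  by (simp add: add_subgroup_def subspace_0 subspace_diff)

text \<open>
  A type cannot depend on a subgroup \<open>N\<close> that is a variable. The product of the quotients by all
  subgroups is a type, though, and the quotient by each \<open>N\<close> is one of its factors.
\<close>

quotient_type (overloaded) 'a all_quotients =
  "'a::ab_group_add set \<Rightarrow> 'a" / "\<lambda>f g. \<forall>N. add_subgroup N \<longrightarrow> f N - g N \<in> N"
proof (rule equivpI)
  show "reflp (\<lambda>f g :: 'a set \<Rightarrow> 'a. \<forall>N. add_subgroup N \<longrightarrow> f N - g N \<in> N)"
    by (simp add: reflp_def add_subgroup_zero)
  show "symp (\<lambda>f g :: 'a set \<Rightarrow> 'a. \<forall>N. add_subgroup N \<longrightarrow> f N - g N \<in> N)"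
    unfolding symp_def using add_subgroup_minus by fastforce
  show "transp (\<lambda>f g :: 'a set \<Rightarrow> 'a. \<forall>N. add_subgroup N \<longrightarrow> f N - g N \<in> N)"
    unfolding transp_def using add_subgroup_add by fastforce
qed

instantiation all_quotients :: (ab_group_add) ab_group_add
begin

lift_definition zero_all_quotients :: "'a all_quotients" is "\<lambda>N. 0" .

lift_definition plus_all_quotients :: "'a all_quotients \<Rightarrow> 'a all_quotients \<Rightarrow> 'a all_quotients"
  is "\<lambda>f g N. f N + g N"
  using add_subgroup_add by (fastforce simp: add_diff_add)

lift_definition uminus_all_quotients :: "'a all_quotients \<Rightarrow> 'a all_quotients"
  is "\<lambda>f N. - f N"
  using add_subgroup_minus by fastforce

lift_definition minus_all_quotients :: "'a all_quotients \<Rightarrow> 'a all_quotients \<Rightarrow> 'a all_quotients"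
  is "\<lambda>f g N. f N - g N"
  by (blast intro: add_subgroup_diff_diff)

instance
  by standard (transfer; simp add: add_subgroup_zero algebra_simps)+

end

text \<open>The embedding of the factor for \<open>N\<close> into the product of all quotients. The
  coordinates other than \<open>N\<close> are set to 0, so that for a subgroup \<open>N\<close> the
  kernel is exactly \<open>N\<close>.\<close>

lift_definition residue_class :: "'a::ab_group_add set \<Rightarrow> 'a \<Rightarrow> 'a all_quotients"
  is "\<lambda>N x M. if M = N then x else 0" .

lemma residue_class_add: "residue_class N (x + y) = residue_class N x + residue_class N y"
  by transfer (simp add: add_subgroup_zero)

lemma residue_class_diff: "residue_class N (x - y) = residue_class N x - residue_class N y"
  by transfer (simp add: add_subgroup_zero)

lemma residue_class_eq_0_iff: "add_subgroup N \<Longrightarrow> residue_class N x = 0 \<longleftrightarrow> x \<in> N"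
  by transfer (auto simp: add_subgroup_zero)

lemma residue_class_zero [simp]: "residue_class N 0 = 0"
  by transfer (simp add: add_subgroup_zero)

lemma residue_class_minus: "residue_class N (- x) = - residue_class N x"
  using residue_class_diff[of N 0 x] by simp

section \<open>Isomorphisms of subquotients\<close>

lemma in_elt_set_plus_iff: "z \<in> x +o N \<longleftrightarrow> z - x \<in> N" for x :: "'a::ab_group_add"
  by (auto simp: elt_set_plus_def) (metis add.commute diff_add_cancel)

lemma elt_set_plus_eq_iff:
  assumes "add_subgroup N"
  shows "x +o N = y +o N \<longleftrightarrow> x - y \<in> N"
proof
  assume "x +o N = y +o N"
  moreover have "x \<in> x +o N"
    using assms by (simp add: in_elt_set_plus_iff add_subgroup_zero)
  ultimately show "x - y \<in> N"
    by (simp add: in_elt_set_plus_iff)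
next
  assume xy: "x - y \<in> N"
  have "z - x \<in> N \<longleftrightarrow> z - y \<in> N" for z
    using add_subgroup_add[OF assms xy, of "z - x"] add_subgroup_diff[OF assms _ xy, of "z - y"]
    by auto
  then show "x +o N = y +o N"
    by (auto simp: in_elt_set_plus_iff)
qed

lemma elt_set_plus_add:
  assumes "add_subgroup N"
  shows "(x +o N) + (y +o N) = (x + y) +o N"
proof -
  have "N + N = N"
    using assms add_subgroup_add[OF assms] add_subgroup_zero[OF assms]
    by (auto simp: set_plus_def) force
  then show ?thesis
    by (simp add: set_plus_rearrange)
qed

lemma (in Modules.module) quotient_smult:
  assumes "subspace N"
  shows "(\<Union>z\<in>x +o N. scale c z +o N) = scale c x +o N"
proof -
  have "scale c z +o N = scale c x +o N" if "z \<in> x +o N" for z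
    using that subspace_scale[OF assms, of "z - x" c] elt_set_plus_eq_iff[OF add_subgroup_subspace[OF assms]]
    by (simp add: in_elt_set_plus_iff scale_right_diff_distrib)
  moreover have "x \<in> x +o N"
    using assms by (simp add: in_elt_set_plus_iff subspace_0)
  ultimately show ?thesis
    by blast
qed

text \<open>The first isomorphism theorem for the pair \<open>f1\<close>, \<open>f2\<close> on
  \<open>Z\<close>. Kernel and image are described on representatives, so that its application is a
  statement about elements of free modules and never about cosets.\<close>

lemma module_isomorphic_quotient_direct_sum:
  fixes sc :: "'k::comm_ring_1 \<Rightarrow> 'a::ab_group_add \<Rightarrow> 'a"
    and sc1 :: "'k \<Rightarrow> 'b::ab_group_add \<Rightarrow> 'b" and sc2 :: "'k \<Rightarrow> 'c::ab_group_add \<Rightarrow> 'c"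
  assumes hom1: "module_hom sc sc1 f1" and hom2: "module_hom sc sc2 f2"
    and N: "Modules.module.subspace sc N" and N1: "Modules.module.subspace sc1 N1"
    and N2: "Modules.module.subspace sc2 N2"
    and Z: "Modules.module.subspace sc Z"
    and f1: "\<And>z. z \<in> Z \<Longrightarrow> f1 z \<in> Z1" and f2: "\<And>z. z \<in> Z \<Longrightarrow> f2 z \<in> Z2"
    and ker: "\<And>z. z \<in> Z \<Longrightarrow> z \<in> N \<longleftrightarrow> f1 z \<in> N1 \<and> f2 z \<in> N2"
    and surj: "\<And>u v. u \<in> Z1 \<Longrightarrow> v \<in> Z2 \<Longrightarrow> \<exists>z\<in>Z. f1 z - u \<in> N1 \<and> f2 z - v \<in> N2"
  shows "module_isomorphic (quotient_module sc Z N)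
    (module_direct_sum (quotient_module sc1 Z1 N1) (quotient_module sc2 Z2 N2))"
proof -
  interpret f1: module_hom sc sc1 f1 by fact
  interpret f2: module_hom sc sc2 f2 by fact
  have aN: "add_subgroup N" "add_subgroup N1" "add_subgroup N2"
    by (rule f1.m1.add_subgroup_subspace[OF N] f1.m2.add_subgroup_subspace[OF N1]
      f2.m2.add_subgroup_subspace[OF N2])+
  \<comment> \<open>\<open>F\<close> picks a representative of the coset; by \<open>ker\<close> the
    result does not depend on the choice.\<close>
  define F where "F A = (let z = SOME z. z \<in> Z \<and> A = z +o N in (f1 z +o N1, f2 z +o N2))" for A
  have F: "F (z +o N) = (f1 z +o N1, f2 z +o N2)" if "z \<in> Z" for z
  proof -
    define z' where "z' = (SOME z'. z' \<in> Z \<and> z +o N = z' +o N)"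
    have "z' \<in> Z \<and> z +o N = z' +o N"
      unfolding z'_def by (rule someI[where x = z]) (simp add: that)
    then have "z - z' \<in> N" "z - z' \<in> Z"
      using aN that f1.m1.subspace_diff[OF Z] by (simp_all add: elt_set_plus_eq_iff)
    then have "f1 z - f1 z' \<in> N1" "f2 z - f2 z' \<in> N2"
      using ker by (auto simp flip: f1.diff f2.diff)
    then show ?thesis
      using aN unfolding F_def z'_def[symmetric] by (simp flip: elt_set_plus_eq_iff)
  qed
  let ?Q = "quotient_module sc Z N"
  let ?S = "module_direct_sum (quotient_module sc1 Z1 N1) (quotient_module sc2 Z2 N2)"
  have "F \<in> iso (add_monoid ?Q) (add_monoid ?S)"
  proof (rule isoI)
    show "F \<in> hom (add_monoid ?Q) (add_monoid ?S)"
    proof (rule homI)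
      fix A assume "A \<in> carrier (add_monoid ?Q)"
      then show "F A \<in> carrier (add_monoid ?S)"
        using f1 f2 by (auto simp: quotient_module_def module_direct_sum_def F)
    next
      fix A B assume "A \<in> carrier (add_monoid ?Q)" "B \<in> carrier (add_monoid ?Q)"
      then obtain x y where "x \<in> Z" "A = x +o N" "y \<in> Z" "B = y +o N"
        by (auto simp: quotient_module_def)
      then show "F (A \<otimes>\<^bsub>add_monoid ?Q\<^esub> B) = F A \<otimes>\<^bsub>add_monoid ?S\<^esub> F B"
        using aN f1.m1.subspace_add[OF Z]
        by (simp add: quotient_module_def module_direct_sum_def F elt_set_plus_add f1.add f2.add)
    qed
    show "bij_betw F (carrier (add_monoid ?Q)) (carrier (add_monoid ?S))"
    proof (rule bij_betwI')
      fix A B assume "A \<in> carrier (add_monoid ?Q)" "B \<in> carrier (add_monoid ?Q)"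
      then obtain x y where xy: "x \<in> Z" "A = x +o N" "y \<in> Z" "B = y +o N"
        by (auto simp: quotient_module_def)
      moreover have "x - y \<in> Z"
        using xy f1.m1.subspace_diff[OF Z] by blast
      ultimately show "F A = F B \<longleftrightarrow> A = B"
        using aN ker[of "x - y"] by (simp add: F elt_set_plus_eq_iff f1.diff f2.diff)
    next
      fix A assume "A \<in> carrier (add_monoid ?Q)"
      then show "F A \<in> carrier (add_monoid ?S)"
        using f1 f2 by (auto simp: quotient_module_def module_direct_sum_def F)
    next
      fix B assume "B \<in> carrier (add_monoid ?S)"
      then obtain u v where "u \<in> Z1" "v \<in> Z2" and B: "B = (u +o N1, v +o N2)"
        by (auto simp: quotient_module_def module_direct_sum_def)
      then obtain z where "z \<in> Z" "f1 z - u \<in> N1" "f2 z - v \<in> N2"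
        using surj by blast
      then show "\<exists>A\<in>carrier (add_monoid ?Q). B = F A"
        using aN by (intro bexI[of _ "z +o N"])
          (auto simp: quotient_module_def B F elt_set_plus_eq_iff[symmetric])
    qed
  qed
  moreover have "F (c \<odot>\<^bsub>?Q\<^esub> A) = c \<odot>\<^bsub>?S\<^esub> F A" if A: "A \<in> carrier ?Q" for c A
  proof -
    obtain x where "x \<in> Z" "A = x +o N"
      using A by (auto simp: quotient_module_def)
    then show ?thesis
      using f1.m1.subspace_scale[OF Z]
      by (simp add: quotient_module_def module_direct_sum_def F f1.m1.quotient_smult[OF N]
          f1.m2.quotient_smult[OF N1] f2.m2.quotient_smult[OF N2] f1.scale f2.scale)
  qed
  ultimately show ?thesis
    unfolding module_isomorphic_def by blast
qed

section \<open>Free modules on pairs\<close>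

lemma lookup_free_scale [simp]: "Poly_Mapping.lookup (free_scale c f) x = c * Poly_Mapping.lookup f x"
  unfolding free_scale_def by (rule Poly_Mapping.map.rep_eq[THEN fun_cong, THEN trans]) (simp add: when_def)

lemma module_free_scale: "Modules.module (free_scale :: 'k::comm_ring_1 \<Rightarrow> ('b \<Rightarrow>\<^sub>0 'k) \<Rightarrow> _)"
  by standard (auto intro!: poly_mapping_eqI simp: lookup_add algebra_simps)

global_interpretation free: Modules.module "free_scale :: 'k::comm_ring_1 \<Rightarrow> ('b \<Rightarrow>\<^sub>0 'k) \<Rightarrow> _"
  by (rule module_free_scale)

lemma free_scale_gen: "free_scale c (gen x y) = Poly_Mapping.single (x, y) c"
  by (rule poly_mapping_eqI) (simp add: gen_def lookup_single when_def)

lemma free_square_expand: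
  "f = (\<Sum>(x, y)\<in>Poly_Mapping.keys f. free_scale (Poly_Mapping.lookup f (x, y)) (gen x y))"
  for f :: "'a \<times> 'a \<Rightarrow>\<^sub>0 'k::comm_ring_1"
proof (rule poly_mapping_eqI)
  fix k
  have "Poly_Mapping.lookup (\<Sum>(x, y)\<in>Poly_Mapping.keys f. free_scale (Poly_Mapping.lookup f (x, y)) (gen x y)) k
      = (\<Sum>x\<in>Poly_Mapping.keys f. if x = k then Poly_Mapping.lookup f k else 0)"
    unfolding lookup_sum by (rule sum.cong)
      (auto simp: free_scale_gen lookup_single when_def split: prod.splits)
  also have "\<dots> = Poly_Mapping.lookup f k"
    by (simp add: in_keys_iff)
  finally show "Poly_Mapping.lookup f k = Poly_Mapping.lookup (\<Sum>(x, y)\<in>Poly_Mapping.keys f.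
      free_scale (Poly_Mapping.lookup f (x, y)) (gen x y)) k" ..
qed

context Modules.module
begin

text \<open>The supports of \<open>f\<close>, \<open>g\<close> and \<open>f + g\<close> differ, so
  additivity is checked on a common finite set of indices, where the extra terms vanish.\<close>

lemma free_lift_superset:
  assumes "finite K" "Poly_Mapping.keys f \<subseteq> K"
  shows "free_lift scale b f = (\<Sum>(x, y)\<in>K. scale (Poly_Mapping.lookup f (x, y)) (b x y))"
  unfolding free_lift_def using assms
  by (intro sum.mono_neutral_left) (auto simp: in_keys_iff)

lemma module_hom_free_lift: "module_hom free_scale scale (free_lift scale b)"
proof -
  have add: "free_lift scale b (f + g) = free_lift scale b f + free_lift scale b g" for f g
  proof -
    let ?K = "Poly_Mapping.keys f \<union> Poly_Mapping.keys g"
    have "free_lift scale b (f + g) = (\<Sum>(x, y)\<in>?K. scale (Poly_Mapping.lookup (f + g) (x, y)) (b x y))"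
      by (rule free_lift_superset) (auto intro!: keys_add)
    also have "\<dots> = free_lift scale b f + free_lift scale b g"
      by (subst (1 2) free_lift_superset[where K = ?K])
        (auto simp: lookup_add scale_left_distrib sum.distrib case_prod_unfold)
    finally show ?thesis .
  qed
  have "free_lift scale b (free_scale c f) = scale c (free_lift scale b f)" for c f
  proof -
    have "free_lift scale b (free_scale c f)
        = (\<Sum>(x, y)\<in>Poly_Mapping.keys f. scale (Poly_Mapping.lookup (free_scale c f) (x, y)) (b x y))"
      by (rule free_lift_superset) (auto simp: in_keys_iff)
    then show ?thesis
      by (simp add: free_lift_def scale_sum_right case_prod_unfold)
  qed
  with add show ?thesis
    by unfold_locales (auto simp: free.scale_right_distrib free.scale_left_distrib scale_right_distrib scale_left_distrib)
qed

lemma free_lift_gen [simp]: "free_lift scale b (gen x y) = b x y"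
  by (subst free_lift_superset[of "{(x, y)}"]) (auto simp: gen_def)

end

section \<open>Signs and gradings\<close>

declare add_bit_eq_xor [simp del] mult_bit_eq_and [simp del]

lemma bit_add_self [simp]: "p + p = 0" "p + (p + q) = q" for p q :: bit
  by (cases p; cases q; simp)+

lemma signed_0 [simp]: "signed 0 x = x" and signed_1 [simp]: "signed 1 x = - x"
  by (simp_all add: signed_def)

lemma signed_zero [simp]: "signed p 0 = 0"
  by (simp add: signed_def)

lemma signed_add: "signed p (x + y) = signed p x + signed p y" for x :: "'a::ab_group_add"
  by (simp add: signed_def)

lemma signed_minus: "signed p (- x) = - signed p x"
  by (simp add: signed_def)

lemma signed_diff: "signed p (x - y) = signed p x - signed p y" for x :: "'a::ab_group_add"
  by (simp add: signed_def)

lemma signed_signed: "signed p (signed q x) = signed (p + q) x"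
  by (cases p; cases q) simp_all

lemma signed_mult_left: "signed p x * y = signed p (x * y)"
  and signed_mult_right: "x * signed p y = signed p (x * y)" for x :: "'a::ring_1"
  by (simp_all add: signed_def)

lemma signed_sum: "signed p (sum f A) = (\<Sum>x\<in>A. signed p (f x))" for f :: "_ \<Rightarrow> 'a::ab_group_add"
  by (cases p) (simp_all add: sum_negf)

lemma signed_eq_iff: "signed p x = signed p y \<longleftrightarrow> x = y"
  by (cases p) simp_all

text \<open>Scalars are absent because the values of a cocycle lie in a type without scalar
  multiplication; signs are the only factors that are pulled out.\<close>

definition biadditive :: "('a::ab_group_add \<Rightarrow> 'b::ab_group_add \<Rightarrow> 'c::ab_group_add) \<Rightarrow> bool" where
  "biadditive f \<longleftrightarrow> (\<forall>x x' y. f (x + x') y = f x y + f x' y) \<and> (\<forall>x y y'. f x (y + y') = f x y + f x y')"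

lemma biadditive_simps:
  assumes "biadditive f"
  shows "f (x + x') y = f x y + f x' y" "f x (y + y') = f x y + f x y'"
    "f 0 y = 0" "f x 0 = 0" "f (- x) y = - f x y" "f x (- y) = - f x y"
    "f (x - x') y = f x y - f x' y" "f x (y - y') = f x y - f x y'"
    "f (signed p x) y = signed p (f x y)" "f x (signed p y) = signed p (f x y)"
proof -
  interpret l: additive "\<lambda>x. f x y" for y
    using assms by unfold_locales (simp add: biadditive_def)
  interpret r: additive "f x" for x
    using assms by unfold_locales (simp add: biadditive_def)
  show "f (x + x') y = f x y + f x' y" "f x (y + y') = f x y + f x y'"
    "f 0 y = 0" "f x 0 = 0" "f (- x) y = - f x y" "f x (- y) = - f x y"
    "f (x - x') y = f x y - f x' y" "f x (y - y') = f x y - f x y'"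
    "f (signed p x) y = signed p (f x y)" "f x (signed p y) = signed p (f x y)"
    by (simp_all add: l.add r.add l.zero r.zero l.minus r.minus l.diff r.diff signed_def)
qed

text \<open>Used for \<open>R\<close> and for the matrices over it, whose grading is shifted by the
  parities of the indices.\<close>

locale graded =
  fixes V :: "bit \<Rightarrow> 'a::ab_group_add set"
  assumes subgroup_V: "add_subgroup (V p)"
    and disjoint_V: "V 0 \<inter> V 1 = {0}"
    and sum_V: "\<exists>y\<in>V 0. \<exists>z\<in>V 1. x = y + z"
begin

lemmas zero_V [simp] = add_subgroup_zero[OF subgroup_V]
lemmas add_V = add_subgroup_add[OF subgroup_V]
lemmas diff_V = add_subgroup_diff[OF subgroup_V]
lemmas minus_V = add_subgroup_minus[OF subgroup_V]

lemma signed_V: "x \<in> V p \<Longrightarrow> signed q x \<in> V p"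
  by (simp add: signed_def minus_V)

lemma zero_if_opposite: "x \<in> V p \<Longrightarrow> x \<in> V (p + 1) \<Longrightarrow> x = 0"
  using disjoint_V by (cases p) auto

lemma component_eqI:
  assumes "y \<in> V p" "x - y \<in> V (p + 1)"
  shows "component V p x = y"
  unfolding component_def
proof (rule the_equality)
  fix y' assume y': "y' \<in> V p \<and> x - y' \<in> V (p + 1)"
  have "y' - y \<in> V p"
    using assms y' diff_V by blast
  moreover have "(x - y) - (x - y') \<in> V (p + 1)"
    using assms y' diff_V by blast
  ultimately show "y' = y"
    using zero_if_opposite[of "y' - y"] by (simp add: algebra_simps)
qed (use assms in blast)

lemma component_props: "component V p x \<in> V p" "x - component V p x \<in> V (p + 1)"
proof -
  obtain y z where yz: "y \<in> V 0" "z \<in> V 1" "x = y + z"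
    using sum_V by blast
  then have "\<exists>y. y \<in> V p \<and> x - y \<in> V (p + 1)"
    by (cases p) (auto intro: exI[of _ y] exI[of _ z])
  then obtain y where y: "y \<in> V p" "x - y \<in> V (p + 1)"
    by blast
  then show "component V p x \<in> V p" "x - component V p x \<in> V (p + 1)"
    using component_eqI[OF y] by auto
qed

lemma component_homogeneous: "x \<in> V p \<Longrightarrow> component V q x = (if q = p then x else 0)"
  by (cases p; cases q) (auto intro!: component_eqI simp: one_add_one)

lemma component_add: "component V p (x + y) = component V p x + component V p y"
  using add_V[OF component_props(2)[where x = x] component_props(2)[where x = y]] component_props(1)
  by (intro component_eqI add_V) (auto simp: add_diff_add)

lemma component_sum: "component V 0 x + component V 1 x = x"
  using component_props[where p = 0 and x = x] component_eqI[of "x - component V 0 x" 1 x] by simp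

sublocale component: additive "component V p" for p
  by unfold_locales (rule component_add)

text \<open>Signs are explicit for homogeneous arguments only; an identity that is additive in an
  argument is reduced to them by this rule, one argument at a time.\<close>

lemma homogeneous_induct [case_names homogeneous add]:
  assumes "\<And>p x. x \<in> V p \<Longrightarrow> P x" and "\<And>x y. P x \<Longrightarrow> P y \<Longrightarrow> P (x + y)"
  shows "P x"
proof -
  have "P (component V 0 x + component V 1 x)"
    using assms component_props(1) by blast
  then show ?thesis
    by (simp add: component_sum)
qed

lemma rho_homogeneous: "x \<in> V p \<Longrightarrow> rho V x = signed p x"
  by (cases p) (simp_all add: rho_def component_homogeneous)

sublocale rho: additive "rho V"
  by unfold_locales (simp add: rho_def component_add)

lemma rho_V: "x \<in> V p \<Longrightarrow> rho V x \<in> V p"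
  by (simp add: rho_homogeneous signed_V)

lemma rho_rho [simp]: "rho V (rho V x) = x"
proof (induction x rule: homogeneous_induct)
  case (homogeneous p x)
  then show ?case
    by (cases p) (simp_all add: rho_homogeneous rho.minus)
qed (simp add: rho.add)

lemma supercommutator_homogeneous:
  assumes "biadditive mul" "x \<in> V p" "y \<in> V q"
  shows "supercommutator mul V x y = mul x y - signed (p * q) (mul y x)"
  unfolding supercommutator_def using assms
  by (cases p; cases q) (simp_all add: component_homogeneous biadditive_simps[OF assms(1)])

lemma biadditive_supercommutator:
  assumes "biadditive mul"
  shows "biadditive (supercommutator mul V)"
  unfolding biadditive_def supercommutator_def
  by (simp add: component_add biadditive_simps[OF assms] signed_add sum.distrib algebra_simps)

lemma supercommutator_swap:
  assumes "biadditive mul" "x \<in> V p" "y \<in> V q"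
  shows "supercommutator mul V y x = - signed (p * q) (supercommutator mul V x y)"
  using assms by (cases p; cases q) (simp_all add: supercommutator_homogeneous)

end

section \<open>Superalgebras with superinvolution\<close>

context superalgebra
begin

sublocale graded V
  using subspace_V V_disjoint V_sum by unfold_locales (auto intro: add_subgroup_subspace)

lemma biadditive_mult: "biadditive ((*) :: 'r \<Rightarrow> 'r \<Rightarrow> 'r)"
  by (simp add: biadditive_def algebra_simps)

lemma scale_V: "x \<in> V p \<Longrightarrow> sc c x \<in> V p"
  using subspace_V subspace_scale by blast

lemma component_scale: "component V p (sc c x) = sc c (component V p x)"
  using scale_V[OF component_props(2)[where x = x]] component_props(1)
  by (intro component_eqI scale_V) (auto simp: scale_right_diff_distrib)

lemma rho_scale: "rho V (sc c x) = sc c (rho V x)"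
  by (simp add: rho_def component_scale scale_right_diff_distrib)

abbreviation scomm :: "'r \<Rightarrow> 'r \<Rightarrow> 'r" where
  "scomm \<equiv> supercommutator (*) V"

lemmas biadditive_scomm = biadditive_supercommutator[OF biadditive_mult]
lemmas scomm_simps = biadditive_simps[OF biadditive_scomm]
lemmas scomm_homogeneous = supercommutator_homogeneous[OF biadditive_mult]

lemma scomm_scale_left: "scomm (sc c x) y = sc c (scomm x y)"
  by (simp add: supercommutator_def component_scale scale_mult_left scale_mult_right
      scale_right_distrib scale_right_diff_distrib)

lemma scomm_V: "x \<in> V p \<Longrightarrow> y \<in> V q \<Longrightarrow> scomm x y \<in> V (p + q)"
  using V_mult[of x p y q] V_mult[of y q x p]
  unfolding scomm_homogeneous by (intro diff_V signed_V) (simp_all add: add.commute)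

end

context superinvolution
begin

sublocale bar: module_hom sc sc bar
  by (rule bar_linear)

lemma bar_one [simp]: "bar 1 = 1"
  using bar_mult[OF bar_V[OF V_one] V_one] by (simp add: bar_bar)

lemma bar_signed: "bar (signed p x) = signed p (bar x)"
  by (simp add: signed_def bar.neg)

lemma bar_rho: "bar (rho V x) = rho V (bar x)"
proof (induction x rule: homogeneous_induct)
  case (homogeneous p x)
  then show ?case
    by (simp add: rho_homogeneous rho_homogeneous[OF bar_V] bar_signed)
qed (simp add: rho.add bar.add)

text \<open>Reversing the factors turns a supercommutator into its negative. Hence
  \<open>scomm a b - bar (scomm a b)\<close> is itself a sum of two supercommutators.\<close>

lemma bar_scomm: "bar (scomm x y) = - scomm (bar x) (bar y)"
proof (induction x rule: homogeneous_induct)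
  case (homogeneous p x)
  then show ?case
  proof (induction y rule: homogeneous_induct)
    case (homogeneous q y)
    then show ?case
      using scomm_homogeneous[OF bar_V bar_V, of x p y q]
      by (cases p; cases q) (simp_all add: scomm_homogeneous bar_mult bar.diff bar.add)
  qed (simp add: scomm_simps bar.add)
qed (simp add: scomm_simps bar.add)

end

section \<open>Matrices of size 2|2\<close>

type_synonym idx = "2 + 1 + 1"
type_synonym 'r mat22 = "('r, 2, 1) block_matrix"

definition i1 :: idx where "i1 = Inl 1"
definition i2 :: idx where "i2 = Inl 2"
definition i3 :: idx where "i3 = Inr (Inl 1)"
definition i4 :: idx where "i4 = Inr (Inr 1)"

lemma idx_distinct [simp]:
  "i1 \<noteq> i2" "i1 \<noteq> i3" "i1 \<noteq> i4" "i2 \<noteq> i1" "i2 \<noteq> i3" "i2 \<noteq> i4"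
  "i3 \<noteq> i1" "i3 \<noteq> i2" "i3 \<noteq> i4" "i4 \<noteq> i1" "i4 \<noteq> i2" "i4 \<noteq> i3"
  by (simp_all add: i1_def i2_def i3_def i4_def)

lemma UNIV_idx: "UNIV = {i1, i2, i3, i4}"
proof -
  have "i \<in> {i1, i2, i3, i4}" for i
  proof (cases i)
    case (Inl a)
    then show ?thesis
      using exhaust_2[of a] by (auto simp: i1_def i2_def)
  next
    case (Inr b)
    then show ?thesis
      by (cases b) (auto simp: i3_def i4_def)
  qed
  then show ?thesis
    by blast
qed

lemma all_idx: "(\<forall>i::idx. P i) \<longleftrightarrow> P i1 \<and> P i2 \<and> P i3 \<and> P i4"
proof -
  have "(\<forall>i::idx. P i) \<longleftrightarrow> (\<forall>i\<in>{i1, i2, i3, i4}. P i)"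
    unfolding UNIV_idx[symmetric] by simp
  then show ?thesis
    by simp
qed

lemma sum_idx: "(\<Sum>i\<in>UNIV. f i) = f i1 + f i2 + f i3 + f (i4 :: idx)"
  for f :: "idx \<Rightarrow> 'a::comm_monoid_add"
  unfolding UNIV_idx by (simp add: add.assoc)

lemma idx_cases: "(i = i1 \<Longrightarrow> P) \<Longrightarrow> (i = i2 \<Longrightarrow> P) \<Longrightarrow> (i = i3 \<Longrightarrow> P) \<Longrightarrow> (i = i4 \<Longrightarrow> P) \<Longrightarrow> P"
  for i :: idx
  using UNIV_idx by blast

lemma index_parity_idx [simp]:
  "index_parity i1 = 0" "index_parity i2 = 0" "index_parity i3 = 1" "index_parity i4 = 1"
  by (simp_all add: index_parity_def i1_def i2_def i3_def i4_def)

lemma mat22_eq_iff: "X = Y \<longleftrightarrow>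
    X $ i1 $ i1 = Y $ i1 $ i1 \<and> X $ i1 $ i2 = Y $ i1 $ i2 \<and> X $ i1 $ i3 = Y $ i1 $ i3 \<and> X $ i1 $ i4 = Y $ i1 $ i4 \<and>
    X $ i2 $ i1 = Y $ i2 $ i1 \<and> X $ i2 $ i2 = Y $ i2 $ i2 \<and> X $ i2 $ i3 = Y $ i2 $ i3 \<and> X $ i2 $ i4 = Y $ i2 $ i4 \<and>
    X $ i3 $ i1 = Y $ i3 $ i1 \<and> X $ i3 $ i2 = Y $ i3 $ i2 \<and> X $ i3 $ i3 = Y $ i3 $ i3 \<and> X $ i3 $ i4 = Y $ i3 $ i4 \<and>
    X $ i4 $ i1 = Y $ i4 $ i1 \<and> X $ i4 $ i2 = Y $ i4 $ i2 \<and> X $ i4 $ i3 = Y $ i4 $ i3 \<and> X $ i4 $ i4 = Y $ i4 $ i4"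
  for X Y :: "'r mat22"
  unfolding vec_eq_iff all_idx by (simp only: conj_assoc)

definition munit :: "idx \<Rightarrow> idx \<Rightarrow> 'r::ring_1 \<Rightarrow> 'r mat22" where
  "munit i j a = (\<chi> k l. if k = i \<and> l = j then a else 0)"

lemma munit_nth: "munit i j a $ k $ l = (if k = i \<and> l = j then a else 0)"
  by (simp add: munit_def)

lemma munit_add: "munit i j (a + b) = munit i j a + munit i j b"
  and munit_minus: "munit i j (- a) = - munit i j a"
  and munit_diff: "munit i j (a - b) = munit i j a - munit i j b"
  and munit_zero [simp]: "munit i j 0 = 0"
  and munit_signed: "munit i j (signed p a) = signed p (munit i j a)"
  by (simp_all add: vec_eq_iff munit_nth signed_def)

lemma munit_mult: "munit i j a ** munit k l b = (if j = k then munit i l (a * b) else 0)"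
proof -
  have "(munit i j a ** munit k l b) $ r $ s = (if j = k then munit i l (a * b) else 0) $ r $ s" for r s
    unfolding matrix_matrix_mult_def by (auto simp: munit_nth sum_idx intro: idx_cases[of k])
  then show ?thesis
    by (simp add: vec_eq_iff)
qed

lemma biadditive_matrix_mult: "biadditive ((**) :: 'r::ring_1^'n^'m \<Rightarrow> 'r^'p^'n \<Rightarrow> _)"
  unfolding biadditive_def
  by (simp add: matrix_matrix_mult_def vec_eq_iff algebra_simps sum.distrib)

lemmas matrix_mult_simps = biadditive_simps[OF biadditive_matrix_mult]

lemma signed_nth: "signed p X $ i = signed p (X $ i)"
  by (simp add: signed_def)

context superalgebra
begin

sublocale mat: Modules.module "matrix_scale sc :: 'k \<Rightarrow> 'r^'i^'j \<Rightarrow> _"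
  by unfold_locales (simp_all add: matrix_scale_def vec_eq_iff scale_right_distrib scale_left_distrib)

abbreviation msc :: "'k \<Rightarrow> 'r^'i^'j \<Rightarrow> 'r^'i^'j" where
  "msc \<equiv> matrix_scale sc"

abbreviation MG :: "bit \<Rightarrow> 'r mat22 set" where
  "MG \<equiv> matrix_grading V"

abbreviation br :: "'r mat22 \<Rightarrow> 'r mat22 \<Rightarrow> 'r mat22" where
  "br \<equiv> matrix_bracket V"

sublocale MG: graded MG
proof
  show "add_subgroup (MG p)" for p
    by (simp add: add_subgroup_def matrix_grading_def diff_V)
  show "MG 0 \<inter> MG 1 = {0}"
  proof -
    have "X $ i $ j = 0" if "X \<in> MG 0" "X \<in> MG 1" for X i j
      using that zero_if_opposite[of "X $ i $ j" "index_parity i + index_parity j"]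
      by (simp add: matrix_grading_def ac_simps)
    moreover have "0 \<in> MG p" for p
      by (simp add: matrix_grading_def)
    ultimately show ?thesis
      by (auto simp: vec_eq_iff)
  qed
  show "\<exists>Y\<in>MG 0. \<exists>Z\<in>MG 1. X = Y + Z" for X :: "'r mat22"
  proof -
    define C where "C p = (\<chi> i j. component V (p + index_parity i + index_parity j) (X $ i $ j))" for p
    have "C p \<in> MG p" for p
      by (simp add: C_def matrix_grading_def component_props)
    moreover have "X = C 0 + C 1"
    proof -
      have "component V q x + component V (1 + q) x = x" for q x
        using component_sum[of x] by (cases q) (simp_all add: add.commute)
      then show ?thesis
        by (simp add: C_def vec_eq_iff add.assoc)
    qed
    ultimately show ?thesis
      by blast
  qed
qed

lemma component_MG_nth:
  "component MG p X $ i $ j = component V (p + index_parity i + index_parity j) (X $ i $ j)"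
proof -
  have "component MG p X = (\<chi> i j. component V (p + index_parity i + index_parity j) (X $ i $ j))"
    using component_props(2)[where p = "p + r" for r]
    by (intro MG.component_eqI) (simp_all add: matrix_grading_def component_props add.assoc add.commute[of _ "1::bit"])
  then show ?thesis
    by simp
qed

lemma MG_nth: "X \<in> MG p \<Longrightarrow> X $ i $ j \<in> V (p + index_parity i + index_parity j)"
  by (simp add: matrix_grading_def)

lemma munit_MG: "a \<in> V (p + index_parity i + index_parity j) \<Longrightarrow> munit i j a \<in> MG p"
  by (auto simp: matrix_grading_def munit_nth)

lemma mult_MG: "X \<in> MG p \<Longrightarrow> Y \<in> MG q \<Longrightarrow> X ** Y \<in> MG (p + q)"
proof -
  assume X: "X \<in> MG p" and Y: "Y \<in> MG q"
  have "X $ i $ k * Y $ k $ j \<in> V (p + q + index_parity i + index_parity j)" for i j k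
    using V_mult[OF MG_nth[OF X, of i k] MG_nth[OF Y, of k j]]
    by (cases "index_parity k") (simp_all add: ac_simps)
  then show ?thesis
    by (simp add: matrix_grading_def matrix_matrix_mult_def sum_idx add_V)
qed

lemma component_MG_scale: "component MG p (msc c X) = msc c (component MG p X)"
  by (simp add: vec_eq_iff component_MG_nth matrix_scale_def component_scale)

lemma mult_scale_left: "msc c X ** Y = msc c (X ** Y)"
  and mult_scale_right: "X ** msc c Y = msc c (X ** Y)" for X Y :: "'r mat22"
  by (simp_all add: vec_eq_iff matrix_matrix_mult_def matrix_scale_def scale_sum_right
      scale_mult_left scale_mult_right)

lemma biadditive_br: "biadditive br"
  unfolding matrix_bracket_def by (rule MG.biadditive_supercommutator[OF biadditive_matrix_mult])

lemmas br_simps = biadditive_simps[OF biadditive_br]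

lemma br_homogeneous: "X \<in> MG p \<Longrightarrow> Y \<in> MG q \<Longrightarrow> br X Y = X ** Y - signed (p * q) (Y ** X)"
  unfolding matrix_bracket_def by (rule MG.supercommutator_homogeneous[OF biadditive_matrix_mult])

lemma br_swap: "X \<in> MG p \<Longrightarrow> Y \<in> MG q \<Longrightarrow> br Y X = - signed (p * q) (br X Y)"
  unfolding matrix_bracket_def by (rule MG.supercommutator_swap[OF biadditive_matrix_mult])

lemma br_MG: "X \<in> MG p \<Longrightarrow> Y \<in> MG q \<Longrightarrow> br X Y \<in> MG (p + q)"
  using mult_MG[of X p Y q] mult_MG[of Y q X p]
  unfolding br_homogeneous by (intro MG.diff_V MG.signed_V) (simp_all add: add.commute)

lemma br_scale_left: "br (msc c X) Y = msc c (br X Y)"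
  by (simp add: matrix_bracket_def supercommutator_def component_MG_scale mult_scale_left
      mult_scale_right mat.scale_right_distrib mat.scale_right_diff_distrib)

lemma br_jacobi:
  assumes "X \<in> MG p" "Y \<in> MG q" "Z \<in> MG r"
  shows "br X (br Y Z) = br (br X Y) Z + signed (p * q) (br Y (br X Z))"
  using assms br_MG[OF assms(1,2)] br_MG[OF assms(1,3)] br_MG[OF assms(2,3)]
  by (cases p; cases q; cases r)
    (simp_all add: br_homogeneous mult_MG matrix_mult_simps matrix_mul_assoc MG.diff_V MG.signed_V)

end

section \<open>The orthosymplectic Lie superalgebra of type 2|2\<close>

lemma osp_entry_idx:
  fixes X :: "'r::ring_1 mat22"
  shows "k \<in> {i1, i2} \<Longrightarrow> l \<in> {i1, i2} \<Longrightarrow> osp_entry V bar X k l = bar (X $ l $ k)"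
    "k \<in> {i1, i2} \<Longrightarrow> osp_entry V bar X k i3 = - bar (rho V (X $ i4 $ k))"
    "k \<in> {i1, i2} \<Longrightarrow> osp_entry V bar X k i4 = bar (rho V (X $ i3 $ k))"
    "k \<in> {i1, i2} \<Longrightarrow> osp_entry V bar X i3 k = bar (rho V (X $ k $ i4))"
    "k \<in> {i1, i2} \<Longrightarrow> osp_entry V bar X i4 k = - bar (rho V (X $ k $ i3))"
    "osp_entry V bar X i3 i3 = bar (X $ i4 $ i4)" "osp_entry V bar X i3 i4 = - bar (X $ i3 $ i4)"
    "osp_entry V bar X i4 i3 = - bar (X $ i4 $ i3)" "osp_entry V bar X i4 i4 = bar (X $ i3 $ i3)"
  by (auto simp: i1_def i2_def i3_def i4_def)

lemma osp_tilde_iff_entry: "X \<in> osp_tilde V bar \<longleftrightarrow> (\<forall>i j. osp_entry V bar X i j = - X $ i $ j)"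
  by (simp add: osp_tilde_def vec_eq_iff)

text \<open>
  Writing $i^*$ for the index dual to $i$, the involution of the matrix superalgebra is
  $X \mapsto \pm\overline{X_{j^* i^*}}$ for homogeneous \<open>X\<close>, with a sign that depends on the degrees
  and on the symplectic form through \<open>symplectic_sign\<close>.
\<close>

definition dual_idx :: "idx \<Rightarrow> idx" where
  "dual_idx i = (if i = i3 then i4 else if i = i4 then i3 else i)"

definition symplectic_sign :: "idx \<Rightarrow> bit" where
  "symplectic_sign i = (if i = i4 then 1 else 0)"

text \<open>The summand with \<open>p\<close> comes from \<open>rho\<close>, which acts on entries
  of degree \<open>p + 1\<close> in the blocks of mixed parity. The constant 1 of that degree and
  the fixed signs of the nine blocks make up the other summands.\<close>

definition osp_sign :: "bit \<Rightarrow> idx \<Rightarrow> idx \<Rightarrow> bit" where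
  "osp_sign p i j = index_parity i * index_parity j + index_parity i
     + (index_parity i + index_parity j) * p + symplectic_sign i + symplectic_sign j"

lemma dual_idx_simps [simp]:
  "dual_idx i1 = i1" "dual_idx i2 = i2" "dual_idx i3 = i4" "dual_idx i4 = i3"
  by (simp_all add: dual_idx_def)

lemma index_parity_dual [simp]: "index_parity (dual_idx i) = index_parity i"
  by (auto simp: dual_idx_def)

lemma sum_dual_idx: "(\<Sum>k\<in>UNIV. f (dual_idx k)) = (\<Sum>k\<in>UNIV. f k)" for f :: "idx \<Rightarrow> 'a::ab_group_add"
  by (simp add: sum_idx ac_simps)

context superinvolution
begin

abbreviation OT :: "'r mat22 set" where
  "OT \<equiv> osp_tilde V bar"

abbreviation L :: "'r mat22 set" where
  "L \<equiv> osp sc V bar"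

lemma component_bar: "component V p (bar x) = bar (component V p x)"
  using component_props[where x = x] by (intro component_eqI) (auto simp: bar_V simp flip: bar.diff)

lemma component_rho: "component V p (rho V x) = rho V (component V p x)"
proof (induction x rule: homogeneous_induct)
  case (homogeneous q x)
  then show ?case
    using component_homogeneous[OF rho_V[OF homogeneous], of p] by (simp add: component_homogeneous rho.zero)
qed (simp add: rho.add component_add)

lemma osp_entry_additive:
  "osp_entry V bar (X + Y) i j = osp_entry V bar X i j + osp_entry V bar Y i j" for X :: "'r mat22"
  by (rule idx_cases[of i]; rule idx_cases[of j])
    (simp_all add: osp_entry_idx rho.add bar.add)

lemma osp_entry_scale:
  "osp_entry V bar (msc c X) i j = sc c (osp_entry V bar X i j)" for X :: "'r mat22"
  by (rule idx_cases[of i]; rule idx_cases[of j])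
    (simp_all add: osp_entry_idx rho_scale bar.scale matrix_scale_def)

lemma osp_entry_component:
  "osp_entry V bar (component MG p X) i j
     = component V (p + index_parity i + index_parity j) (osp_entry V bar X i j)"
  by (rule idx_cases[of i]; rule idx_cases[of j])
    (simp_all add: osp_entry_idx component_MG_nth component_bar component_rho component.minus add.assoc)

lemma osp_entry_homogeneous:
  assumes "X \<in> MG p"
  shows "osp_entry V bar X i j = signed (osp_sign p i j) (bar (X $ dual_idx j $ dual_idx i))"
  by (rule idx_cases[of i]; rule idx_cases[of j]; cases p;
      simp add: osp_entry_idx osp_sign_def symplectic_sign_def bar.neg rho_homogeneous[OF MG_nth[OF assms]])

lemma subspace_OT: "mat.subspace OT"
  unfolding mat.subspace_def osp_tilde_iff_entry
proof (intro conjI ballI allI impI)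
  have "osp_entry V bar (0 + 0 :: 'r mat22) i j = osp_entry V bar 0 i j + osp_entry V bar 0 i j" for i j
    by (rule osp_entry_additive)
  then show "osp_entry V bar 0 i j = - (0 :: 'r mat22) $ i $ j" for i j
    by simp
qed (simp_all add: osp_tilde_iff_entry osp_entry_additive osp_entry_scale, simp add: matrix_scale_def)

lemma component_OT: "X \<in> OT \<Longrightarrow> component MG p X \<in> OT"
  by (simp add: osp_tilde_iff_entry osp_entry_component component_MG_nth component.minus)

lemma OT_homogeneous:
  assumes "X \<in> OT" "X \<in> MG p"
  shows "X $ i $ j = - signed (osp_sign p i j) (bar (X $ dual_idx j $ dual_idx i))"
  using assms by (simp add: osp_tilde_iff_entry osp_entry_homogeneous)

text \<open>The involution reverses products up to the sign of the degrees, and the two minus signs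
  from \<open>X\<close> and \<open>Y\<close> cancel; hence \<open>X ** Y\<close> is
  \<open>signed (p * q)\<close> times the image of \<open>Y ** X\<close>, and the bracket is again
  skew.\<close>

lemma OT_mult:
  assumes X: "X \<in> OT" "X \<in> MG p" and Y: "Y \<in> OT" "Y \<in> MG q"
  shows "(X ** Y) $ i $ j
    = signed (p * q + osp_sign (p + q) i j) (bar ((Y ** X) $ dual_idx j $ dual_idx i))"
proof -
  have "X $ i $ k * Y $ k $ j
      = signed (p * q + osp_sign (p + q) i j) (bar (Y $ dual_idx j $ dual_idx k * X $ dual_idx k $ dual_idx i))"
    for k
  proof -
    let ?A = "X $ dual_idx k $ dual_idx i" and ?B = "Y $ dual_idx j $ dual_idx k"
    have "X $ i $ k * Y $ k $ j = signed (osp_sign p i k) (bar ?A) * signed (osp_sign q k j) (bar ?B)"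
      by (subst OT_homogeneous[OF X], subst OT_homogeneous[OF Y]) simp
    also have "\<dots> = signed (osp_sign p i k + osp_sign q k j) (bar ?A * bar ?B)"
      by (simp add: signed_mult_left signed_mult_right signed_signed add.commute)
    \<comment> \<open>The excess over the claimed sign is the product of the degrees of the two
      entries, which is the sign that \<open>bar_mult\<close> produces when their product is
      reversed.\<close>
    also have "osp_sign p i k + osp_sign q k j = p * q + osp_sign (p + q) i j
        + (q + index_parity j + index_parity k) * (p + index_parity k + index_parity i)"
      unfolding osp_sign_def
      by (cases p; cases q; cases "index_parity i"; cases "index_parity j"; cases "index_parity k")
        (simp_all add: ac_simps)
    finally show ?thesis
      using bar_mult[OF MG_nth[OF Y(2), of "dual_idx j" "dual_idx k"] MG_nth[OF X(2), of "dual_idx k" "dual_idx i"]]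
      by (simp add: signed_signed)
  qed
  then have "(X ** Y) $ i $ j = signed (p * q + osp_sign (p + q) i j)
      (\<Sum>k\<in>UNIV. bar (Y $ dual_idx j $ dual_idx k * X $ dual_idx k $ dual_idx i))"
    by (simp add: matrix_matrix_mult_def signed_sum)
  also have "(\<Sum>k\<in>UNIV. bar (Y $ dual_idx j $ dual_idx k * X $ dual_idx k $ dual_idx i))
      = bar ((Y ** X) $ dual_idx j $ dual_idx i)"
    using sum_dual_idx[of "\<lambda>k. bar (Y $ dual_idx j $ k * X $ k $ dual_idx i)"]
    by (simp add: matrix_matrix_mult_def bar.sum)
  finally show ?thesis .
qed

lemma br_OT_homogeneous:
  assumes X: "X \<in> OT" "X \<in> MG p" and Y: "Y \<in> OT" "Y \<in> MG q"
  shows "br X Y \<in> OT"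
  unfolding osp_tilde_iff_entry
proof (intro allI)
  fix i j
  let ?s = "osp_sign (p + q) i j"
  have "(X ** Y) $ i $ j = signed (p * q + ?s) (bar ((Y ** X) $ dual_idx j $ dual_idx i))"
    by (rule OT_mult[OF X Y])
  moreover have "(Y ** X) $ i $ j = signed (p * q + ?s) (bar ((X ** Y) $ dual_idx j $ dual_idx i))"
    using OT_mult[OF Y X, of i j] by (simp add: ac_simps)
  ultimately show "osp_entry V bar (br X Y) i j = - br X Y $ i $ j"
    unfolding osp_entry_homogeneous[OF br_MG[OF X(2) Y(2)]]
    unfolding br_homogeneous[OF X(2) Y(2)]
    by (cases p; cases q; cases ?s) (simp_all add: bar.diff bar.add)
qed

lemma br_OT:
  assumes "X \<in> OT" "Y \<in> OT"
  shows "br X Y \<in> OT"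
proof -
  have "br X Y = br (component MG 0 X + component MG 1 X) (component MG 0 Y + component MG 1 Y)"
    by (simp add: MG.component_sum)
  moreover have "br (component MG p X) (component MG q Y) \<in> OT" for p q
    using assms component_OT MG.component_props(1) by (blast intro: br_OT_homogeneous)
  ultimately show ?thesis
    using mat.subspace_add[OF subspace_OT] by (simp add: br_simps)
qed

lemma subspace_L: "mat.subspace L"
  unfolding osp_def by (rule mat.subspace_span)

lemma br_L: "X \<in> OT \<Longrightarrow> Y \<in> OT \<Longrightarrow> br X Y \<in> L"
  unfolding osp_def by (rule mat.span_base) blast

lemma L_OT: "L \<subseteq> OT"
  unfolding osp_def by (rule mat.span_minimal[OF _ subspace_OT]) (auto intro: br_OT)

lemma br_LL: "X \<in> L \<Longrightarrow> Y \<in> L \<Longrightarrow> br X Y \<in> L"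
  using br_L L_OT by blast

lemmas L_add = mat.subspace_add[OF subspace_L]
lemmas L_diff = mat.subspace_diff[OF subspace_L]
lemmas L_minus = mat.subspace_neg[OF subspace_L]
lemmas L_zero [simp] = mat.subspace_0[OF subspace_L]
lemmas L_scale = mat.subspace_scale[OF subspace_L]

lemma L_signed: "X \<in> L \<Longrightarrow> signed p X \<in> L"
  by (simp add: signed_def L_minus)

text \<open>
  With respect to \<open>DD 1\<close>, the elements \<open>xx\<close>, \<open>yy\<close>, \<open>ZZ\<close> and \<open>WW\<close> have the weights $1$, $-1$, $2$
  and $-2$, and \<open>AA\<close> and \<open>DD\<close> have weight $0$. A coefficient of degree $p$ gives an element \<open>xx\<close>
  or \<open>yy\<close> of degree $p + 1$.
\<close>

definition xx :: "idx \<Rightarrow> 'r \<Rightarrow> 'r mat22" where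
  "xx k a = munit i3 k a - munit k i4 (rho V (bar a))"

definition yy :: "idx \<Rightarrow> 'r \<Rightarrow> 'r mat22" where
  "yy k b = munit k i3 b + munit i4 k (rho V (bar b))"

definition AA :: "idx \<Rightarrow> idx \<Rightarrow> 'r \<Rightarrow> 'r mat22" where
  "AA i j c = munit i j c - munit j i (bar c)"

definition DD :: "'r \<Rightarrow> 'r mat22" where
  "DD d = munit i3 i3 d - munit i4 i4 (bar d)"

abbreviation ZZ :: "'r \<Rightarrow> 'r mat22" where "ZZ \<equiv> munit i3 i4"
abbreviation WW :: "'r \<Rightarrow> 'r mat22" where "WW \<equiv> munit i4 i3"

lemma xx_add: "xx k (a + b) = xx k a + xx k b"
  and yy_add: "yy k (a + b) = yy k a + yy k b"
  and AA_add: "AA k l (a + b) = AA k l a + AA k l b"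
  and DD_add: "DD (a + b) = DD a + DD b"
  by (simp_all add: xx_def yy_def AA_def DD_def munit_add bar.add rho.add)

sublocale xx: additive "xx k" for k by unfold_locales (rule xx_add)
sublocale yy: additive "yy k" for k by unfold_locales (rule yy_add)
sublocale AA: additive "AA k l" for k l by unfold_locales (rule AA_add)
sublocale DD: additive DD by unfold_locales (rule DD_add)

lemma xx_signed: "xx k (signed p a) = signed p (xx k a)"
  and yy_signed: "yy k (signed p a) = signed p (yy k a)"
  and AA_signed: "AA k l (signed p a) = signed p (AA k l a)"
  by (simp_all add: signed_def xx.minus yy.minus AA.minus)

lemma munit_scale: "munit i j (sc c a) = msc c (munit i j a)"
  by (simp add: vec_eq_iff munit_nth matrix_scale_def)

lemma AA_scale: "AA k l (sc c a) = msc c (AA k l a)"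
  by (simp add: AA_def munit_scale bar.scale mat.scale_right_diff_distrib)

lemma AA_swap: "AA l k (bar c) = - AA k l c"
  by (simp add: AA_def bar_bar)

context
  fixes k l :: idx
  assumes k: "k \<in> {i1, i2}" and l: "l \<in> {i1, i2}"
begin

lemma xx_MG: "a \<in> V p \<Longrightarrow> xx k a \<in> MG (p + 1)"
  and yy_MG: "a \<in> V p \<Longrightarrow> yy k a \<in> MG (p + 1)"
  and AA_MG: "a \<in> V p \<Longrightarrow> AA k l a \<in> MG p"
  using k l by (auto simp: xx_def yy_def AA_def rho_V bar_V intro!: MG.diff_V MG.add_V munit_MG)

lemma xx_OT: "xx k a \<in> OT" and yy_OT: "yy k a \<in> OT" and AA_OT: "AA k l a \<in> OT"
  by (insert k l, elim insertE emptyE; simp add: xx_def yy_def AA_def osp_tilde_iff_entry all_idx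
      osp_entry_idx munit_nth bar.neg rho.minus bar_rho bar_bar rho.zero bar.diff)+

end

lemma DD_MG: "a \<in> V p \<Longrightarrow> DD a \<in> MG p"
  and ZZ_MG: "a \<in> V p \<Longrightarrow> ZZ a \<in> MG p"
  and WW_MG: "a \<in> V p \<Longrightarrow> WW a \<in> MG p"
  by (auto simp: DD_def bar_V intro!: MG.diff_V munit_MG)

lemma DD_OT: "DD a \<in> OT"
  and ZZ_OT: "bar a = a \<Longrightarrow> ZZ a \<in> OT"
  and WW_OT: "bar a = a \<Longrightarrow> WW a \<in> OT"
  by (auto simp: DD_def osp_tilde_iff_entry all_idx osp_entry_idx munit_nth bar.neg bar_bar rho.zero)

section \<open>Brackets of root vectors\<close>

lemmas expand_simps = xx_def yy_def AA_def DD_def matrix_mult_simps munit_mult munit_add munit_diff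
  munit_minus munit_signed rho_homogeneous

lemma rho_bar: "a \<in> V p \<Longrightarrow> rho V (bar a) = signed p (bar a)"
  by (rule rho_homogeneous[OF bar_V])

lemma rho_prod: "a \<in> V p \<Longrightarrow> b \<in> V q \<Longrightarrow> rho V (a * b) = signed (p + q) (a * b)"
  by (rule rho_homogeneous[OF V_mult])

text \<open>For given degrees, the symplectic block of the bracket depends on \<open>a * b\<close>
  only, the orthogonal block on \<open>b * a\<close> only, and the former vanishes for
  \<open>k \<noteq> l\<close>. Later arguments use this to vary \<open>a\<close> and
  \<open>b\<close> without changing the bracket.\<close>

lemma br_xy:
  assumes a: "a \<in> V p" and b: "b \<in> V q" and k: "k \<in> {i1, i2}" and l: "l \<in> {i1, i2}"
  shows "br (xx k a) (yy l b)
    = (if k = l then DD (a * b) else 0) + signed (p * q + p + q) (AA l k (b * a))"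
  unfolding br_homogeneous[OF xx_MG[OF k k a] yy_MG[OF l l b]]
  using bar_mult[OF a b] bar_mult[OF b a] a b
  by (insert k l, elim insertE emptyE; cases p; cases q;
      simp add: expand_simps rho_bar)

lemma br_xx:
  assumes a: "a \<in> V p" and b: "b \<in> V q" and k: "k \<in> {i1, i2}" and l: "l \<in> {i1, i2}"
  shows "br (xx k a) (xx l b)
    = (if k = l then - signed q (ZZ (a * bar b + bar (a * bar b))) else 0)"
  unfolding br_homogeneous[OF xx_MG[OF k k a] xx_MG[OF l l b]]
  using bar_mult[OF a bar_V[OF b]] a b
  by (insert k l, elim insertE emptyE; cases p; cases q;
      simp add: expand_simps rho_bar bar_bar)

lemma br_yy:
  assumes a: "a \<in> V p" and b: "b \<in> V q" and k: "k \<in> {i1, i2}" and l: "l \<in> {i1, i2}"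
  shows "br (yy k a) (yy l b)
    = (if k = l then signed p (WW (bar a * b + bar (bar a * b))) else 0)"
  unfolding br_homogeneous[OF yy_MG[OF k k a] yy_MG[OF l l b]]
  using bar_mult[OF bar_V[OF a] b] a b
  by (insert k l, elim insertE emptyE; cases p; cases q;
      simp add: expand_simps rho_bar bar_bar)

lemma br_xA:
  assumes a: "a \<in> V p" and c: "c \<in> V r" and k: "k \<in> {i1, i2}"
    and i: "i \<in> {i1, i2}" and j: "j \<in> {i1, i2}"
  shows "br (xx k a) (AA i j c) = (if k = i then xx j (a * c) else 0) - (if k = j then xx i (a * bar c) else 0)"
  unfolding br_homogeneous[OF xx_MG[OF k k a] AA_MG[OF i j c]]
  using bar_mult[OF a c] bar_mult[OF a bar_V[OF c]] a c
    rho_prod[OF bar_V[OF c] bar_V[OF a]] rho_prod[OF c bar_V[OF a]]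
  by (insert k i j, elim insertE emptyE; cases p; cases r;
      simp add: expand_simps rho_bar bar_bar rho.minus)

lemma br_Ay:
  assumes b: "b \<in> V q" and c: "c \<in> V r" and k: "k \<in> {i1, i2}"
    and i: "i \<in> {i1, i2}" and j: "j \<in> {i1, i2}"
  shows "br (AA i j c) (yy k b) = (if j = k then yy i (c * b) else 0) - (if i = k then yy j (bar c * b) else 0)"
  unfolding br_homogeneous[OF AA_MG[OF i j c] yy_MG[OF k k b]]
  using bar_mult[OF c b] bar_mult[OF bar_V[OF c] b] b c
    rho_prod[OF bar_V[OF b] bar_V[OF c]] rho_prod[OF bar_V[OF b] c]
  by (insert k i j, elim insertE emptyE; cases q; cases r;
      simp add: expand_simps rho_bar bar_bar rho.minus)

lemma br_Dx:
  assumes a: "a \<in> V p" and d: "d \<in> V r" and k: "k \<in> {i1, i2}"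
  shows "br (DD d) (xx k a) = xx k (d * a)"
  unfolding br_homogeneous[OF DD_MG[OF d] xx_MG[OF k k a]]
  using bar_mult[OF d a] a d rho_prod[OF bar_V[OF a] bar_V[OF d]]
  by (insert k, elim insertE emptyE; cases p; cases r;
      simp add: expand_simps rho_bar bar_bar rho.minus)

lemma br_yD:
  assumes b: "b \<in> V q" and d: "d \<in> V r" and k: "k \<in> {i1, i2}"
  shows "br (yy k b) (DD d) = yy k (b * d)"
  unfolding br_homogeneous[OF yy_MG[OF k k b] DD_MG[OF d]]
  using bar_mult[OF b d] b d rho_prod[OF bar_V[OF d] bar_V[OF b]]
  by (insert k, elim insertE emptyE; cases q; cases r;
      simp add: expand_simps rho_bar bar_bar rho.minus)

lemma br_Zy:
  assumes b: "b \<in> V q" and c: "c \<in> V r" and k: "k \<in> {i1, i2}" and sym: "bar c = c"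
  shows "br (ZZ c) (yy k b) = signed q (xx k (c * bar b))"
  unfolding br_homogeneous[OF ZZ_MG[OF c] yy_MG[OF k k b]]
  using bar_mult[OF c bar_V[OF b]] b c rho_prod[OF b c] sym
  by (insert k, elim insertE emptyE; cases q; cases r;
      simp add: expand_simps rho_bar bar_bar rho.minus)

text \<open>Membership in \<open>L\<close> requires a combination of brackets; \<open>ZZ 1\<close>,
  \<open>DD 1\<close> and \<open>WW 1\<close> form an sl2-triple.\<close>

lemma hh_L: "DD 1 \<in> L"
proof -
  have "br (ZZ 1) (WW 1) = DD 1"
    unfolding br_homogeneous[OF ZZ_MG[OF V_one] WW_MG[OF V_one]] by (simp add: expand_simps)
  moreover have "br (ZZ 1) (WW 1) \<in> L"
    by (intro br_L ZZ_OT WW_OT) simp_all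
  ultimately show ?thesis
    by simp
qed

lemma br_hx: "k \<in> {i1, i2} \<Longrightarrow> br (DD 1) (xx k a) = xx k a"
  by (induction a rule: homogeneous_induct) (simp_all add: br_Dx[OF _ V_one] xx_add br_simps)

lemma br_yh: "k \<in> {i1, i2} \<Longrightarrow> br (yy k a) (DD 1) = yy k a"
  by (induction a rule: homogeneous_induct) (simp_all add: br_yD[OF _ V_one] yy_add br_simps)

lemma xx_L: "k \<in> {i1, i2} \<Longrightarrow> xx k a \<in> L"
  by (metis br_hx br_L DD_OT xx_OT)

lemma yy_L: "k \<in> {i1, i2} \<Longrightarrow> yy k a \<in> L"
  by (metis br_yh br_L DD_OT yy_OT)

lemma br_xy_one:
  assumes "k \<in> {i1, i2}" "l \<in> {i1, i2}"
  shows "br (xx k 1) (yy l b) = (if k = l then DD b else 0) + AA l k (rho V b)"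
proof (induction b rule: homogeneous_induct)
  case (homogeneous q b)
  then show ?case
    using br_xy[OF V_one homogeneous assms] by (simp add: rho_homogeneous AA_signed)
qed (auto simp: br_simps yy_add DD_add AA_add rho.add)

lemma AA12_L: "k \<in> {i1, i2} \<Longrightarrow> l \<in> {i1, i2} \<Longrightarrow> k \<noteq> l \<Longrightarrow> AA l k c \<in> L"
  using br_xy_one[of k l "rho V c"] br_LL[OF xx_L yy_L, of k l 1 "rho V c"] by simp

text \<open>The symplectic blocks cancel because \<open>rho\<close> is multiplicative, and on the
  orthogonal block \<open>rho\<close> turns the sign of \<open>br_xy\<close> into that of the
  supercommutator. The identity concentrates a difference of two brackets in one diagonal entry; it
  provides elements of \<open>L\<close> here, and cycles in the proof of surjectivity.\<close>

lemma br_xy_corner: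
  assumes k: "k \<in> {i1, i2}"
  shows "br (xx k (rho V a)) (yy k (rho V b)) - br (xx k 1) (yy k (rho V (a * b)))
    = - munit k k (scomm a b - bar (scomm a b))"
proof (induction a rule: homogeneous_induct)
  case a: (homogeneous p a)
  show ?case
  proof (induction b rule: homogeneous_induct)
    case b: (homogeneous q b)
    show ?case
      unfolding br_xy_one[OF k k] rho_homogeneous[OF a] rho_homogeneous[OF b] rho_homogeneous[OF V_mult[OF a b]]
        xx_signed yy_signed br_simps br_xy[OF a b k k] rho_rho
      using bar_mult[OF a b] bar_mult[OF b a]
      by (cases p; cases q)
        (simp_all add: scomm_homogeneous[OF a b] AA_def DD.minus munit_add munit_diff munit_minus bar.diff bar.add bar.neg)
  next
    case (add x y)
    then show ?case
      by (simp add: br_simps yy_add rho.add scomm_simps bar.add distrib_left munit_add munit_diff)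
        (simp add: algebra_simps)
  qed
next
  case (add x y)
  then show ?case
    by (simp add: br_simps xx_add yy_add rho.add scomm_simps bar.add distrib_right munit_add munit_diff)
      (simp add: algebra_simps)
qed

end

section \<open>Generators of the Lie superalgebra\<close>

locale osp22 = superinvolution sc V bar
  for sc :: "'k::comm_ring_1 \<Rightarrow> 'r::ring_1 \<Rightarrow> 'r" and V :: "bit \<Rightarrow> 'r set" and bar :: "'r \<Rightarrow> 'r" +
  fixes half :: 'k
  assumes half: "half + half = 1"
begin

abbreviation hf :: "'r \<Rightarrow> 'r" where "hf \<equiv> sc half"

lemma hf_double [simp]: "hf a + hf a = a"
  by (simp add: half flip: scale_left_distrib)

lemma hf_simps: "hf (a + b) = hf a + hf b" "hf (- a) = - hf a" "hf (a - b) = hf a - hf b"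
  "hf a * b = hf (a * b)" "a * hf b = hf (a * b)" "bar (hf a) = hf (bar a)" "rho V (hf a) = hf (rho V a)"
  by (simp_all add: scale_right_distrib scale_right_diff_distrib scale_mult_left scale_mult_right
      bar.scale rho_scale)

text \<open>Odd refers to the weights 1 and -1; the degree in the superalgebra is arbitrary.\<close>

definition odd_generators :: "'r mat22 set" where
  "odd_generators = {xx k a | k a p. k \<in> {i1, i2} \<and> a \<in> V p} \<union> {yy k a | k a p. k \<in> {i1, i2} \<and> a \<in> V p}"

lemma xx_odd_generators: "k \<in> {i1, i2} \<Longrightarrow> a \<in> V p \<Longrightarrow> xx k a \<in> odd_generators"
  and yy_odd_generators: "k \<in> {i1, i2} \<Longrightarrow> a \<in> V p \<Longrightarrow> yy k a \<in> odd_generators"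
  unfolding odd_generators_def by blast+

text \<open>For \<open>X\<close> of degree \<open>p\<close>, the sum of the last two diagonal
  entries is subtracted with the sign of \<open>p\<close>. With this twist the supertrace of a
  bracket is a sum of supercommutators of entries.\<close>

definition str :: "'r mat22 \<Rightarrow> 'r" where
  "str X = X $ i1 $ i1 + X $ i2 $ i2 - rho V (X $ i3 $ i3) - rho V (X $ i4 $ i4)"

lemma str_add: "str (X + Y) = str X + str Y"
  by (simp add: str_def rho.add)

sublocale str: additive str
  by unfold_locales (rule str_add)

lemma str_scale: "str (msc c X) = sc c (str X)"
  by (simp add: str_def matrix_scale_def rho_scale scale_right_distrib scale_right_diff_distrib)

text \<open>
  The supertrace form of a bilinear map \<open>f\<close>. The automorphism \<open>rho\<close> in the odd rows accounts for
  the sign of the supertrace of a matrix that is not homogeneous.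
\<close>

definition strace_form :: "('r \<Rightarrow> 'r \<Rightarrow> 'g::ab_group_add) \<Rightarrow> 'r mat22 \<Rightarrow> 'r mat22 \<Rightarrow> 'g" where
  "strace_form f X Y = (\<Sum>i\<in>UNIV. \<Sum>j\<in>UNIV. if index_parity i = 0 then f (X $ i $ j) (Y $ j $ i)
     else - f (rho V (X $ i $ j)) (rho V (Y $ j $ i)))"

lemma biadditive_strace_form:
  assumes "biadditive f"
  shows "biadditive (strace_form f)"
  unfolding biadditive_def strace_form_def
  by (simp add: sum.distrib[symmetric] rho.add biadditive_simps[OF assms] algebra_simps if_distrib cong: if_cong)

lemma strace_form_homogeneous:
  assumes "biadditive f" "X \<in> MG p" "Y \<in> MG q"
  shows "strace_form f X Y
    = (\<Sum>i\<in>UNIV. \<Sum>j\<in>UNIV. signed (index_parity i * (1 + p + q)) (f (X $ i $ j) (Y $ j $ i)))"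
  unfolding strace_form_def
proof (intro sum.cong refl)
  fix i j
  show "(if index_parity i = 0 then f (X $ i $ j) (Y $ j $ i)
      else - f (rho V (X $ i $ j)) (rho V (Y $ j $ i)))
    = signed (index_parity i * (1 + p + q)) (f (X $ i $ j) (Y $ j $ i))"
    unfolding rho_homogeneous[OF MG_nth[OF assms(2)]] rho_homogeneous[OF MG_nth[OF assms(3)]]
    by (cases p; cases q; cases "index_parity i"; cases "index_parity j";
        simp add: biadditive_simps[OF assms(1)])
qed

lemma strace_form_swap:
  assumes f: "biadditive f" and skew: "\<And>a b p q. a \<in> V p \<Longrightarrow> b \<in> V q \<Longrightarrow> f b a = - signed (p * q) (f a b)"
    and X: "X \<in> MG p" and Y: "Y \<in> MG q"
  shows "strace_form f Y X = - signed (p * q) (strace_form f X Y)"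
proof -
  have "signed (index_parity i * (1 + q + p)) (f (Y $ i $ j) (X $ j $ i))
    = - signed (p * q) (signed (index_parity j * (1 + p + q)) (f (X $ j $ i) (Y $ i $ j)))" for i j
    unfolding skew[OF MG_nth[OF X, of j i] MG_nth[OF Y, of i j]]
    by (cases p; cases q; cases "index_parity i"; cases "index_parity j"; simp)
  then have "strace_form f Y X = (\<Sum>i\<in>UNIV. \<Sum>j\<in>UNIV.
      - signed (p * q) (signed (index_parity j * (1 + p + q)) (f (X $ j $ i) (Y $ i $ j))))"
    by (simp add: strace_form_homogeneous[OF f Y X])
  also have "\<dots> = - signed (p * q) (strace_form f X Y)"
    unfolding strace_form_homogeneous[OF f X Y]
    by (subst sum.swap) (simp add: sum_negf signed_sum)
  finally show ?thesis .
qed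

lemma sum_rotate: "(\<Sum>i\<in>A. \<Sum>j\<in>A. \<Sum>k\<in>A. h j k i) = (\<Sum>i\<in>A. \<Sum>j\<in>A. \<Sum>k\<in>A. h i j k)"
  for h :: "'i \<Rightarrow> 'i \<Rightarrow> 'i \<Rightarrow> 'b::comm_monoid_add"
proof -
  have "(\<Sum>i\<in>A. \<Sum>j\<in>A. \<Sum>k\<in>A. h j k i) = (\<Sum>j\<in>A. \<Sum>i\<in>A. \<Sum>k\<in>A. h j k i)"
    by (rule sum.swap)
  also have "\<dots> = (\<Sum>j\<in>A. \<Sum>k\<in>A. \<Sum>i\<in>A. h j k i)"
    by (intro sum.cong refl sum.swap)
  finally show ?thesis .
qed

text \<open>Expanding the brackets yields the products of the three matrices in the given cyclic
  order and in the opposite one. Each family vanishes on its own, by \<open>cyc\<close> applied to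
  the three entries along a closed path \<open>i\<close>, \<open>j\<close>,
  \<open>k\<close>.\<close>

lemma strace_form_cyclic:
  assumes f: "biadditive f"
    and cyc: "\<And>a b c p q r. a \<in> V p \<Longrightarrow> b \<in> V q \<Longrightarrow> c \<in> V r \<Longrightarrow>
      signed (p * r) (f (a * b) c) + signed (p * q) (f (b * c) a) + signed (q * r) (f (c * a) b) = 0"
    and X: "X \<in> MG p" and Y: "Y \<in> MG q" and Z: "Z \<in> MG r"
  shows "signed (p * r) (strace_form f (br X Y) Z) + signed (q * p) (strace_form f (br Y Z) X)
    + signed (r * q) (strace_form f (br Z X) Y) = 0"
proof -
  \<comment> \<open>The parameter \<open>m\<close> will be \<open>1 + p + q + r\<close>, which is
    the same for all orders of the three matrices.\<close>
  define g where "g X Y Z p r m = (\<Sum>i\<in>UNIV. \<Sum>j\<in>UNIV. \<Sum>k\<in>UNIV.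
    signed (p * r + index_parity i * m) (f (X $ i $ j * Y $ j $ k) (Z $ k $ i)))" for X Y Z :: "'r mat22" and p r m :: bit
  have g0: "g X Y Z p r (1 + p + q + r) + g Y Z X q p (1 + p + q + r) + g Z X Y r q (1 + p + q + r) = 0"
    if X: "X \<in> MG p" and Y: "Y \<in> MG q" and Z: "Z \<in> MG r" for X Y Z p q r
  proof -
    let ?m = "1 + p + q + r"
    have 1: "g Y Z X q p ?m = (\<Sum>i\<in>UNIV. \<Sum>j\<in>UNIV. \<Sum>k\<in>UNIV.
        signed (q * p + index_parity j * ?m) (f (Y $ j $ k * Z $ k $ i) (X $ i $ j)))"
      unfolding g_def by (rule sum_rotate[symmetric])
    have 2: "g Z X Y r q ?m = (\<Sum>i\<in>UNIV. \<Sum>j\<in>UNIV. \<Sum>k\<in>UNIV.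
        signed (r * q + index_parity k * ?m) (f (Z $ k $ i * X $ i $ j) (Y $ j $ k)))"
      unfolding g_def by (rule sum_rotate)
    have "signed (p * r + index_parity i * ?m) (f (X $ i $ j * Y $ j $ k) (Z $ k $ i))
      + signed (q * p + index_parity j * ?m) (f (Y $ j $ k * Z $ k $ i) (X $ i $ j))
      + signed (r * q + index_parity k * ?m) (f (Z $ k $ i * X $ i $ j) (Y $ j $ k)) = 0" for i j k
      using cyc[OF MG_nth[OF X, of i j] MG_nth[OF Y, of j k] MG_nth[OF Z, of k i]]
      by (cases p; cases q; cases r; cases "index_parity i"; cases "index_parity j"; cases "index_parity k";
          simp add: algebra_simps eq_neg_iff_add_eq_0 neg_eq_iff_add_eq_0)
    then show ?thesis
      unfolding 1 2 by (subst (1) g_def) (simp flip: sum.distrib)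
  qed
  have expand: "signed (p * r) (strace_form f (br X Y) Z)
      = g X Y Z p r (1 + p + q + r) - signed (p * q + q * r + r * p) (g Y X Z q r (1 + p + q + r))"
    if X: "X \<in> MG p" and Y: "Y \<in> MG q" and Z: "Z \<in> MG r" for X Y Z p q r
  proof -
    have "f (br X Y $ i $ k) (Z $ k $ i) = (\<Sum>j\<in>UNIV. f (X $ i $ j * Y $ j $ k) (Z $ k $ i))
        - signed (p * q) (\<Sum>j\<in>UNIV. f (Y $ i $ j * X $ j $ k) (Z $ k $ i))" for i k
      unfolding br_homogeneous[OF X Y]
      by (simp add: matrix_matrix_mult_def signed_nth sum_idx biadditive_simps[OF f])
    then have "signed (p * r) (strace_form f (br X Y) Z)
      = (\<Sum>i\<in>UNIV. \<Sum>k\<in>UNIV. \<Sum>j\<in>UNIV.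
          signed (p * r + index_parity i * (1 + p + q + r)) (f (X $ i $ j * Y $ j $ k) (Z $ k $ i)))
        - signed (p * q + q * r + r * p) (\<Sum>i\<in>UNIV. \<Sum>k\<in>UNIV. \<Sum>j\<in>UNIV.
          signed (q * r + index_parity i * (1 + p + q + r)) (f (Y $ i $ j * X $ j $ k) (Z $ k $ i)))"
      unfolding strace_form_homogeneous[OF f br_MG[OF X Y] Z]
      by (simp add: signed_sum signed_signed signed_diff sum_subtractf ac_simps)
    also have "\<dots> = g X Y Z p r (1 + p + q + r) - signed (p * q + q * r + r * p) (g Y X Z q r (1 + p + q + r))"
      unfolding g_def by (intro arg_cong2[where f = minus] arg_cong[where f = "signed _"] sum.cong refl sum.swap)
    finally show ?thesis .
  qed
  let ?m = "1 + p + q + r" and ?w = "p * q + q * r + r * p"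
  have swapped: "signed ?w (g Y X Z q r ?m) + signed ?w (g Z Y X r p ?m) + signed ?w (g X Z Y p q ?m) = 0"
    using g0[OF Y X Z] by (simp add: ac_simps flip: signed_add)
  have "signed (p * r) (strace_form f (br X Y) Z) = g X Y Z p r ?m - signed ?w (g Y X Z q r ?m)"
    by (rule expand[OF X Y Z])
  moreover have "signed (q * p) (strace_form f (br Y Z) X) = g Y Z X q p ?m - signed ?w (g Z Y X r p ?m)"
    using expand[OF Y Z X] by (simp add: ac_simps)
  moreover have "signed (r * q) (strace_form f (br Z X) Y) = g Z X Y r q ?m - signed ?w (g X Z Y p q ?m)"
    using expand[OF Z X Y] by (simp add: ac_simps)
  ultimately show ?thesis
    using g0[OF X Y Z] swapped by (simp flip: add_diff_add)
qed

text \<open>Exchanging the summation indices in the supertrace of \<open>Y ** X\<close> pairs the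
  entry (i, j) of \<open>X\<close> with the entry (j, i) of \<open>Y\<close> in both products, so
  that supercommutators of entries appear.\<close>

lemma str_br: "str (br X Y) = strace_form scomm X Y"
proof -
  note simps = biadditive_simps[OF biadditive_strace_form[OF biadditive_scomm]]
  show ?thesis
  proof (induction X rule: MG.homogeneous_induct)
    case X: (homogeneous p X)
    show ?case
    proof (induction Y rule: MG.homogeneous_induct)
      case Y: (homogeneous q Y)
      have "str (br X Y) = (\<Sum>i\<in>UNIV. signed (index_parity i * (1 + p + q)) (br X Y $ i $ i))"
        unfolding str_def sum_idx rho_homogeneous[OF MG_nth[OF br_MG[OF X Y]]]
        by (cases p; cases q; simp)
      also have "\<dots> = (\<Sum>i\<in>UNIV. \<Sum>j\<in>UNIV. signed (index_parity i * (1 + p + q)) (X $ i $ j * Y $ j $ i))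
          - (\<Sum>j\<in>UNIV. \<Sum>i\<in>UNIV. signed (p * q + index_parity j * (1 + p + q)) (Y $ j $ i * X $ i $ j))"
        unfolding br_homogeneous[OF X Y]
        by (simp add: matrix_matrix_mult_def signed_nth signed_sum signed_signed signed_diff sum_subtractf ac_simps)
      also have "\<dots> = (\<Sum>i\<in>UNIV. \<Sum>j\<in>UNIV. signed (index_parity i * (1 + p + q)) (X $ i $ j * Y $ j $ i)
          - signed (p * q + index_parity j * (1 + p + q)) (Y $ j $ i * X $ i $ j))"
        by (subst (2) sum.swap) (simp add: sum_subtractf)
      also have "\<dots> = strace_form scomm X Y"
        unfolding strace_form_homogeneous[OF biadditive_scomm X Y]
      proof (intro sum.cong refl)
        fix i j
        show "signed (index_parity i * (1 + p + q)) (X $ i $ j * Y $ j $ i)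
          - signed (p * q + index_parity j * (1 + p + q)) (Y $ j $ i * X $ i $ j)
          = signed (index_parity i * (1 + p + q)) (scomm (X $ i $ j) (Y $ j $ i))"
          unfolding scomm_homogeneous[OF MG_nth[OF X] MG_nth[OF Y]]
          by (cases p; cases q; cases "index_parity i"; cases "index_parity j"; simp)
      qed
      finally show ?case .
    qed (simp add: br_simps str_add simps)
  qed (simp add: br_simps str_add simps)
qed

text \<open>By \<open>bar_scomm\<close> the generators are sums of two supercommutators. As 2 is
  invertible, this is the skew part of the span of all supercommutators; the supertraces of elements
  of \<open>L\<close> lie in it.\<close>

definition trace_module :: "'r set" where
  "trace_module = span {scomm a b - bar (scomm a b) | a b. True}"

lemma str_OT: "X \<in> OT \<Longrightarrow> bar (str X) = - str X"
proof -
  assume "X \<in> OT"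
  then have "bar (X $ i1 $ i1) = - X $ i1 $ i1" "bar (X $ i2 $ i2) = - X $ i2 $ i2"
    "bar (X $ i3 $ i3) = - X $ i4 $ i4" "bar (X $ i4 $ i4) = - X $ i3 $ i3"
    by (simp_all add: osp_tilde_iff_entry all_idx osp_entry_idx)
  then show ?thesis
    by (simp add: str_def bar.add bar.diff bar_rho rho.minus)
qed

text \<open>By \<open>str_br\<close> the supertrace of a bracket is a sum of supercommutators, and
  by \<open>str_OT\<close> it is skew. It is therefore half of its difference from its image under
  \<open>bar\<close>, which is a sum of generators.\<close>

lemma str_L: "X \<in> L \<Longrightarrow> str X \<in> trace_module"
  unfolding osp_def
proof (induction rule: mat.span_induct_alt)
  case base
  show ?case
    by (simp add: str.zero trace_module_def span_zero)
next
  case (step c B Y)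
  then obtain X1 Y1 where B: "B = br X1 Y1" "X1 \<in> OT" "Y1 \<in> OT"
    by blast
  have gen: "scomm a b - bar (scomm a b) \<in> trace_module" for a b
    unfolding trace_module_def by (rule span_base) blast
  have "str B - bar (str B) = strace_form (\<lambda>a b. scomm a b - bar (scomm a b)) X1 Y1"
    unfolding B(1) str_br strace_form_def bar.sum sum_subtractf[symmetric]
    by (intro sum.cong refl) (simp add: bar.neg)
  also have "\<dots> \<in> trace_module"
    unfolding strace_form_def using gen subspace_span[of "{scomm a b - bar (scomm a b) | a b. True}"]
    unfolding trace_module_def[symmetric] by (intro subspace_sum) (auto simp: subspace_neg simp del: minus_diff_eq)
  finally have "str B - bar (str B) \<in> trace_module" .
  moreover have "str B - bar (str B) = str B + str B"
    using str_OT[OF br_OT[OF B(2,3)]] B(1) by simp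
  ultimately have "hf (str B + str B) \<in> trace_module"
    unfolding trace_module_def by (simp add: span_scale)
  then have "str B \<in> trace_module"
    by (simp add: hf_simps)
  then show ?case
    using step unfolding str_add str_scale trace_module_def by (intro span_add span_scale)
qed

text \<open>Brackets of two generators of weights 1 and -1 already suffice to reach all of
  \<open>L\<close>. The predicate is closed under addition only, so signs and scalars are absorbed
  into the coefficients of the generators.\<close>

lemma L_induct [consumes 1, case_names generator bracket add]:
  assumes "X \<in> L"
    and gen: "\<And>g. g \<in> odd_generators \<Longrightarrow> P g"
    and bracket: "\<And>g g'. g \<in> odd_generators \<Longrightarrow> g' \<in> odd_generators \<Longrightarrow> P (br g g')"
    and add: "\<And>X Y. P X \<Longrightarrow> P Y \<Longrightarrow> P (X + Y)"
  shows "P X"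
proof -
  have x: "P (xx k a)" and y: "P (yy k a)" if "k \<in> {i1, i2}" for k a
    using that by (induction a rule: homogeneous_induct)
      (auto simp: xx_add yy_add intro: gen add xx_odd_generators yy_odd_generators)
  have xy: "P (br (xx k a) (yy l b))" if "k \<in> {i1, i2}" "l \<in> {i1, i2}" for k l a b
  proof (induction a rule: homogeneous_induct)
    case a: (homogeneous p a)
    then show ?case
      using that by (induction b rule: homogeneous_induct)
        (auto simp: xx_add yy_add br_simps intro: bracket add xx_odd_generators yy_odd_generators)
  qed (simp add: xx_add br_simps add)
  have yy1: "P (br (yy i1 1) (yy i1 b))" for b
    by (induction b rule: homogeneous_induct)
      (auto simp: yy_add br_simps intro: bracket add yy_odd_generators V_one)
  have xx1: "P (br (xx i1 b) (xx i1 1))" for b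
    by (induction b rule: homogeneous_induct)
      (auto simp: xx_add br_simps intro: bracket add xx_odd_generators V_one)
  have neg: "P (- br (xx k a) (yy l b))" if "k \<in> {i1, i2}" "l \<in> {i1, i2}" for k l a b
    using xy[OF that, of "- a" b] by (simp add: xx.minus br_simps)
  have W: "P (WW r)" if "bar r = r" for r
  proof -
    have "br (yy i1 1) (yy i1 b) = WW (b + bar b)" for b
      by (induction b rule: homogeneous_induct)
        (simp_all add: br_yy[OF V_one] yy_add br_simps munit_add bar.add ac_simps)
    from this[of "hf r"] yy1[of "hf r"] show ?thesis
      using that by (simp add: hf_simps)
  qed
  have Z: "P (ZZ r)" if "bar r = r" for r
  proof -
    have "br (xx i1 b) (xx i1 1) = - ZZ (b + bar b)" for b
      by (induction b rule: homogeneous_induct)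
        (simp_all add: br_xx[OF _ V_one] xx_add br_simps munit_add bar.add ac_simps)
    moreover have "hf (- r) + bar (hf (- r)) = - r"
      using that hf_double[of "- r"] by (simp add: hf_simps bar.neg)
    ultimately show ?thesis
      using xx1[of "hf (- r)"] by (simp add: munit_minus)
  qed
  have corner: "P (munit i1 i1 t)" if "t \<in> trace_module" for t
    using that unfolding trace_module_def
  proof (induction rule: span_induct_alt)
    case base
    show ?case
      using x[of i1 0] by (simp add: xx.zero)
  next
    case (step c s t)
    then obtain a b where s: "s = scomm a b - bar (scomm a b)"
      by blast
    have "P (- br (xx i1 (rho V a)) (yy i1 (rho V b)) + br (xx i1 1) (yy i1 (rho V (a * b))))" for a b
      by (intro add neg xy) simp_all
    moreover have "- br (xx i1 (rho V a)) (yy i1 (rho V b)) + br (xx i1 1) (yy i1 (rho V (a * b)))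
        = munit i1 i1 (scomm a b - bar (scomm a b))" for a b
      using br_xy_corner[of i1 a b] by (simp add: algebra_simps)
    ultimately have "P (munit i1 i1 (scomm (sc c a) b - bar (scomm (sc c a) b)))"
      by simp
    then show ?case
      using step unfolding s
      by (simp add: munit_add scomm_scale_left bar.scale add flip: scale_right_diff_distrib)
  qed
  have diff: "P (munit i2 i2 s - munit i1 i1 s)" if s: "bar s = - s" for s
  proof -
    have "br (xx i2 1) (yy i2 (rho V (hf s))) - br (xx i1 1) (yy i1 (rho V (hf s)))
        = munit i2 i2 s - munit i1 i1 s"
      unfolding br_xy_one[of i1 i1, simplified] br_xy_one[of i2 i2, simplified]
      by (simp add: AA_def hf_simps s munit_minus flip: munit_add)
    moreover have "P (br (xx i2 1) (yy i2 (rho V (hf s))) + - br (xx i1 1) (yy i1 (rho V (hf s))))"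
      by (intro add neg xy) simp_all
    ultimately show ?thesis
      by simp
  qed
  have "X \<in> OT"
    using assms L_OT by blast
  then have X: "X $ i1 $ i1 = - bar (X $ i1 $ i1)" "X $ i2 $ i2 = - bar (X $ i2 $ i2)"
    "X $ i2 $ i1 = - bar (X $ i1 $ i2)" "X $ i4 $ i4 = - bar (X $ i3 $ i3)"
    "bar (X $ i3 $ i4) = X $ i3 $ i4" "bar (X $ i4 $ i3) = X $ i4 $ i3"
    "X $ i1 $ i4 = - rho V (bar (X $ i3 $ i1))" "X $ i2 $ i4 = - rho V (bar (X $ i3 $ i2))"
    "X $ i4 $ i1 = rho V (bar (X $ i1 $ i3))" "X $ i4 $ i2 = rho V (bar (X $ i2 $ i3))"
    unfolding osp_tilde_iff_entry all_idx by (simp_all add: osp_entry_idx bar_rho)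
  \<comment> \<open>The off-diagonal entries are read off. The bracket with
    \<open>X $ i3 $ i3\<close> supplies the symplectic diagonal but changes the entry (1,1), and
    \<open>X $ i2 $ i2\<close> is produced together with its negative in that entry. The correction
    that remains at (1,1) is exactly the supertrace, which \<open>corner\<close> can supply.\<close>
  have "X = xx i1 (X $ i3 $ i1) + xx i2 (X $ i3 $ i2) + yy i1 (X $ i1 $ i3) + yy i2 (X $ i2 $ i3)
      + ZZ (X $ i3 $ i4) + WW (X $ i4 $ i3) + br (xx i2 1) (yy i1 (rho V (X $ i1 $ i2)))
      + br (xx i1 1) (yy i1 (X $ i3 $ i3)) + (munit i2 i2 (X $ i2 $ i2) - munit i1 i1 (X $ i2 $ i2))
      + munit i1 i1 (str X)"
    unfolding br_xy_one[of i1 i1, simplified] br_xy_one[of i2 i1, simplified]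
    unfolding mat22_eq_iff
    by (simp add: X(3,4,7-10) str_def xx_def yy_def AA_def DD_def munit_nth bar.neg rho.minus bar_rho bar.zero rho.zero)
  also have "P \<dots>"
    using X(1,2) by (intro add x y xy Z W diff corner str_L[OF assms(1)] X(5,6)) (simp_all add: equation_minus_iff)
  finally show ?thesis .
qed

end

section \<open>The exceptional cocycle\<close>

context osp22
begin

abbreviation I :: "'r set" where
  "I \<equiv> commutator_ideal sc V"

lemma subspace_I: "subspace I"
  unfolding commutator_ideal_def by (rule subspace_span)

lemma scomm_mult_I: "scomm a b * c \<in> I"
  unfolding commutator_ideal_def by (rule span_base) blast

lemma scomm_I: "scomm a b \<in> I"
  using scomm_mult_I[of a b 1] by simp

text \<open>For homogeneous elements, \<open>a * scomm b c\<close> is the supercommutator of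
  \<open>a\<close> and \<open>scomm b c\<close> plus a signed \<open>scomm b c * a\<close>. So
  \<open>I\<close> is a two-sided ideal.\<close>

lemma mult_scomm_I: "a * scomm b c \<in> I"
proof (induction a rule: homogeneous_induct)
  case a: (homogeneous p a)
  show ?case
  proof (induction b rule: homogeneous_induct)
    case b: (homogeneous q b)
    show ?case
    proof (induction c rule: homogeneous_induct)
      case c: (homogeneous r c)
      have "a * scomm b c = scomm a (scomm b c) + signed (p * (q + r)) (scomm b c * a)"
        by (simp add: scomm_homogeneous[OF a scomm_V[OF b c]])
      moreover have "signed (p * (q + r)) (scomm b c * a) \<in> I"
        using scomm_mult_I subspace_neg[OF subspace_I] by (simp add: signed_def)
      ultimately show ?case
        using scomm_I subspace_add[OF subspace_I] by simp
    qed (simp add: scomm_simps distrib_left subspace_add[OF subspace_I])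
  qed (simp add: scomm_simps distrib_left subspace_add[OF subspace_I])
qed (simp add: distrib_right subspace_add[OF subspace_I])

lemma mult_I_right: "x \<in> I \<Longrightarrow> x * y \<in> I"
  unfolding commutator_ideal_def
proof (induction rule: span_induct_alt)
  case base
  show ?case
    by (simp add: span_zero)
next
  case (step c s x)
  then obtain a b d where "s = scomm a b * d"
    by blast
  then have "s * y = scomm a b * (d * y)"
    by (simp add: mult.assoc)
  then have "s * y \<in> span {scomm a b * c | a b c. True}"
    by (intro span_base) blast
  then show ?case
    using step by (simp add: distrib_right scale_mult_left span_add span_scale)
qed

lemma trace_module_mult:
  assumes "t \<in> trace_module"
  shows "x * t * y \<in> I"
proof -
  have "x * t \<in> I"
    using assms unfolding trace_module_def
  proof (induction rule: span_induct_alt)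
    case base
    show ?case
      by (simp add: subspace_0[OF subspace_I])
  next
    case (step c s t)
    then obtain a b where "s = scomm a b + scomm (bar a) (bar b)"
      by (auto simp: bar_scomm)
    then show ?case
      using step by (simp add: distrib_left scale_mult_right mult_scomm_I subspace_add[OF subspace_I] subspace_scale[OF subspace_I])
  qed
  then show ?thesis
    by (rule mult_I_right)
qed

text \<open>The entries of the block have degree \<open>p + 1\<close> if \<open>X\<close> has degree
  \<open>p\<close>, so the factor \<open>- rho\<close> is the sign of \<open>p\<close>.\<close>

definition det_form :: "'r mat22 \<Rightarrow> 'r mat22 \<Rightarrow> 'r" where
  "det_form X Y = - (rho V (X $ i1 $ i3) * Y $ i2 $ i4 - rho V (X $ i1 $ i4) * Y $ i2 $ i3
     - rho V (X $ i2 $ i3) * Y $ i1 $ i4 + rho V (X $ i2 $ i4) * Y $ i1 $ i3)"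

lemma biadditive_det_form: "biadditive det_form"
  by (simp add: biadditive_def det_form_def rho.add algebra_simps)

lemma det_form_homogeneous:
  assumes "X \<in> MG p"
  shows "det_form X Y = signed p (X $ i1 $ i3 * Y $ i2 $ i4 - X $ i1 $ i4 * Y $ i2 $ i3
     - X $ i2 $ i3 * Y $ i1 $ i4 + X $ i2 $ i4 * Y $ i1 $ i3)"
  unfolding det_form_def rho_homogeneous[OF MG_nth[OF assms]]
  by (cases p) simp_all

context
  fixes \<kappa> :: "'r \<Rightarrow> 'g::ab_group_add"
  assumes \<kappa>_add: "\<kappa> (x + y) = \<kappa> x + \<kappa> y" and \<kappa>_I: "x \<in> I \<Longrightarrow> \<kappa> x = 0"
begin

interpretation \<kappa>: additive \<kappa>
  by unfold_locales (rule \<kappa>_add)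

lemma \<kappa>_signed: "\<kappa> (signed p x) = signed p (\<kappa> x)"
  by (simp add: signed_def \<kappa>.minus)

text \<open>Modulo \<open>I\<close> the factors of a product supercommute. The map \<kappa> stands
  both for the class map of R/I and for the map \<open>M\<close> that is extracted from a
  cocycle.\<close>

lemma \<kappa>_swap_left:
  assumes "a \<in> V p" "b \<in> V q"
  shows "\<kappa> (b * a * c) = signed (p * q) (\<kappa> (a * b * c))"
proof -
  have "scomm b a * c = b * a * c - signed (p * q) (a * b * c)"
    by (simp add: scomm_homogeneous[OF assms(2,1)] signed_mult_left left_diff_distrib mult.commute[of q])
  then show ?thesis
    using \<kappa>_I[OF scomm_mult_I[of b a c]] by (simp add: \<kappa>.diff \<kappa>_signed)
qed

lemma \<kappa>_swap_right:
  assumes "a \<in> V p" "b \<in> V q"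
  shows "\<kappa> (c * b * a) = signed (p * q) (\<kappa> (c * a * b))"
proof -
  have "c * scomm b a = c * b * a - signed (p * q) (c * a * b)"
    by (simp add: scomm_homogeneous[OF assms(2,1)] signed_mult_right right_diff_distrib mult.assoc mult.commute[of q])
  then show ?thesis
    using \<kappa>_I[OF mult_scomm_I[of c b a]] by (simp add: \<kappa>.diff \<kappa>_signed)
qed

lemma \<kappa>_trace:
  assumes "X \<in> L" "X \<in> MG p"
  shows "\<kappa> (a * X $ i1 $ i1 * b) = signed p (\<kappa> (a * X $ i3 $ i3 * b) + \<kappa> (a * X $ i4 $ i4 * b)) - \<kappa> (a * X $ i2 $ i2 * b)"
proof -
  have "\<kappa> (a * str X * b) = 0"
    by (intro \<kappa>_I trace_module_mult str_L assms)
  then show ?thesis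
    unfolding str_def rho_homogeneous[OF MG_nth[OF assms(2)]]
    by (simp add: algebra_simps \<kappa>_add \<kappa>.diff \<kappa>_signed signed_mult_left signed_mult_right signed_add)
qed

lemma det_form_swap:
  assumes X: "X \<in> MG p" and Y: "Y \<in> MG q"
  shows "\<kappa> (det_form Y X) = - signed (p * q) (\<kappa> (det_form X Y))"
proof -
  have "\<kappa> (Y $ a $ b * X $ c $ d) = signed ((p + index_parity c + index_parity d) * (q + index_parity a + index_parity b))
      (\<kappa> (X $ c $ d * Y $ a $ b))" for a b c d
    using \<kappa>_swap_left[OF MG_nth[OF X] MG_nth[OF Y], where c = 1] by simp
  then show ?thesis
    unfolding det_form_homogeneous[OF X] det_form_homogeneous[OF Y]
    by (cases p; cases q; simp add: \<kappa>_add \<kappa>.diff \<kappa>.minus)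
qed

text \<open>
  With respect to the block triangular grading, \<open>det_form\<close> pairs the upper right blocks. A diagonal
  block acts on this pairing by its supertrace, which vanishes modulo \<open>I\<close>.
\<close>

lemma det_form_cyclic:
  assumes X: "X \<in> L" "X \<in> MG p" and Y: "Y \<in> L" "Y \<in> MG q" and Z: "Z \<in> L" "Z \<in> MG r"
  shows "signed (p * r) (\<kappa> (det_form (br X Y) Z)) + signed (q * p) (\<kappa> (det_form (br Y Z) X))
    + signed (r * q) (\<kappa> (det_form (br Z X) Y)) = 0"
proof -
  note swaps =
    \<kappa>_swap_left[OF MG_nth[OF X(2)] MG_nth[OF Y(2)]] \<kappa>_swap_left[OF MG_nth[OF X(2)] MG_nth[OF Z(2)]]
    \<kappa>_swap_left[OF MG_nth[OF Y(2)] MG_nth[OF Z(2)]]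
    \<kappa>_swap_right[OF MG_nth[OF X(2)] MG_nth[OF Y(2)]] \<kappa>_swap_right[OF MG_nth[OF X(2)] MG_nth[OF Z(2)]]
    \<kappa>_swap_right[OF MG_nth[OF Y(2)] MG_nth[OF Z(2)]]
  \<comment> \<open>The rules \<open>swaps\<close> sort the factors of each product in the order
    \<open>X\<close>, \<open>Y\<close>, \<open>Z\<close>. The supertrace relation is therefore
    stated with a diagonal entry of \<open>X\<close> in front, of \<open>Z\<close> at the end and of
    \<open>Y\<close> in the middle; it eliminates the entries at (1,1).\<close>
  have trace_first: "\<kappa> (X $ i1 $ i1 * b) = signed p (\<kappa> (X $ i3 $ i3 * b) + \<kappa> (X $ i4 $ i4 * b)) - \<kappa> (X $ i2 $ i2 * b)" for b
    using \<kappa>_trace[OF X, of 1 b] by simp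
  have trace_last: "\<kappa> (a * Z $ i1 $ i1) = signed r (\<kappa> (a * Z $ i3 $ i3) + \<kappa> (a * Z $ i4 $ i4)) - \<kappa> (a * Z $ i2 $ i2)" for a
    using \<kappa>_trace[OF Z, of a 1] by simp
  note trace = trace_first[of "_ * _", folded mult.assoc] trace_last[of "_ * _"] \<kappa>_trace[OF Y]
  show ?thesis
    unfolding det_form_homogeneous[OF br_MG[OF X(2) Y(2)]] det_form_homogeneous[OF br_MG[OF Y(2) Z(2)]]
      det_form_homogeneous[OF br_MG[OF Z(2) X(2)]]
    unfolding br_homogeneous[OF X(2) Y(2)] br_homogeneous[OF Y(2) Z(2)] br_homogeneous[OF Z(2) X(2)]
    by (cases p; cases q; cases r;
        simp add: matrix_matrix_mult_def sum_idx distrib_right left_diff_distrib \<kappa>_add \<kappa>.diff \<kappa>.minus;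
        simp add: swaps; simp add: trace)
qed

end

end

section \<open>Vanishing of cocycles\<close>

locale osp22_unit = osp22 sc V bar half
  for sc :: "'k::comm_ring_1 \<Rightarrow> 'r::ring_1 \<Rightarrow> 'r" and V :: "bit \<Rightarrow> 'r set" and bar :: "'r \<Rightarrow> 'r" and half :: 'k +
  fixes e ei :: 'r
  assumes e_even: "e \<in> V 0" and bar_e: "bar e = - e" and e_central: "e * x = x * e" and e_ei: "e * ei = 1"
begin

lemma ei_e: "ei * e = 1"
  using e_central[of ei] e_ei by simp

lemma ei_central: "ei * x = x * ei"
proof -
  have "ei * x = ei * (x * e) * ei"
    by (simp add: mult.assoc e_ei)
  also have "\<dots> = ei * e * x * ei"
    by (metis e_central mult.assoc)
  finally show ?thesis
    by (simp add: ei_e)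
qed

lemma e_cancel: "e * (ei * x) = x" "ei * (e * x) = x" "x * e * ei = x" "x * ei * e = x"
  by (simp_all add: e_ei ei_e mult.assoc) (simp_all add: e_ei ei_e flip: mult.assoc)

text \<open>Comparing degrees in \<open>e * ei = 1\<close>: the product of \<open>e\<close> with the
  odd component of \<open>ei\<close> is both odd and even, hence 0, and \<open>e\<close> can be
  cancelled.\<close>

lemma ei_even: "ei \<in> V 0"
proof -
  have "e * component V 1 ei \<in> V 1"
    using V_mult[OF e_even component_props(1)[of 1 ei]] by simp
  moreover have "e * component V 1 ei = 1 - e * component V 0 ei"
    using component_sum[of ei] e_ei by (metis add_diff_cancel_left' distrib_left)
  moreover have "1 - e * component V 0 ei \<in> V 0"
    using V_mult[OF e_even component_props(1)[of 0 ei]] by (simp add: diff_V V_one)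
  ultimately have "e * component V 1 ei \<in> V 0" "e * component V 1 ei \<in> V (0 + 1)"
    by simp_all
  then have "e * component V 1 ei = 0"
    by (rule zero_if_opposite)
  then have "component V 1 ei = 0"
    using e_cancel(2)[of "component V 1 ei"] by simp
  then show ?thesis
    using component_sum[of ei] component_props(1)[of 0 ei] by simp
qed

lemma bar_mult_even:
  assumes "a \<in> V 0"
  shows "bar (a * x) = bar x * bar a" "bar (x * a) = bar a * bar x"
proof -
  show "bar (a * x) = bar x * bar a"
    by (induction x rule: homogeneous_induct) (simp_all add: bar_mult[OF assms] algebra_simps bar.add)
  show "bar (x * a) = bar a * bar x"
    by (induction x rule: homogeneous_induct) (simp_all add: bar_mult[OF _ assms] algebra_simps bar.add)
qed

lemma bar_ei: "bar ei = - ei"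
proof -
  have "bar ei * bar e = 1"
    using bar_mult_even(1)[OF e_even, of ei] e_ei by simp
  then show ?thesis
    by (metis bar_e e_cancel(3) minus_mult_minus minus_minus mult_1_left mult_minus_right)
qed

lemma e_V: "a \<in> V p \<Longrightarrow> e * a \<in> V p" "a \<in> V p \<Longrightarrow> a * e \<in> V p"
  and ei_V: "a \<in> V p \<Longrightarrow> ei * a \<in> V p" "a \<in> V p \<Longrightarrow> a * ei \<in> V p"
  using V_mult[OF e_even] V_mult[OF _ e_even] V_mult[OF ei_even] V_mult[OF _ ei_even]
  by (metis add_0 add_0_right)+

text \<open>The diagonal is skew, as the symmetry of \<open>OT\<close> demands, and the supertrace
  is 0. \<open>TT\<close> acts on the root vectors \<open>xx\<close> and \<open>yy\<close> by
  multiplication with \<open>e\<close> or \<open>- e\<close>; this is invertible and, unlike the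
  action of \<open>hh\<close>, tells the indices \<open>i1\<close> and \<open>i2\<close>
  apart.\<close>

definition TT :: "'r mat22" where
  "TT = munit i1 i1 e - munit i2 i2 e"

lemma TT_MG: "TT \<in> MG 0"
  unfolding TT_def by (intro MG.diff_V munit_MG) (simp_all add: e_even)

lemma TT_L: "TT \<in> L"
proof -
  have "br (xx i1 1) (yy i1 (hf e)) - br (xx i2 1) (yy i2 (hf e)) = TT"
    unfolding br_xy_one[of i1 i1, simplified] br_xy_one[of i2 i2, simplified]
      rho_homogeneous[OF scale_V[OF e_even]]
    by (simp add: AA_def hf_simps bar_e munit_minus TT_def flip: munit_add)
  moreover have "br (xx i1 1) (yy i1 (hf e)) - br (xx i2 1) (yy i2 (hf e)) \<in> L"
    by (intro L_diff br_LL xx_L yy_L) simp_all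
  ultimately show ?thesis
    by simp
qed

lemma br_Tx:
  assumes a: "a \<in> V p"
  shows "br TT (xx i1 a) = - xx i1 (a * e)" "br TT (xx i2 a) = xx i2 (a * e)"
  unfolding br_homogeneous[OF TT_MG xx_MG[OF insertI1 insertI1 a]]
    br_homogeneous[OF TT_MG xx_MG[OF insertI2[OF insertI1] insertI2[OF insertI1] a]]
  using bar_mult_even(2)[OF e_even, of a]
  by (simp_all add: TT_def expand_simps bar_e rho.minus rho_bar[OF a] rho_bar[OF e_V(2)[OF a]]
      rho_homogeneous[OF e_V(1)[OF bar_V[OF a]]] rho_homogeneous[OF e_V(2)[OF bar_V[OF a]]]
      e_central signed_mult_left signed_mult_right signed_minus)

lemma br_Ty:
  assumes b: "b \<in> V q"
  shows "br TT (yy i1 b) = yy i1 (e * b)" "br TT (yy i2 b) = - yy i2 (e * b)"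
  unfolding br_homogeneous[OF TT_MG yy_MG[OF insertI1 insertI1 b]]
    br_homogeneous[OF TT_MG yy_MG[OF insertI2[OF insertI1] insertI2[OF insertI1] b]]
  using bar_mult_even(1)[OF e_even, of b]
  by (simp_all add: TT_def expand_simps bar_e rho.minus rho_bar[OF b] rho_bar[OF e_V(1)[OF b]]
      rho_homogeneous[OF e_V(1)[OF bar_V[OF b]]] rho_homogeneous[OF e_V(2)[OF bar_V[OF b]]]
      signed_mult_left signed_mult_right signed_minus)

end

section \<open>Weights with respect to \<open>hh\<close>\<close>

context superinvolution
begin

abbreviation hh :: "'r mat22" where "hh \<equiv> DD 1"

lemma hh_MG: "hh \<in> MG 0"
  by (rule DD_MG[OF V_one])

lemma br_hy: "k \<in> {i1, i2} \<Longrightarrow> br hh (yy k a) = - yy k a"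
proof (induction a rule: homogeneous_induct)
  case (homogeneous p a)
  then show ?case
    using br_swap[OF yy_MG[of k k a p] hh_MG] br_yh[of k a] by simp
qed (simp add: yy_add br_simps)

lemma br_hZ: "br hh (ZZ r) = ZZ (r + r)"
proof (induction r rule: homogeneous_induct)
  case (homogeneous p r)
  show ?case
    unfolding br_homogeneous[OF hh_MG ZZ_MG[OF homogeneous]] by (simp add: expand_simps)
qed (simp add: munit_add br_simps)

lemma br_hW: "br hh (WW r) = - WW (r + r)"
proof (induction r rule: homogeneous_induct)
  case (homogeneous p r)
  show ?case
    unfolding br_homogeneous[OF hh_MG WW_MG[OF homogeneous]] by (simp add: expand_simps)
qed (simp add: munit_add br_simps)

lemma br_Zx:
  assumes "a \<in> V p" "r \<in> V q" "k \<in> {i1, i2}"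
  shows "br (ZZ r) (xx k a) = 0"
  unfolding br_homogeneous[OF ZZ_MG[OF assms(2)] xx_MG[OF assms(3,3,1)]]
  by (insert assms, elim insertE emptyE; simp add: expand_simps)

lemma br_Wy:
  assumes "a \<in> V p" "r \<in> V q" "k \<in> {i1, i2}"
  shows "br (WW r) (yy k a) = 0"
  unfolding br_homogeneous[OF WW_MG[OF assms(2)] yy_MG[OF assms(3,3,1)]]
  by (insert assms, elim insertE emptyE; simp add: expand_simps)

definition xspace :: "'r mat22 set" where "xspace = {xx i1 a + xx i2 b | a b. True}"
definition yspace :: "'r mat22 set" where "yspace = {yy i1 a + yy i2 b | a b. True}"

lemma xspace_add: "X \<in> xspace \<Longrightarrow> Y \<in> xspace \<Longrightarrow> X + Y \<in> xspace"
proof -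
  have "(xx i1 a + xx i2 b) + (xx i1 c + xx i2 d) = xx i1 (a + c) + xx i2 (b + d)" for a b c d
    by (simp add: xx_add)
  then show "X \<in> xspace \<Longrightarrow> Y \<in> xspace \<Longrightarrow> X + Y \<in> xspace"
    unfolding xspace_def by blast
qed

lemma yspace_add: "X \<in> yspace \<Longrightarrow> Y \<in> yspace \<Longrightarrow> X + Y \<in> yspace"
proof -
  have "(yy i1 a + yy i2 b) + (yy i1 c + yy i2 d) = yy i1 (a + c) + yy i2 (b + d)" for a b c d
    by (simp add: yy_add)
  then show "X \<in> yspace \<Longrightarrow> Y \<in> yspace \<Longrightarrow> X + Y \<in> yspace"
    unfolding yspace_def by blast
qed

lemma xspace_signed: "X \<in> xspace \<Longrightarrow> signed p X \<in> xspace"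
proof -
  have "signed p (xx i1 a + xx i2 b) = xx i1 (signed p a) + xx i2 (signed p b)" for a b
    by (simp add: xx_signed signed_add)
  then show "X \<in> xspace \<Longrightarrow> signed p X \<in> xspace"
    unfolding xspace_def by blast
qed

lemma yspace_signed: "X \<in> yspace \<Longrightarrow> signed p X \<in> yspace"
proof -
  have "signed p (yy i1 a + yy i2 b) = yy i1 (signed p a) + yy i2 (signed p b)" for a b
    by (simp add: yy_signed signed_add)
  then show "X \<in> yspace \<Longrightarrow> signed p X \<in> yspace"
    unfolding yspace_def by blast
qed

lemma xx_xspace: "k \<in> {i1, i2} \<Longrightarrow> xx k a \<in> xspace"
proof -
  have "xx i1 a = xx i1 a + xx i2 0" "xx i2 a = xx i1 0 + xx i2 a"
    by (simp_all add: xx.zero)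
  then show "k \<in> {i1, i2} \<Longrightarrow> xx k a \<in> xspace"
    unfolding xspace_def by blast
qed

lemma yy_yspace: "k \<in> {i1, i2} \<Longrightarrow> yy k a \<in> yspace"
proof -
  have "yy i1 a = yy i1 a + yy i2 0" "yy i2 a = yy i1 0 + yy i2 a"
    by (simp_all add: yy.zero)
  then show "k \<in> {i1, i2} \<Longrightarrow> yy k a \<in> yspace"
    unfolding yspace_def by blast
qed

lemma zero_xspace: "0 \<in> xspace" and zero_yspace: "0 \<in> yspace"
  using xx_xspace[of i1 0] yy_yspace[of i1 0] by (simp_all add: xx.zero yy.zero)

lemma xspace_minus: "X \<in> xspace \<Longrightarrow> - X \<in> xspace" and yspace_minus: "X \<in> yspace \<Longrightarrow> - X \<in> yspace"
  using xspace_signed[of X 1] yspace_signed[of X 1] by simp_all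

lemma xspace_diff: "X \<in> xspace \<Longrightarrow> Y \<in> xspace \<Longrightarrow> X - Y \<in> xspace"
  and yspace_diff: "X \<in> yspace \<Longrightarrow> Y \<in> yspace \<Longrightarrow> X - Y \<in> yspace"
  using xspace_add[of X "- Y"] xspace_minus[of Y] yspace_add[of X "- Y"] yspace_minus[of Y] by simp_all

lemma br_xy_x:
  assumes a: "a \<in> V p" and b: "b \<in> V q" and c: "c \<in> V r"
    and k: "k \<in> {i1, i2}" and l: "l \<in> {i1, i2}" and m: "m \<in> {i1, i2}"
  shows "br (br (xx k a) (yy l b)) (xx m c) \<in> xspace"
proof -
  have "br (xx m c) (AA l k (b * a)) \<in> xspace"
    unfolding br_xA[OF c V_mult[OF b a] m l k]
    by (intro xspace_diff) (simp_all only: xx_xspace[OF k] xx_xspace[OF l] zero_xspace split: if_splits, simp_all)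
  then have "br (AA l k (b * a)) (xx m c) \<in> xspace"
    unfolding br_swap[OF xx_MG[OF m m c] AA_MG[OF l k V_mult[OF b a]]]
    by (intro xspace_minus xspace_signed)
  moreover have "br (DD (a * b)) (xx m c) \<in> xspace"
    unfolding br_Dx[OF c V_mult[OF a b] m] by (rule xx_xspace[OF m])
  ultimately show ?thesis
    unfolding br_xy[OF a b k l] br_simps
    by (intro xspace_add xspace_signed) (simp_all add: br_simps zero_xspace)
qed

lemma br_xy_y:
  assumes a: "a \<in> V p" and b: "b \<in> V q" and c: "c \<in> V r"
    and k: "k \<in> {i1, i2}" and l: "l \<in> {i1, i2}" and m: "m \<in> {i1, i2}"
  shows "br (br (xx k a) (yy l b)) (yy m c) \<in> yspace"
proof -
  have "br (AA l k (b * a)) (yy m c) \<in> yspace"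
    unfolding br_Ay[OF c V_mult[OF b a] m l k]
    by (intro yspace_diff) (simp_all only: yy_yspace[OF k] yy_yspace[OF l] zero_yspace split: if_splits, simp_all)
  moreover have "br (yy m c) (DD (a * b)) \<in> yspace"
    unfolding br_yD[OF c V_mult[OF a b] m] by (rule yy_yspace[OF m])
  then have "br (DD (a * b)) (yy m c) \<in> yspace"
    unfolding br_swap[OF yy_MG[OF m m c] DD_MG[OF V_mult[OF a b]]]
    by (intro yspace_minus yspace_signed)
  ultimately show ?thesis
    unfolding br_xy[OF a b k l] br_simps
    by (intro yspace_add yspace_signed) (simp_all add: br_simps zero_yspace)
qed

end

context osp22
begin

text \<open>By \<open>br_xx\<close>, the bracket of \<open>xx i1 b\<close> and
  \<open>xx i1 1\<close> is the negative of \<open>ZZ (b + bar b)\<close>; a symmetric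
  \<open>r\<close> is therefore hit by \<open>b = - hf r\<close>.\<close>

lemma ZZ_eq_br:
  assumes "r \<in> V p" "bar r = r"
  shows "ZZ r = br (xx i1 (- hf r)) (xx i1 1)"
  using assms(2) hf_double[of "- r"]
  by (simp add: br_xx[OF minus_V[OF scale_V[OF assms(1)]] V_one] hf_simps bar.neg munit_minus flip: munit_add)

lemma WW_eq_br:
  assumes "r \<in> V p" "bar r = r"
  shows "WW r = br (yy i1 1) (yy i1 (hf r))"
  using assms(2) by (simp add: br_yy[OF V_one scale_V[OF assms(1)]] hf_simps flip: munit_add)

lemma ZZ_L: "bar r = r \<Longrightarrow> ZZ r \<in> L"
proof -
  assume r: "bar r = r"
  have "br hh (ZZ (hf r)) \<in> L"
    using r by (intro br_L DD_OT ZZ_OT) (simp add: hf_simps)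
  then show ?thesis
    by (simp add: br_hZ)
qed

lemma WW_L: "bar r = r \<Longrightarrow> WW r \<in> L"
proof -
  assume r: "bar r = r"
  have "br hh (WW (hf r)) \<in> L"
    using r by (intro br_L DD_OT WW_OT) (simp add: hf_simps)
  then show ?thesis
    using L_minus[of "- WW r"] by (simp add: br_hW)
qed

lemma odd_generatorsE:
  assumes "g \<in> odd_generators"
  obtains (x) k a p where "k \<in> {i1, i2}" "a \<in> V p" "g = xx k a"
    | (y) k a p where "k \<in> {i1, i2}" "a \<in> V p" "g = yy k a"
  using assms unfolding odd_generators_def by blast

text \<open>The weight 0 part is represented by brackets, which the Leibniz rule can take apart. The
  inductive form allows a pair of generators to be treated by two case analyses.\<close>

inductive_set weight_generators :: "'r mat22 set" where
  x: "k \<in> {i1, i2} \<Longrightarrow> a \<in> V p \<Longrightarrow> xx k a \<in> weight_generators"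
| y: "k \<in> {i1, i2} \<Longrightarrow> a \<in> V p \<Longrightarrow> yy k a \<in> weight_generators"
| Z: "r \<in> V p \<Longrightarrow> bar r = r \<Longrightarrow> ZZ r \<in> weight_generators"
| W: "r \<in> V p \<Longrightarrow> bar r = r \<Longrightarrow> WW r \<in> weight_generators"
| xy: "k \<in> {i1, i2} \<Longrightarrow> l \<in> {i1, i2} \<Longrightarrow> a \<in> V p \<Longrightarrow> b \<in> V q \<Longrightarrow> br (xx k a) (yy l b) \<in> weight_generators"

lemma L_induct_weights [consumes 1, case_names generator add]:
  assumes "X \<in> L"
    and gen: "\<And>g. g \<in> weight_generators \<Longrightarrow> P g"
    and add: "\<And>X Y. P X \<Longrightarrow> P Y \<Longrightarrow> P (X + Y)"
  shows "P X"
  using assms(1)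
proof (induction rule: L_induct)
  case (generator g)
  then show ?case
    by (cases rule: odd_generatorsE) (auto intro: gen weight_generators.intros)
next
  note x = gen[OF weight_generators.x] and Z = gen[OF weight_generators.Z]
    and W = gen[OF weight_generators.W] and xy = gen[OF weight_generators.xy]
  have zero: "P 0"
    using x[of i1 0 0] by (simp add: xx.zero)
  case (bracket g g')
  have xx: "P (br (xx k a) (xx l b))"
    if "k \<in> {i1, i2}" "l \<in> {i1, i2}" "a \<in> V p" "b \<in> V q" for k l a b p q
  proof -
    let ?s = "- signed q (a * bar b + bar (a * bar b))"
    have "?s \<in> V (p + q)"
      using V_mult[OF that(3) bar_V[OF that(4)]] bar_V by (intro minus_V signed_V add_V) auto
    moreover have "bar ?s = ?s"
      by (simp add: bar.neg bar_signed bar.add bar_bar add.commute)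
    ultimately have "P (ZZ ?s)"
      by (rule Z)
    then show ?thesis
      unfolding br_xx[OF that(3,4,1,2)] by (simp add: zero munit_minus munit_signed)
  qed
  have yy: "P (br (yy k a) (yy l b))"
    if "k \<in> {i1, i2}" "l \<in> {i1, i2}" "a \<in> V p" "b \<in> V q" for k l a b p q
  proof -
    let ?s = "signed p (bar a * b + bar (bar a * b))"
    have "?s \<in> V (p + q)"
      using V_mult[OF bar_V[OF that(3)] that(4)] bar_V by (intro signed_V add_V) auto
    moreover have "bar ?s = ?s"
      by (simp add: bar_signed bar.add bar_bar add.commute)
    ultimately have "P (WW ?s)"
      by (rule W)
    then show ?thesis
      unfolding br_yy[OF that(3,4,1,2)] by (simp add: zero munit_signed)
  qed
  have yx: "P (br (yy k a) (xx l b))"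
    if "k \<in> {i1, i2}" "l \<in> {i1, i2}" "a \<in> V p" "b \<in> V q" for k l a b p q
  proof -
    have "br (yy k a) (xx l b) = br (xx l (- signed ((q + 1) * (p + 1)) b)) (yy k a)"
      unfolding br_swap[OF xx_MG[OF that(2,2,4)] yy_MG[OF that(1,1,3)]]
      by (simp add: xx.minus xx_signed br_simps)
    then show ?thesis
      using xy[OF that(2,1) minus_V[OF signed_V[OF that(4)]] that(3)] by simp
  qed
  from bracket(1) show ?case
  proof (cases rule: odd_generatorsE)
    case g: (x k a p)
    from bracket(2) show ?thesis
      by (cases rule: odd_generatorsE)
        (simp_all only: g(3), (rule xx[OF g(1) _ g(2)] xy[OF g(1) _ g(2)]; assumption)+)
  next
    case g: (y k a p)
    from bracket(2) show ?thesis
      by (cases rule: odd_generatorsE)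
        (simp_all only: g(3), (rule yx[OF g(1) _ g(2)] yy[OF g(1) _ g(2)]; assumption)+)
  qed
qed (rule add)

end

context osp22_unit
begin

text \<open>The degree is hidden because signs are irrelevant in statements that a value
  vanishes.\<close>

definition homog :: "'r mat22 \<Rightarrow> bool" where
  "homog X \<longleftrightarrow> X \<in> L \<and> (\<exists>p. X \<in> MG p)"

lemma homog_intros:
  "k \<in> {i1, i2} \<Longrightarrow> a \<in> V p \<Longrightarrow> homog (xx k a)"
  "k \<in> {i1, i2} \<Longrightarrow> a \<in> V p \<Longrightarrow> homog (yy k a)"
  "a \<in> V p \<Longrightarrow> bar a = a \<Longrightarrow> homog (ZZ a)"
  "a \<in> V p \<Longrightarrow> bar a = a \<Longrightarrow> homog (WW a)"
  "homog X \<Longrightarrow> homog Y \<Longrightarrow> homog (br X Y)"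
  "homog hh" "homog TT"
  unfolding homog_def
  using xx_L xx_MG yy_L yy_MG ZZ_L ZZ_MG WW_L WW_MG br_LL br_MG hh_L hh_MG TT_L TT_MG by metis+

end

text \<open>Instantiated with the universal cocycle, whose values lie in
  \<open>all_quotients\<close>, and with the difference between a cocycle and its normal
  form.\<close>

locale osp22_cocycle = osp22_unit sc V bar half e ei
  for sc :: "'k::comm_ring_1 \<Rightarrow> 'r::ring_1 \<Rightarrow> 'r" and V :: "bit \<Rightarrow> 'r set" and bar :: "'r \<Rightarrow> 'r" and half :: 'k
    and e ei :: 'r +
  fixes \<beta> :: "'r mat22 \<Rightarrow> 'r mat22 \<Rightarrow> 'g::ab_group_add"
  assumes \<beta>_add_left: "X \<in> L \<Longrightarrow> X' \<in> L \<Longrightarrow> Y \<in> L \<Longrightarrow> \<beta> (X + X') Y = \<beta> X Y + \<beta> X' Y"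
    and \<beta>_add_right: "X \<in> L \<Longrightarrow> Y \<in> L \<Longrightarrow> Y' \<in> L \<Longrightarrow> \<beta> X (Y + Y') = \<beta> X Y + \<beta> X Y'"
    and \<beta>_skew: "X \<in> L \<Longrightarrow> X \<in> MG p \<Longrightarrow> Y \<in> L \<Longrightarrow> Y \<in> MG q \<Longrightarrow> \<beta> X Y + signed (p * q) (\<beta> Y X) = 0"
    and \<beta>_cyclic: "X \<in> L \<Longrightarrow> X \<in> MG p \<Longrightarrow> Y \<in> L \<Longrightarrow> Y \<in> MG q \<Longrightarrow> Z \<in> L \<Longrightarrow> Z \<in> MG r \<Longrightarrow>
      signed (p * r) (\<beta> (br X Y) Z) + signed (q * p) (\<beta> (br Y Z) X) + signed (r * q) (\<beta> (br Z X) Y) = 0"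
begin

lemma \<beta>_zero_left: "Y \<in> L \<Longrightarrow> \<beta> 0 Y = 0"
  using \<beta>_add_left[of 0 0 Y] by simp

lemma \<beta>_zero_right: "X \<in> L \<Longrightarrow> \<beta> X 0 = 0"
  using \<beta>_add_right[of X 0 0] by simp

lemma \<beta>_minus_left: "X \<in> L \<Longrightarrow> Y \<in> L \<Longrightarrow> \<beta> (- X) Y = - \<beta> X Y"
  using \<beta>_add_left[of X "- X" Y] by (simp add: L_minus \<beta>_zero_left eq_neg_iff_add_eq_0 add.commute)

lemma \<beta>_minus_right: "X \<in> L \<Longrightarrow> Y \<in> L \<Longrightarrow> \<beta> X (- Y) = - \<beta> X Y"
  using \<beta>_add_right[of X Y "- Y"] by (simp add: L_minus \<beta>_zero_right eq_neg_iff_add_eq_0 add.commute)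

lemma \<beta>_signed_left: "X \<in> L \<Longrightarrow> Y \<in> L \<Longrightarrow> \<beta> (signed p X) Y = signed p (\<beta> X Y)"
  and \<beta>_signed_right: "X \<in> L \<Longrightarrow> Y \<in> L \<Longrightarrow> \<beta> X (signed p Y) = signed p (\<beta> X Y)"
  by (simp_all add: signed_def \<beta>_minus_left \<beta>_minus_right)

lemma \<beta>_swap: "X \<in> L \<Longrightarrow> X \<in> MG p \<Longrightarrow> Y \<in> L \<Longrightarrow> Y \<in> MG q \<Longrightarrow> \<beta> Y X = - signed (p * q) (\<beta> X Y)"
  using \<beta>_skew[of Y q X p] by (simp add: eq_neg_iff_add_eq_0 mult.commute)

lemma \<beta>_leibniz:
  assumes X: "X \<in> L" "X \<in> MG p" and Y: "Y \<in> L" "Y \<in> MG q" and Z: "Z \<in> L" "Z \<in> MG r"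
  shows "\<beta> X (br Y Z) = \<beta> (br X Y) Z + signed (p * q) (\<beta> Y (br X Z))"
proof -
  have 1: "\<beta> (br Y Z) X = - signed (p * (q + r)) (\<beta> X (br Y Z))"
    using \<beta>_swap[OF X br_LL[OF Y(1) Z(1)] br_MG[OF Y(2) Z(2)]] .
  have 2: "\<beta> (br Z X) Y = signed (p * r + q * (p + r)) (\<beta> Y (br X Z))"
    unfolding br_swap[OF X(2) Z(2)]
    using \<beta>_swap[OF Y br_LL[OF X(1) Z(1)] br_MG[OF X(2) Z(2)]] br_LL[OF X(1) Z(1)] Y(1)
    by (simp add: \<beta>_minus_left L_signed \<beta>_signed_left signed_signed signed_minus)
  show ?thesis
    using \<beta>_cyclic[OF X Y Z] unfolding 1 2
    by (cases p; cases q; cases r; simp add: algebra_simps eq_neg_iff_add_eq_0 neg_eq_iff_add_eq_0)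
qed

text \<open>Moving \<open>G\<close> from the first argument to the second costs a single value, in
  which \<open>G\<close> is paired with the bracket of the other two.\<close>

lemma \<beta>_derivation:
  assumes X: "X \<in> L" "X \<in> MG p" and G: "G \<in> L" "G \<in> MG g" and Y: "Y \<in> L" "Y \<in> MG q"
  shows "\<beta> (br X G) Y - \<beta> X (br G Y) = signed (g * q) (\<beta> (br X Y) G)"
proof -
  have "\<beta> G (br X Y) = - signed ((p + q) * g) (\<beta> (br X Y) G)"
    using \<beta>_swap[OF br_LL[OF X(1) Y(1)] br_MG[OF X(2) Y(2)] G] .
  then show ?thesis
    using \<beta>_leibniz[OF X G Y] by (cases p; cases g; cases q; simp add: algebra_simps)
qed

section \<open>Cocycles that vanish on opposite root vectors and on \<open>hh\<close> paired with
  nonzero weights\<close>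

context
  notes i1 = insertI1[of i1 "{i2}"]
  assumes \<beta>_xy: "\<And>k l a b. k \<in> {i1, i2} \<Longrightarrow> l \<in> {i1, i2} \<Longrightarrow> \<beta> (xx k a) (yy l b) = 0"
    and \<beta>_hx: "\<And>k a. k \<in> {i1, i2} \<Longrightarrow> \<beta> hh (xx k a) = 0"
    and \<beta>_hy: "\<And>k a. k \<in> {i1, i2} \<Longrightarrow> \<beta> hh (yy k a) = 0"
    and \<beta>_hZ: "\<And>r. bar r = r \<Longrightarrow> \<beta> hh (ZZ r) = 0"
    and \<beta>_hW: "\<And>r. bar r = r \<Longrightarrow> \<beta> hh (WW r) = 0"
begin

lemma vanish_swap:
  assumes "homog X" "homog Y" "\<beta> X Y = 0"
  shows "\<beta> Y X = 0"
proof -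
  obtain p q where "X \<in> L" "X \<in> MG p" "Y \<in> L" "Y \<in> MG q"
    using assms unfolding homog_def by blast
  from \<beta>_swap[OF this] show ?thesis
    using assms(3) by simp
qed

lemma vanish_iff:
  assumes "homog X" "homog Y" "homog Z" "\<beta> Y (br X Z) = 0"
  shows "\<beta> X (br Y Z) = \<beta> (br X Y) Z"
proof -
  obtain p q r where "X \<in> L" "X \<in> MG p" "Y \<in> L" "Y \<in> MG q" "Z \<in> L" "Z \<in> MG r"
    using assms unfolding homog_def by blast
  from \<beta>_leibniz[OF this] show ?thesis
    using assms(4) by simp
qed

lemma vanish_right:
  assumes "homog X" "homog Y" "homog Z" "\<beta> (br X Y) Z = 0" "\<beta> Y (br X Z) = 0"
  shows "\<beta> X (br Y Z) = 0"
  using assms vanish_iff by simp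

lemma vanish_left:
  assumes "homog X" "homog Y" "homog Z" "\<beta> X (br Y Z) = 0" "\<beta> Y (br X Z) = 0"
  shows "\<beta> (br X Y) Z = 0"
  using assms vanish_iff by simp

lemma vanish_xspace:
  assumes "X \<in> L" and "\<And>k a p. k \<in> {i1, i2} \<Longrightarrow> a \<in> V p \<Longrightarrow> \<beta> X (xx k a) = 0" and "Y \<in> xspace"
  shows "\<beta> X Y = 0"
proof -
  have "\<beta> X (xx k a) = 0" if "k \<in> {i1, i2}" for k a
    by (induction a rule: homogeneous_induct)
      (use assms that in \<open>simp_all add: xx_add \<beta>_add_right xx_L\<close>)
  then show ?thesis
    using assms by (auto simp: xspace_def \<beta>_add_right xx_L)
qed

lemma vanish_yspace:
  assumes "X \<in> L" and "\<And>k a p. k \<in> {i1, i2} \<Longrightarrow> a \<in> V p \<Longrightarrow> \<beta> X (yy k a) = 0" and "Y \<in> yspace"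
  shows "\<beta> X Y = 0"
proof -
  have "\<beta> X (yy k a) = 0" if "k \<in> {i1, i2}" for k a
    by (induction a rule: homogeneous_induct)
      (use assms that in \<open>simp_all add: yy_add \<beta>_add_right yy_L\<close>)
  then show ?thesis
    using assms by (auto simp: yspace_def \<beta>_add_right yy_L)
qed

lemma xspace_y: "X \<in> xspace \<Longrightarrow> k \<in> {i1, i2} \<Longrightarrow> \<beta> X (yy k b) = 0"
  by (auto simp: xspace_def \<beta>_add_left xx_L yy_L \<beta>_xy)

lemma hspace: "X \<in> xspace \<Longrightarrow> \<beta> hh X = 0" "X \<in> yspace \<Longrightarrow> \<beta> hh X = 0"
  by (auto simp: xspace_def yspace_def \<beta>_add_right xx_L yy_L \<beta>_hx \<beta>_hy hh_L)

text \<open>By the Leibniz rule for \<open>hh\<close>, the value at \<open>hh\<close> and a bracket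
  is the total weight times the value on the pair. Here the weight is 2, which \<open>hf a\<close>
  compensates.\<close>

lemma x_x:
  assumes "k \<in> {i1, i2}" "l \<in> {i1, i2}" "a \<in> V p" "b \<in> V q"
  shows "\<beta> (xx k a) (xx l b) = 0"
proof -
  have "\<beta> (xx k a) (xx l b) + \<beta> (xx k a) (xx l b) = 0" if a: "a \<in> V p" for a
  proof -
    have "\<beta> hh (br (xx k a) (xx l b)) = 0"
      unfolding br_xx[OF a assms(4,1,2)]
      by (simp add: \<beta>_minus_right \<beta>_signed_right L_signed ZZ_L hh_L \<beta>_hZ \<beta>_zero_right bar.add bar_bar add.commute)
    then show ?thesis
      using \<beta>_leibniz[OF hh_L hh_MG xx_L xx_MG xx_L xx_MG, of k k a p l l b q] assms a
      by (simp add: br_hx)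
  qed
  from this[OF scale_V[OF assms(3)], of half] show ?thesis
    using \<beta>_add_left[of "xx k (hf a)" "xx k (hf a)" "xx l b"] assms by (simp add: xx_L flip: xx_add)
qed

lemma y_y:
  assumes "k \<in> {i1, i2}" "l \<in> {i1, i2}" "a \<in> V p" "b \<in> V q"
  shows "\<beta> (yy k a) (yy l b) = 0"
proof -
  have "\<beta> (yy k a) (yy l b) + \<beta> (yy k a) (yy l b) = 0" if a: "a \<in> V p" for a
  proof -
    have "\<beta> hh (br (yy k a) (yy l b)) = 0"
      unfolding br_yy[OF a assms(4,1,2)]
      by (simp add: \<beta>_signed_right WW_L hh_L \<beta>_hW \<beta>_zero_right bar.add bar_bar add.commute)
    then show ?thesis
      using \<beta>_leibniz[OF hh_L hh_MG yy_L yy_MG yy_L yy_MG, of k k a p l l b q] assms a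
      by (simp add: br_hy \<beta>_minus_left \<beta>_minus_right yy_L neg_eq_iff_add_eq_0 eq_neg_iff_add_eq_0)
  qed
  from this[OF scale_V[OF assms(3)], of half] show ?thesis
    using \<beta>_add_left[of "yy k (hf a)" "yy k (hf a)" "yy l b"] assms by (simp add: yy_L flip: yy_add)
qed

context
  fixes k l :: idx and a b :: 'r and p q :: bit
  assumes kl: "k \<in> {i1, i2}" "l \<in> {i1, i2}" and ab: "a \<in> V p" "b \<in> V q"
begin

lemma br_h_xy: "br hh (br (xx k a) (yy l b)) = 0"
  using br_jacobi[OF hh_MG xx_MG[OF kl(1,1) ab(1)] yy_MG[OF kl(2,2) ab(2)]] kl
  by (simp add: br_hx br_hy br_simps)

lemma xy_L: "br (xx k a) (yy l b) \<in> L"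
  using kl by (intro br_LL xx_L yy_L)

lemma xy_MG: "br (xx k a) (yy l b) \<in> MG ((p + 1) + (q + 1))"
  using kl ab by (intro br_MG xx_MG yy_MG)

lemma homogeneous_xy: "homog (br (xx k a) (yy l b))"
  using kl ab by (intro homog_intros)

text \<open>\<open>hh\<close> commutes with the first argument and fixes \<open>xx m c\<close>, so
  the Leibniz rule turns the value into one of \<open>hh\<close> on an element of weight 1.\<close>

lemma xy_x:
  assumes "m \<in> {i1, i2}" "c \<in> V r"
  shows "\<beta> (br (xx k a) (yy l b)) (xx m c) = 0"
  using \<beta>_leibniz[OF hh_L hh_MG xy_L xy_MG xx_L[OF assms(1)] xx_MG[OF assms(1,1,2)]]
    hspace(1)[OF br_xy_x[OF ab assms(2) kl assms(1)]] assms
  by (simp add: br_h_xy br_hx \<beta>_zero_left xx_L)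

lemma xy_y:
  assumes "m \<in> {i1, i2}" "c \<in> V r"
  shows "\<beta> (br (xx k a) (yy l b)) (yy m c) = 0"
  using \<beta>_leibniz[OF hh_L hh_MG xy_L xy_MG yy_L[OF assms(1)] yy_MG[OF assms(1,1,2)]]
    hspace(2)[OF br_xy_y[OF ab assms(2) kl assms(1)]] assms
  by (simp add: br_h_xy br_hy \<beta>_zero_left yy_L \<beta>_minus_right xy_L)

end

lemma x_xspace: "k \<in> {i1, i2} \<Longrightarrow> a \<in> V p \<Longrightarrow> Y \<in> xspace \<Longrightarrow> \<beta> (xx k a) Y = 0"
  by (rule vanish_xspace) (auto simp: xx_L x_x)

lemma y_yspace: "k \<in> {i1, i2} \<Longrightarrow> a \<in> V p \<Longrightarrow> Y \<in> yspace \<Longrightarrow> \<beta> (yy k a) Y = 0"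
  by (rule vanish_yspace) (auto simp: yy_L y_y)

lemma xspace_x: "Y \<in> xspace \<Longrightarrow> homog Y \<Longrightarrow> k \<in> {i1, i2} \<Longrightarrow> a \<in> V p \<Longrightarrow> \<beta> Y (xx k a) = 0"
  by (rule vanish_swap[OF homog_intros(1) _ x_xspace])

lemma yspace_y: "Y \<in> yspace \<Longrightarrow> homog Y \<Longrightarrow> k \<in> {i1, i2} \<Longrightarrow> a \<in> V p \<Longrightarrow> \<beta> Y (yy k a) = 0"
  by (rule vanish_swap[OF homog_intros(2) _ y_yspace])

lemma x_yspace: "k \<in> {i1, i2} \<Longrightarrow> Y \<in> yspace \<Longrightarrow> \<beta> (xx k a) Y = 0"
  by (rule vanish_yspace) (auto simp: xx_L \<beta>_xy)

context
  fixes r :: 'r and q :: bit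
  assumes r: "r \<in> V q" "bar r = r"
begin

lemma Z_factors: "homog (xx i1 (- hf r))" "homog (xx i1 1)" "- hf r \<in> V q"
  and W_factors: "homog (yy i1 1)" "homog (yy i1 (hf r))" "hf r \<in> V q"
  using r minus_V[OF scale_V] scale_V V_one by (auto intro!: homog_intros)

lemma homogeneous_ZW: "homog (ZZ r)" "homog (WW r)"
  using r by (auto intro: homog_intros)

text \<open>The total weight is 3, so \<open>hh\<close> would only show that three times the value
  is 0. Instead, \<open>TT\<close> commutes with \<open>ZZ r\<close>, and \<open>ZZ r\<close> with
  every \<open>xx\<close>, while every \<open>xx k a\<close> is a bracket with \<open>TT\<close>
  because \<open>e\<close> is a unit.\<close>

lemma Z_x:
  assumes "k \<in> {i1, i2}" "a \<in> V p"
  shows "\<beta> (ZZ r) (xx k a) = 0"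
proof -
  have TZ: "br TT (ZZ r) = 0"
    unfolding br_homogeneous[OF TT_MG ZZ_MG[OF r(1)]] by (simp add: TT_def expand_simps)
  have "\<beta> (ZZ r) (br TT (xx k (a * ei))) = 0"
    using \<beta>_leibniz[OF TT_L TT_MG ZZ_L[OF r(2)] ZZ_MG[OF r(1)] xx_L[OF assms(1)] xx_MG[OF assms(1,1) ei_V(2)[OF assms(2)]]]
      br_Zx[OF ei_V(2)[OF assms(2)] r(1) assms(1)] assms
    by (simp add: TZ \<beta>_zero_left \<beta>_zero_right xx_L TT_L)
  then show ?thesis
    using assms(1) br_Tx[OF ei_V(2)[OF assms(2)]]
    by (auto simp: e_cancel \<beta>_minus_right ZZ_L r xx_L)
qed

lemma W_y:
  assumes "k \<in> {i1, i2}" "a \<in> V p"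
  shows "\<beta> (WW r) (yy k a) = 0"
proof -
  have TW: "br TT (WW r) = 0"
    unfolding br_homogeneous[OF TT_MG WW_MG[OF r(1)]] by (simp add: TT_def expand_simps)
  have "\<beta> (WW r) (br TT (yy k (ei * a))) = 0"
    using \<beta>_leibniz[OF TT_L TT_MG WW_L[OF r(2)] WW_MG[OF r(1)] yy_L[OF assms(1)] yy_MG[OF assms(1,1) ei_V(1)[OF assms(2)]]]
      br_Wy[OF ei_V(1)[OF assms(2)] r(1) assms(1)] assms
    by (simp add: TW \<beta>_zero_left \<beta>_zero_right yy_L TT_L)
  then show ?thesis
    using assms(1) br_Ty[OF ei_V(1)[OF assms(2)]]
    by (auto simp: e_cancel \<beta>_minus_right WW_L r yy_L)
qed

text \<open>\<open>ZZ r\<close> is a bracket of two elements of weight 1, and an element of weight 0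
  preserves that weight. The Leibniz rule leaves only values on pairs of weight 1.\<close>

lemma xy_Z:
  assumes "k \<in> {i1, i2}" "l \<in> {i1, i2}" "a \<in> V p" "b \<in> V p'"
  shows "\<beta> (br (xx k a) (yy l b)) (ZZ r) = 0"
proof -
  have 1: "br (br (xx k a) (yy l b)) (xx i1 c) \<in> xspace" if "c \<in> V s" for c s
    by (rule br_xy_x[OF assms(3,4) that assms(1,2) i1])
  have 2: "homog (br (br (xx k a) (yy l b)) (xx i1 c))" if "c \<in> V s" for c s
    by (rule homog_intros(5)[OF homogeneous_xy[OF assms] homog_intros(1)[OF i1 that]])
  show ?thesis
    unfolding ZZ_eq_br[OF r]
    by (rule vanish_right[OF homogeneous_xy[OF assms] Z_factors(1,2)
          xspace_x[OF 1[OF Z_factors(3)] 2[OF Z_factors(3)] i1 V_one] x_xspace[OF i1 Z_factors(3) 1[OF V_one]]])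
qed

lemma xy_W:
  assumes "k \<in> {i1, i2}" "l \<in> {i1, i2}" "a \<in> V p" "b \<in> V p'"
  shows "\<beta> (br (xx k a) (yy l b)) (WW r) = 0"
proof -
  have 1: "br (br (xx k a) (yy l b)) (yy i1 c) \<in> yspace" if "c \<in> V s" for c s
    by (rule br_xy_y[OF assms(3,4) that assms(1,2) i1])
  have 2: "homog (br (br (xx k a) (yy l b)) (yy i1 c))" if "c \<in> V s" for c s
    by (rule homog_intros(5)[OF homogeneous_xy[OF assms] homog_intros(2)[OF i1 that]])
  show ?thesis
    unfolding WW_eq_br[OF r]
    by (rule vanish_right[OF homogeneous_xy[OF assms] W_factors(1,2)
          yspace_y[OF 1[OF V_one] 2[OF V_one] i1 W_factors(3)] y_yspace[OF i1 V_one 1[OF W_factors(3)]]])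
qed

lemma Z_y:
  assumes "k \<in> {i1, i2}" "a \<in> V p"
  shows "\<beta> (ZZ r) (yy k a) = 0"
  unfolding ZZ_eq_br[OF r]
  by (rule vanish_left[OF Z_factors(1,2) homog_intros(2)[OF assms]
        vanish_swap[OF homogeneous_xy Z_factors(1) xy_x[OF _ _ _ _ i1 Z_factors(3)]]
        vanish_swap[OF homogeneous_xy Z_factors(2) xy_x[OF _ _ _ _ i1 V_one]]];
      rule i1 assms V_one Z_factors)

lemma W_x:
  assumes "k \<in> {i1, i2}" "a \<in> V p"
  shows "\<beta> (WW r) (xx k a) = 0"
proof -
  have "\<beta> (yy i1 b) (br (yy i1 c) (xx k a)) = 0" if "b \<in> V s" "c \<in> V t" for b c s t
  proof -
    have "\<beta> (yy i1 b) (br (xx k a) (yy i1 c)) = 0"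
      by (rule vanish_swap[OF homogeneous_xy[OF assms(1) i1 assms(2) that(2)] homog_intros(2)[OF i1 that(1)]
            xy_y[OF assms(1) i1 assms(2) that(2) i1 that(1)]])
    then show ?thesis
      unfolding br_swap[OF xx_MG[OF assms(1,1,2)] yy_MG[OF i1 i1 that(2)]]
      using xy_L[OF assms(1) i1 assms(2) that(2)] by (simp add: \<beta>_minus_right \<beta>_signed_right L_signed yy_L)
  qed
  note zero = this
  show ?thesis
    unfolding WW_eq_br[OF r]
    by (rule vanish_left[OF W_factors(1,2) homog_intros(1)[OF assms] zero[OF V_one W_factors(3)] zero[OF W_factors(3) V_one]])
qed

end

text \<open>\<open>ZZ r\<close> commutes with both factors of \<open>ZZ s\<close>, so both terms of
  the Leibniz rule vanish.\<close>

lemma Z_Z: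
  assumes r: "r \<in> V p" "bar r = r" and s: "s \<in> V q" "bar s = s"
  shows "\<beta> (ZZ r) (ZZ s) = 0"
proof -
  have "\<beta> (br (ZZ r) (xx i1 a)) (xx i1 b) = 0" "\<beta> (xx i1 b) (br (ZZ r) (xx i1 a)) = 0"
    if "a \<in> V t" for a b t
    by (simp_all add: br_Zx[OF that r(1)] \<beta>_zero_left \<beta>_zero_right xx_L)
  then show ?thesis
    unfolding ZZ_eq_br[OF s]
    using vanish_right[OF homogeneous_ZW(1)[OF r] Z_factors(1,2)[OF s]] Z_factors(3)[OF s] V_one by blast
qed

lemma W_W:
  assumes r: "r \<in> V p" "bar r = r" and s: "s \<in> V q" "bar s = s"
  shows "\<beta> (WW r) (WW s) = 0"
proof -
  have "\<beta> (br (WW r) (yy i1 a)) (yy i1 b) = 0" "\<beta> (yy i1 b) (br (WW r) (yy i1 a)) = 0"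
    if "a \<in> V t" for a b t
    by (simp_all add: br_Wy[OF that r(1)] \<beta>_zero_left \<beta>_zero_right yy_L)
  then show ?thesis
    unfolding WW_eq_br[OF s]
    using vanish_right[OF homogeneous_ZW(2)[OF r] W_factors(1,2)[OF s]] W_factors(3)[OF s] V_one by blast
qed

lemma Z_W:
  assumes r: "r \<in> V p" "bar r = r" and s: "s \<in> V q" "bar s = s"
  shows "\<beta> (ZZ r) (WW s) = 0"
proof -
  have 1: "\<beta> (br (ZZ r) (yy i1 a)) (yy i1 b) = 0" if a: "a \<in> V t" for a b t
    unfolding br_Zy[OF a r(1) i1 r(2)] by (simp add: \<beta>_signed_left xx_L yy_L \<beta>_xy)
  have "\<beta> (yy i1 b) (br (ZZ r) (yy i1 a)) = 0" if a: "a \<in> V t" and b: "b \<in> V t'" for a b t t'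
    by (rule vanish_swap[OF homog_intros(5)[OF homogeneous_ZW(1)[OF r] homog_intros(2)[OF i1 a]]
          homog_intros(2)[OF i1 b] 1[OF a]])
  with 1 show ?thesis
    unfolding WW_eq_br[OF s]
    using vanish_right[OF homogeneous_ZW(1)[OF r] W_factors(1,2)[OF s]] W_factors(3)[OF s] V_one by blast
qed

text \<open>The first argument has weight 0 and maps \<open>xx m c\<close> and \<open>yy n d\<close>
  to elements of the same weights, so only values on pairs of weights 1 and -1 remain.\<close>

lemma xy_xy:
  assumes "k \<in> {i1, i2}" "l \<in> {i1, i2}" "a \<in> V p" "b \<in> V q" "m \<in> {i1, i2}" "n \<in> {i1, i2}" "c \<in> V r" "d \<in> V s"
  shows "\<beta> (br (xx k a) (yy l b)) (br (xx m c) (yy n d)) = 0"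
  by (rule vanish_right[OF homogeneous_xy[OF assms(1-4)] homog_intros(1)[OF assms(5,7)]
        homog_intros(2)[OF assms(6,8)] xspace_y[OF br_xy_x[OF assms(3,4,7,1,2,5)] assms(6)]
        x_yspace[OF assms(5) br_xy_y[OF assms(3,4,8,1,2,6)]]])

theorem cocycle_vanishes:
  assumes "X \<in> L" "Y \<in> L"
  shows "\<beta> X Y = 0"
proof -
  note vanish = x_x y_y \<beta>_xy xy_x xy_y Z_x W_y xy_Z xy_W Z_y W_x Z_Z W_W Z_W xy_xy
  have hom: "homog X" if "X \<in> weight_generators" for X
    using that by induction (rule homog_intros(1-4) homogeneous_xy; assumption)+
  have pair: "\<beta> X Y = 0" if X: "X \<in> weight_generators" and Y: "Y \<in> weight_generators" for X Y
  proof -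
    \<comment> \<open>The list \<open>vanish\<close> contains each pair of kinds in at least one
      order; \<open>vanish_swap\<close> supplies the other.\<close>
    have "\<beta> X Y = 0 \<or> \<beta> Y X = 0"
      using X
    proof induction
      case x
      from Y show ?case
        by induction (insert x, (rule disjI1, rule vanish; assumption | rule disjI2, rule vanish; assumption)+)
    next
      case y
      from Y show ?case
        by induction (insert y, (rule disjI1, rule vanish; assumption | rule disjI2, rule vanish; assumption)+)
    next
      case Z
      from Y show ?case
        by induction (insert Z, (rule disjI1, rule vanish; assumption | rule disjI2, rule vanish; assumption)+)
    next
      case W
      from Y show ?case
        by induction (insert W, (rule disjI1, rule vanish; assumption | rule disjI2, rule vanish; assumption)+)
    next
      case xy
      from Y show ?case
        by induction (insert xy, (rule disjI1, rule vanish; assumption | rule disjI2, rule vanish; assumption)+)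
    qed
    then show ?thesis
      using vanish_swap hom X Y by blast
  qed
  have gen_L: "X \<in> weight_generators \<Longrightarrow> X \<in> L" for X
    using hom by (simp add: homog_def)
  \<comment> \<open>Membership in \<open>L\<close> is carried through the induction because \<beta>
    is additive on \<open>L\<close> only.\<close>
  have single: "Y \<in> L \<and> \<beta> X Y = 0" if "X \<in> weight_generators" for X
    using assms(2) by (induction rule: L_induct_weights) (use gen_L pair that in \<open>auto simp: \<beta>_add_right L_add\<close>)
  have "X \<in> L \<and> \<beta> X Y = 0"
    using assms(1) by (induction rule: L_induct_weights) (use gen_L single assms(2) in \<open>auto simp: \<beta>_add_left L_add\<close>)
  then show ?thesis ..
qed

end

end

section \<open>Normal form of cocycles\<close>

context superinvolution
begin

lemma basis_L:
  "xx i1 a \<in> L" "xx i2 a \<in> L" "yy i1 a \<in> L" "yy i2 a \<in> L" "AA i1 i2 a \<in> L" "AA i2 i1 a \<in> L"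
  by (simp_all add: xx_L yy_L AA12_L)

lemma basis_MG:
  assumes "a \<in> V p"
  shows "xx i1 a \<in> MG (p + 1)" "xx i2 a \<in> MG (p + 1)" "yy i1 a \<in> MG (p + 1)" "yy i2 a \<in> MG (p + 1)"
    "AA i1 i2 a \<in> MG p" "AA i2 i1 a \<in> MG p"
  by (rule xx_MG[OF insertI1 insertI1 assms] xx_MG[OF insertI2[OF insertI1] insertI2[OF insertI1] assms]
      yy_MG[OF insertI1 insertI1 assms] yy_MG[OF insertI2[OF insertI1] insertI2[OF insertI1] assms]
      AA_MG[OF insertI1 insertI2[OF insertI1] assms] AA_MG[OF insertI2[OF insertI1] insertI1 assms])+

lemma br_cyclic:
  assumes "X \<in> MG p" "Y \<in> MG q" "Z \<in> MG r"
  shows "signed (p * r) (br (br X Y) Z) + signed (q * p) (br (br Y Z) X) + signed (r * q) (br (br Z X) Y) = 0"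
  unfolding br_swap[OF assms(1,3)] br_simps
  unfolding br_swap[OF assms(1) br_MG[OF assms(2,3)]] br_swap[OF assms(2) br_MG[OF assms(1,3)]] br_jacobi[OF assms]
  by (cases p; cases q; cases r; simp)

lemma basis_nth:
  "xx k a $ i $ j = munit i3 k a $ i $ j - munit k i4 (rho V (bar a)) $ i $ j"
  "yy k b $ i $ j = munit k i3 b $ i $ j + munit i4 k (rho V (bar b)) $ i $ j"
  "AA k l c $ i $ j = munit k l c $ i $ j - munit l k (bar c) $ i $ j"
  "DD d $ i $ j = munit i3 i3 d $ i $ j - munit i4 i4 (bar d) $ i $ j"
  by (simp_all add: xx_def yy_def AA_def DD_def)

end

lemma (in osp22) det_form_xy:
  "det_form (xx i1 a) (yy i1 b) = 0" "det_form (xx i2 a) (yy i2 b) = 0"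
    "det_form (xx i1 a) (yy i2 b) = - (bar a * b)" "det_form (xx i2 a) (yy i1 b) = bar a * b"
  by (simp_all add: det_form_def basis_nth munit_nth bar.zero rho.zero rho.minus)

context osp22_cocycle
begin

section \<open>Values on root vectors with equal indices: the pairing \<open>lam\<close>\<close>

definition w :: "idx \<Rightarrow> idx \<Rightarrow> 'r \<Rightarrow> 'r \<Rightarrow> 'g" where
  "w k l a b = \<beta> (xx k a) (yy l b)"

definition P :: "'r \<Rightarrow> 'r \<Rightarrow> 'g" where
  "P b c = \<beta> (AA i2 i1 b) (AA i1 i2 c)"

text \<open>\<open>lam\<close> measures how far \<open>w i1 i1 a b\<close> is from a function of \<open>a * b\<close> (see \<open>w11_lam\<close>).\<close>

definition lam :: "'r \<Rightarrow> 'r \<Rightarrow> 'g" where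
  "lam b c = P b c - P (b * c) 1"

lemma biadditive_w: "k \<in> {i1, i2} \<Longrightarrow> l \<in> {i1, i2} \<Longrightarrow> biadditive (w k l)"
  by (auto simp: biadditive_def w_def xx_add yy_add \<beta>_add_left \<beta>_add_right basis_L)

lemmas w_simps = biadditive_simps[OF biadditive_w[of i1 i1, simplified]]
  biadditive_simps[OF biadditive_w[of i1 i2, simplified]] biadditive_simps[OF biadditive_w[of i2 i1, simplified]]
  biadditive_simps[OF biadditive_w[of i2 i2, simplified]]

lemma biadditive_P: "biadditive P"
  by (simp add: biadditive_def P_def AA_add \<beta>_add_left \<beta>_add_right basis_L)

lemmas P_simps = biadditive_simps[OF biadditive_P]

lemma biadditive_lam: "biadditive lam"
  by (simp add: biadditive_def lam_def P_simps algebra_simps)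

lemmas lam_simps = biadditive_simps[OF biadditive_lam]

text \<open>Moving \<open>AA i1 i2 c\<close> from the first argument to the second turns a pair with
  index \<open>i2\<close> into a pair with index \<open>i1\<close>. The cost is a value on two
  elements of weight 0, which is \<open>P\<close>.\<close>

lemma w22_w11_P:
  assumes a: "a \<in> V p" and b: "b \<in> V q" and c: "c \<in> V r"
  shows "w i2 i2 (a * c) b - w i1 i1 a (c * b) = signed (r * q + p * q + p + q + r) (P (b * a) c)"
proof -
  have "\<beta> (br (xx i1 a) (AA i1 i2 c)) (yy i2 b) - \<beta> (xx i1 a) (br (AA i1 i2 c) (yy i2 b))
      = signed (r * (q + 1)) (\<beta> (br (xx i1 a) (yy i2 b)) (AA i1 i2 c))"
    by (rule \<beta>_derivation[OF basis_L(1) basis_MG(1)[OF a] basis_L(5) basis_MG(5)[OF c] basis_L(4) basis_MG(4)[OF b]])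
  then show ?thesis
    by (simp add: br_xA[OF a c] br_Ay[OF b c] br_xy[OF a b] w_def P_def \<beta>_signed_left basis_L
        signed_signed algebra_simps)
qed

lemma w22_w11:
  assumes a: "a \<in> V p" and b: "b \<in> V q"
  shows "w i2 i2 a b = w i1 i1 a b + signed (p * q + p + q) (P (b * a) 1)"
  using w22_w11_P[OF a b V_one] by (simp add: algebra_simps)

lemma w11_lam:
  assumes a: "a \<in> V p" and b: "b \<in> V q" and c: "c \<in> V r"
  shows "w i1 i1 (a * c) b - w i1 i1 a (c * b) = signed (r * q + p * q + p + q + r) (lam (b * a) c)"
proof -
  have "w i2 i2 (a * c) b = w i1 i1 (a * c) b + signed (r * q + p * q + p + q + r) (P (b * a * c) 1)"
    using w22_w11[OF V_mult[OF a c] b] by (simp add: algebra_simps)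
  then show ?thesis
    using w22_w11_P[OF a b c] by (simp add: lam_def signed_diff algebra_simps)
qed

lemma P_bar:
  assumes b: "b \<in> V q" and c: "c \<in> V r"
  shows "P b c = - signed (q * r) (P (bar c) (bar b))"
proof -
  have "AA i2 i1 b = - AA i1 i2 (bar b)" "AA i1 i2 c = - AA i2 i1 (bar c)"
    using AA_swap[of i1 i2 b] AA_swap[of i2 i1 c] by simp_all
  then have "P b c = \<beta> (AA i1 i2 (bar b)) (AA i2 i1 (bar c))"
    by (simp add: P_def \<beta>_minus_left \<beta>_minus_right basis_L L_minus)
  then show ?thesis
    using \<beta>_swap[OF basis_L(6) basis_MG(6)[OF bar_V[OF c]] basis_L(5) basis_MG(5)[OF bar_V[OF b]]]
    by (simp add: P_def mult.commute)
qed

text \<open>\<open>WW (1 + 1)\<close> is the bracket of \<open>yy k 1\<close> with itself for both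
  \<open>k\<close>. The value on \<open>ZZ s\<close> and this element is twice
  \<open>w k k s 1\<close> for either index, and \<open>s = hf r\<close> absorbs the factor
  2.\<close>

lemma w_symmetric:
  assumes r: "r \<in> V p" "bar r = r"
  shows "w i1 i1 r 1 = w i2 i2 r 1"
proof -
  have double: "\<beta> (ZZ s) (WW (1 + 1)) = w k k s 1 + w k k s 1" if s: "s \<in> V p" "bar s = s" and k: "k \<in> {i1, i2}" for s k
  proof -
    note y = yy_L[OF k, of 1] yy_MG[OF k k V_one, simplified]
    have "\<beta> (yy k 1) (xx k s) = signed p (w k k s 1)"
      using \<beta>_swap[OF xx_L[OF k] xx_MG[OF k k s(1)] y] by (cases p) (simp_all add: w_def)
    then show ?thesis
      using \<beta>_leibniz[OF ZZ_L[OF s(2)] ZZ_MG[OF s(1)] y y]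
      by (simp add: br_yy[OF V_one V_one k k] br_Zy[OF V_one s(1) k s(2)] w_def signed_signed)
  qed
  have "w i1 i1 (hf r) 1 + w i1 i1 (hf r) 1 = w i2 i2 (hf r) 1 + w i2 i2 (hf r) 1"
    using double[of "hf r" i1] double[of "hf r" i2] r scale_V[OF r(1)] by (simp add: hf_simps)
  then show ?thesis
    by (simp flip: w_simps)
qed

text \<open>For symmetric \<open>r\<close>, \<open>w_symmetric\<close> and \<open>w22_w11\<close>
  give \<open>P r 1 = 0\<close>; this is applied to \<open>r = c + bar c\<close>.\<close>

lemma P_bar_one: "P (bar c) 1 = - P c 1"
proof (induction c rule: homogeneous_induct)
  case (homogeneous p c)
  have r: "c + bar c \<in> V p" "bar (c + bar c) = c + bar c"
    using homogeneous bar_V by (auto intro!: add_V simp: bar.add bar_bar add.commute)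
  have "P (c + bar c) 1 = 0"
    using w22_w11[OF r(1) V_one] w_symmetric[OF r] by (cases p) simp_all
  then show ?case
    by (simp add: P_simps eq_neg_iff_add_eq_0 add.commute)
qed (simp add: P_simps bar.add)

lemma lam_one: "lam 1 c = 0"
proof (induction c rule: homogeneous_induct)
  case (homogeneous p c)
  then show ?case
    using P_bar[OF V_one homogeneous] P_bar_one[of c] by (simp add: lam_def)
qed (simp add: lam_simps)

text \<open>The left side of \<open>w11_lam\<close> is a difference of two expressions of the same
  kind, in which all factors are moved to the second argument and 1 is left in the first.\<close>

lemma lam_mult:
  assumes a: "a \<in> V p" and b: "b \<in> V q" and c: "c \<in> V r"
  shows "lam b (a * c) = signed (r * q + r * p) (lam (c * b) a) + lam (b * a) c"
proof -
  have "w i1 i1 (a * c) b - w i1 i1 a (c * b) =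
      (w i1 i1 (1 * (a * c)) b - w i1 i1 1 ((a * c) * b)) - (w i1 i1 (1 * a) (c * b) - w i1 i1 1 (a * (c * b)))"
    by (simp add: mult.assoc)
  then show ?thesis
    unfolding w11_lam[OF a b c] w11_lam[OF V_one b V_mult[OF a c]] w11_lam[OF V_one V_mult[OF c b] a]
    by (cases p; cases q; cases r; simp add: algebra_simps)
qed

lemma lam_swap:
  assumes a: "a \<in> V p" and c: "c \<in> V r"
  shows "lam c a = - signed (p * r) (lam a c)"
  using lam_mult[OF a V_one c] lam_one[of "a * c"]
  by (cases p; cases r; simp add: algebra_simps eq_neg_iff_add_eq_0 neg_eq_iff_add_eq_0)

text \<open>Expanding one term by \<open>lam_mult\<close> suffices. With \<open>lam_swap\<close> and
  \<open>lam_bar\<close>, the three families of relations that define <R,R> as a quotient of the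
  tensor square now hold for \<open>lam\<close>.\<close>

lemma lam_cyclic:
  assumes a: "a \<in> V p" and b: "b \<in> V q" and c: "c \<in> V r"
  shows "signed (p * r) (lam (a * b) c) + signed (p * q) (lam (b * c) a) + signed (q * r) (lam (c * a) b) = 0"
  unfolding lam_swap[OF a V_mult[OF b c]] lam_mult[OF b a c]
  by (cases p; cases q; cases r; simp)

lemma lam_bar: "lam (bar a) (bar b) = lam a b"
proof (induction a rule: homogeneous_induct)
  case a: (homogeneous p a)
  show ?case
  proof (induction b rule: homogeneous_induct)
    case b: (homogeneous q b)
    have "P (bar b * bar a) 1 = - signed (p * q) (P (a * b) 1)"
      using P_bar_one[of "a * b"] unfolding bar_mult[OF a b] P_simps
      by (cases p; cases q; simp add: neg_eq_iff_add_eq_0 eq_neg_iff_add_eq_0)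
    then have "lam a b = - signed (p * q) (lam (bar b) (bar a))"
      using P_bar[OF a b] by (cases p; cases q; simp add: lam_def)
    then show ?case
      using lam_swap[OF bar_V[OF a] bar_V[OF b]] by (cases p; cases q; simp)
  qed (simp add: lam_simps bar.add)
qed (simp add: lam_simps bar.add)

lemma w11_normal:
  assumes a: "a \<in> V p" and b: "b \<in> V q"
  shows "w i1 i1 a b = w i1 i1 1 (a * b) - signed (p + q) (lam a b)"
  using w11_lam[OF V_one b a] lam_swap[OF a b]
  by (cases p; cases q; simp add: algebra_simps)

section \<open>Values on root vectors with different indices: the map \<open>m12\<close>\<close>

definition G :: "'r \<Rightarrow> 'g" where
  "G c = \<beta> TT (AA i1 i2 (ei * c))"

text \<open>For homogeneous \<open>a\<close>, \<open>b\<close>, the two pairs of root vectors have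
  the same bracket. The sum of their values is expressed by \<open>G\<close> in lemma
  \<open>w12_G\<close> and can be removed by a coboundary; the difference \<open>m12\<close> is not
  changed by any coboundary.\<close>

definition m12 :: "'r \<Rightarrow> 'r \<Rightarrow> 'g" where
  "m12 a b = w i1 i2 a b - w i1 i2 (a * ei) (e * b)"

definition m21 :: "'r \<Rightarrow> 'r \<Rightarrow> 'g" where
  "m21 a b = w i2 i1 a b - w i2 i1 (a * ei) (e * b)"

lemma G_add: "G (c + d) = G c + G d"
  by (simp add: G_def distrib_left AA_add \<beta>_add_right TT_L basis_L)

sublocale G: additive G
  by unfold_locales (rule G_add)

lemma G_signed: "G (signed p c) = signed p (G c)"
  by (simp add: signed_def G.minus)

lemma biadditive_m12: "biadditive m12" and biadditive_m21: "biadditive m21"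
  by (simp_all add: biadditive_def m12_def m21_def w_simps algebra_simps)

lemmas m_simps = biadditive_simps[OF biadditive_m12] biadditive_simps[OF biadditive_m21]

lemma w12_TT:
  assumes a: "a \<in> V p" and b: "b \<in> V q"
  shows "w i1 i2 (a * e) b + w i1 i2 a (e * b) = signed (p * q + p + q) (\<beta> TT (AA i1 i2 (bar (b * a))))"
proof -
  have "br (xx i1 a) (yy i2 b) = - signed (p * q + p + q) (AA i1 i2 (bar (b * a)))"
    using AA_swap[of i1 i2 "b * a"] by (simp add: br_xy[OF a b] signed_minus)
  then show ?thesis
    using \<beta>_leibniz[OF TT_L TT_MG basis_L(1) basis_MG(1)[OF a] basis_L(4) basis_MG(4)[OF b]]
    by (simp add: br_Tx[OF a] br_Ty[OF b] \<beta>_minus_left \<beta>_minus_right \<beta>_signed_right L_signed basis_L TT_L w_def)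
      (simp add: algebra_simps)
qed

lemma w21_TT:
  assumes a: "a \<in> V p" and b: "b \<in> V q"
  shows "w i2 i1 (a * e) b + w i2 i1 a (e * b) = signed (p * q + p + q) (\<beta> TT (AA i1 i2 (b * a)))"
  using \<beta>_leibniz[OF TT_L TT_MG basis_L(2) basis_MG(2)[OF a] basis_L(3) basis_MG(3)[OF b]]
  by (simp add: br_Tx[OF a] br_Ty[OF b] br_xy[OF a b] \<beta>_signed_right basis_L TT_L w_def)

lemma w12_G:
  assumes a: "a \<in> V p" and b: "b \<in> V q"
  shows "w i1 i2 a b + w i1 i2 (a * ei) (e * b) = - signed (p * q + p + q) (G (bar (b * a)))"
proof -
  have "bar (b * (a * ei)) = - (ei * bar (b * a))"
    using bar_mult_even(2)[OF ei_even, of "b * a"] by (simp add: bar_ei mult.assoc)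
  then show ?thesis
    using w12_TT[OF ei_V(2)[OF a] b]
    by (simp add: e_cancel G_def AA.minus \<beta>_minus_right TT_L basis_L signed_minus)
qed

lemma w21_G:
  assumes a: "a \<in> V p" and b: "b \<in> V q"
  shows "w i2 i1 a b + w i2 i1 (a * ei) (e * b) = signed (p * q + p + q) (G (b * a))"
proof -
  have "b * (a * ei) = ei * (b * a)"
    by (metis ei_central mult.assoc)
  then show ?thesis
    using w21_TT[OF ei_V(2)[OF a] b] by (simp add: e_cancel G_def)
qed

lemma m12_e:
  assumes a: "a \<in> V p" and b: "b \<in> V q"
  shows "m12 (a * e) b = - m12 a (e * b)"
proof -
  have "(e * b) * (a * ei) = b * a"
    by (metis e_cancel(3) e_central mult.assoc)
  then have "w i1 i2 (a * e) b + w i1 i2 a (e * b) = w i1 i2 a (e * b) + w i1 i2 (a * ei) (e * (e * b))"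
    using w12_TT[OF a b] w12_TT[OF ei_V(2)[OF a] e_V(1)[OF b]] by (simp add: e_cancel)
  then show ?thesis
    by (simp add: m12_def e_cancel)
qed

text \<open>
  The bracket of \<open>xx i1 a\<close> with \<open>yy i2 b\<close> depends on \<open>b * a\<close> only, so an operator that acts on both
  sides annihilates \<open>m12\<close>.
\<close>

lemma w12_act:
  assumes g: "g \<in> L" "g \<in> MG r" and a: "a \<in> V p" and b: "b \<in> V q"
  shows "\<beta> (br g (xx i1 a)) (yy i2 b) + signed (r * (p + 1)) (\<beta> (xx i1 a) (br g (yy i2 b)))
    = \<beta> (br g (xx i1 (a * ei))) (yy i2 (e * b)) + signed (r * (p + 1)) (\<beta> (xx i1 (a * ei)) (br g (yy i2 (e * b))))"
proof -
  have "(e * b) * (a * ei) = b * a"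
    by (metis e_cancel(3) e_central mult.assoc)
  then have "br (xx i1 (a * ei)) (yy i2 (e * b)) = br (xx i1 a) (yy i2 b)"
    by (simp add: br_xy[OF a b] br_xy[OF ei_V(2)[OF a] e_V(1)[OF b]])
  then show ?thesis
    using \<beta>_leibniz[OF g basis_L(1) basis_MG(1)[OF a] basis_L(4) basis_MG(4)[OF b]]
      \<beta>_leibniz[OF g basis_L(1) basis_MG(1)[OF ei_V(2)[OF a]] basis_L(4) basis_MG(4)[OF e_V(1)[OF b]]]
    by simp
qed

lemma br_Dy:
  assumes "b \<in> V q" "d \<in> V r" "k \<in> {i1, i2}"
  shows "br (DD d) (yy k b) = - signed (r * (q + 1)) (yy k (b * d))"
  using br_swap[OF yy_MG[OF assms(3,3,1)] DD_MG[OF assms(2)]] br_yD[OF assms]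
  by (simp add: mult.commute)

text \<open>For symmetric \<open>d\<close> the orthogonal block of the bracket of
  \<open>xx i1 1\<close> and \<open>yy i1 d\<close> vanishes, so \<open>DD d\<close> itself lies in
  \<open>L\<close>. It multiplies \<open>xx\<close> by \<open>d\<close> from the left and
  \<open>yy\<close> from the right, and by \<open>w12_act\<close> the total action on
  \<open>m12\<close> is 0.\<close>

lemma m12_symmetric:
  assumes a: "a \<in> V p" and b: "b \<in> V q" and d: "d \<in> V r" "bar d = d"
  shows "m12 (d * a) b = signed (r * (p + q)) (m12 a (b * d))"
proof -
  have "br (xx i1 1) (yy i1 d) = DD d"
    using d by (simp add: br_xy_one rho_homogeneous AA_def munit_signed bar_signed)
  then have g: "DD d \<in> L" "DD d \<in> MG r"
    using br_LL[OF basis_L(1,3), of 1 d] DD_MG[OF d(1)] by simp_all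
  show ?thesis
    using w12_act[OF g a b]
    by (cases p; cases q; cases r;
        simp add: br_Dx[OF a d(1)] br_Dx[OF ei_V(2)[OF a] d(1)] br_Dy[OF b d(1)] br_Dy[OF e_V(1)[OF b] d(1)]
          \<beta>_minus_right basis_L m12_def w_def[symmetric] mult.assoc algebra_simps)
qed

lemma symmetric_induct [consumes 1, case_names symmetric skew add]:
  assumes "x \<in> V p" and "\<And>d. d \<in> V p \<Longrightarrow> bar d = d \<Longrightarrow> Q d" and "\<And>d. d \<in> V p \<Longrightarrow> bar d = - d \<Longrightarrow> Q d"
    and "\<And>x y. Q x \<Longrightarrow> Q y \<Longrightarrow> Q (x + y)"
  shows "Q x"
proof -
  have "Q (hf (x + bar x))"
    using assms(1) bar_V by (intro assms(2)) (auto simp: hf_simps bar.add bar_bar add.commute intro!: scale_V add_V)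
  moreover have "Q (hf (x - bar x))"
    using assms(1) bar_V by (intro assms(3)) (auto simp: hf_simps bar.diff bar_bar intro!: scale_V diff_V)
  moreover have "hf (x + bar x) + hf (x - bar x) = x"
    by (simp add: hf_simps)
  ultimately show ?thesis
    using assms(4) by metis
qed

lemma skew_symmetric:
  assumes "d \<in> V p" "bar d = - d"
  shows "ei * d \<in> V p" "bar (ei * d) = ei * d"
proof -
  show "ei * d \<in> V p"
    by (rule ei_V(1)[OF assms(1)])
  show "bar (ei * d) = ei * d"
    unfolding bar_mult_even(1)[OF ei_even] by (simp add: assms bar_ei ei_central)
qed

text \<open>A skew \<open>d\<close> is \<open>e\<close> times the symmetric element
  \<open>ei * d\<close>; the latter is moved by \<open>m12_symmetric\<close>, and moving
  \<open>e\<close> by \<open>m12_e\<close> produces the sign of \<open>bar d\<close>.\<close>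

lemma m12_bar:
  assumes a: "a \<in> V p" and b: "b \<in> V q" and d: "d \<in> V r"
  shows "m12 (d * a) b = signed (r * (p + q)) (m12 a (b * bar d))"
  using d
proof (induction rule: symmetric_induct)
  case (symmetric d)
  then show ?case
    by (simp add: m12_symmetric[OF a b])
next
  case (skew d)
  note d' = skew_symmetric[OF skew]
  have "m12 (d * a) b = m12 ((ei * d * a) * e) b"
    by (metis e_cancel(1) e_central mult.assoc)
  also have "\<dots> = - signed (r * (p + q)) (m12 a (e * b * (ei * d)))"
    unfolding m12_e[OF V_mult[OF d'(1) a] b] m12_symmetric[OF a e_V(1)[OF b] d'] ..
  also have "e * b * (ei * d) = b * d"
    by (metis e_cancel(1) e_central mult.assoc)
  finally show ?case
    by (simp add: skew m_simps signed_minus)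
qed (simp add: m_simps bar.add distrib_left distrib_right signed_add)

lemma m12_one:
  assumes "a \<in> V p" "b \<in> V q"
  shows "m12 a b = signed (p * q) (m12 1 (b * bar a))"
  using m12_bar[OF V_one assms(2,1)] by simp

text \<open>For skew \<open>s\<close> the operator \<open>g\<close> acts on \<open>xx i1\<close> by
  \<open>s\<close> from the left and, with a factor 2, from the right. Both \<open>w12_act\<close>
  and \<open>m12_bar\<close> express \<open>m12 a (b * s)\<close>; comparing them leaves twice the
  claim, and \<open>hf a\<close> removes the 2.\<close>

lemma m12_scomm_skew:
  assumes s: "s \<in> V r" "bar s = - s" and a: "a \<in> V p" and b: "b \<in> V q"
  shows "m12 (scomm s a) b = 0"
proof -
  define g where "g = br (xx i1 1) (yy i1 s)"
  have g: "g \<in> L" "g \<in> MG r"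
    using br_LL[OF basis_L(1,3)] br_MG[OF basis_MG(1)[OF V_one] basis_MG(3)[OF s(1)]]
    unfolding g_def by (simp_all add: add.commute[of r])
  have g_eq: "g = DD s + signed r (AA i1 i1 s)"
    unfolding g_def br_xy_one[of i1 i1, simplified] by (simp add: rho_homogeneous[OF s(1)] AA_signed)
  have gx: "br g (xx i1 a) = xx i1 (s * a) - signed (r * p) (xx i1 (a * s) + xx i1 (a * s))" if "a \<in> V p" for a p
  proof -
    have "br (AA i1 i1 s) (xx i1 a) = - signed (r * (p + 1)) (xx i1 (a * s) + xx i1 (a * s))"
      using br_swap[OF basis_MG(1)[OF that] AA_MG[of i1 i1, simplified, OF s(1)]]
      by (simp add: br_xA[OF that s(1)] s(2) xx.minus mult.commute)
    then show ?thesis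
      unfolding g_eq br_simps br_Dx[OF that s(1), of i1, simplified]
      by (cases p; cases r; simp)
  qed
  have gy: "br g (yy i2 b) = - signed (r * (q + 1)) (yy i2 (b * s))" if "b \<in> V q" for b
    unfolding g_eq br_simps by (simp add: br_Dy[OF that s(1)] br_Ay[OF that s(1)])
  have "m12 (s * a) b - signed (r * p) (m12 (a * s) b + m12 (a * s) b) - signed (r * (p + q)) (m12 a (b * s)) = 0" if a: "a \<in> V p" for a
  proof -
    have "a * ei * s = a * s * ei"
      using ei_central[of s] by (simp add: mult.assoc)
    then show ?thesis
      using w12_act[OF g a b]
      unfolding gx[OF a] gx[OF ei_V(2)[OF a]] gy[OF b] gy[OF e_V(1)[OF b]]
      by (cases p; cases q; cases r;
          simp add: m12_def w_def[symmetric] w_simps \<beta>_minus_right basis_L mult.assoc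
            flip: xx_add xx.diff xx.minus; simp add: w_simps algebra_simps)
  qed
  moreover have "signed (r * (p + q)) (m12 a (b * s)) = - m12 (s * a) b" if a: "a \<in> V p" for a
    using m12_bar[OF a b s(1)] by (simp add: s(2) m_simps signed_minus)
  moreover have "m12 (scomm s a) b = m12 (s * a) b - signed (r * p) (m12 (a * s) b)" if "a \<in> V p" for a
    by (simp add: scomm_homogeneous[OF s(1) that] m_simps)
  ultimately have "m12 (scomm s a) b + m12 (scomm s a) b = 0" if "a \<in> V p" for a
    using that by (simp add: signed_add algebra_simps)
  moreover have "m12 (scomm s (hf a + hf a)) b = m12 (scomm s (hf a)) b + m12 (scomm s (hf a)) b"
    by (simp only: scomm_simps m_simps)
  ultimately show ?thesis
    using scale_V[OF a, of half] by simp
qed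

text \<open>If \<open>d\<close> is symmetric, \<open>e * d\<close> is skew. As \<open>e\<close> is
  central, it can be taken out of the supercommutator and moved to the second argument, where
  \<open>ei\<close> cancels it.\<close>

lemma m12_scomm: "m12 (scomm c a) b = 0"
proof (induction c rule: homogeneous_induct)
  case c: (homogeneous r c)
  show ?case
  proof (induction a rule: homogeneous_induct)
    case a: (homogeneous p a)
    show ?case
    proof (induction b rule: homogeneous_induct)
      case b: (homogeneous q b)
      show ?case
        using c
      proof (induction rule: symmetric_induct)
        case (symmetric d)
        have ed: "e * d \<in> V r" "bar (e * d) = - (e * d)"
          using e_V(1)[OF symmetric(1)] unfolding bar_mult_even(1)[OF e_even]
          by (simp_all add: symmetric bar_e) (simp add: e_central)
        have "e * d * a = d * a * e" "a * (e * d) = a * d * e"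
          by (metis e_central mult.assoc)+
        then have "scomm (e * d) a = scomm d a * e"
          unfolding scomm_homogeneous[OF ed(1) a] scomm_homogeneous[OF symmetric(1) a]
          by (simp add: left_diff_distrib signed_mult_left)
        then have "m12 (scomm d a) (e * (ei * b)) = 0"
          using m12_scomm_skew[OF ed a ei_V(1)[OF b]] m12_e[OF scomm_V[OF symmetric(1) a] ei_V(1)[OF b]]
          by simp
        then show ?case
          by (simp add: e_cancel)
      next
        case (skew d)
        then show ?case
          by (intro m12_scomm_skew[OF _ _ a b])
      qed (simp add: scomm_simps m_simps)
    qed (simp add: m_simps)
  qed (simp add: scomm_simps m_simps)
qed (simp add: scomm_simps m_simps)

lemma m12_one_mult_scomm: "m12 1 (c * scomm a b) = 0"
proof -
  have "m12 1 (c * bar (scomm a b)) = 0" for a b c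
  proof (induction c rule: homogeneous_induct)
    case c: (homogeneous r c)
    show ?case
    proof (induction a rule: homogeneous_induct)
      case a: (homogeneous p a)
      show ?case
      proof (induction b rule: homogeneous_induct)
        case b: (homogeneous q b)
        show ?case
          using m12_one[OF scomm_V[OF a b] c] m12_scomm[of a b c] signed_eq_iff[of _ _ 0] by (metis signed_zero)
      qed (simp add: scomm_simps m_simps bar.add distrib_left)
    qed (simp add: scomm_simps m_simps bar.add distrib_left)
  qed (simp add: m_simps distrib_right)
  from this[of c "bar a" "bar b"] show ?thesis
    by (simp add: bar_scomm bar_bar m_simps)
qed

text \<open>\<open>scomm u v * c\<close> differs from a signed \<open>c * scomm u v\<close> by the
  supercommutator of \<open>scomm u v\<close> and \<open>c\<close>, and
  \<open>m12_one_mult_scomm\<close> kills both.\<close>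

lemma m12_I: "x \<in> I \<Longrightarrow> m12 1 x = 0"
  unfolding commutator_ideal_def
proof (induction rule: span_induct_alt)
  case base
  show ?case
    by (simp add: m_simps)
next
  case (step k s y)
  then obtain a b c where s: "s = scomm a b * c"
    by blast
  have "m12 1 (scomm u v * c) = 0" for u v
  proof (induction u rule: homogeneous_induct)
    case u: (homogeneous p u)
    show ?case
    proof (induction v rule: homogeneous_induct)
      case v: (homogeneous q v)
      show ?case
      proof (induction c rule: homogeneous_induct)
        case c: (homogeneous r c)
        have "scomm u v * c = 1 * scomm (scomm u v) c + signed ((p + q) * r) (c * scomm u v)"
          by (simp add: scomm_homogeneous[OF scomm_V[OF u v] c])
        then show ?case
          by (simp only: m_simps m12_one_mult_scomm signed_zero add_0)
      qed (simp add: m_simps distrib_left)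
    qed (simp add: scomm_simps m_simps distrib_right)
  qed (simp add: scomm_simps m_simps distrib_right)
  from this[of "sc k a" b] show ?case
    using step by (simp add: s m_simps scomm_scale_left scale_mult_left)
qed

text \<open>\<open>m12_one\<close> yields the product \<open>b * bar a\<close>; modulo
  supercommutators its factors may be exchanged, which gives the product that occurs in
  \<open>det_form_xy\<close>.\<close>

lemma m12_normal:
  assumes a: "a \<in> V p" and b: "b \<in> V q"
  shows "m12 a b = m12 1 (bar a * b)"
proof -
  have "b * bar a = signed (p * q) (bar a * b) + scomm b (bar a)"
    by (simp add: scomm_homogeneous[OF b bar_V[OF a]] mult.commute)
  then show ?thesis
    unfolding m12_one[OF a b] using m12_I[OF scomm_I[of b "bar a"]] by (simp add: m_simps signed_signed)
qed

text \<open>Moving \<open>AA i1 i2 c\<close> across \<open>xx i1 a\<close> and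
  \<open>yy i1 b\<close> relates \<open>w i2 i1\<close> to \<open>w i1 i2\<close>. The error term
  depends on the bracket only, so it is the same for 1, \<open>b\<close> and for \<open>ei\<close>,
  \<open>e * b\<close>, and cancels in the difference.\<close>

lemma m21_normal:
  assumes c: "c \<in> V r" and b: "b \<in> V q"
  shows "m21 c b = - m12 1 (bar c * b)"
proof -
  have R: "w i2 i1 (a * c) b + w i1 i2 a (bar c * b) = signed (r * (q + 1)) (\<beta> (br (xx i1 a) (yy i1 b)) (AA i1 i2 c))"
    if a: "a \<in> V 0" and b: "b \<in> V q" for a b
    using \<beta>_derivation[OF basis_L(1) basis_MG(1)[OF a] basis_L(5) basis_MG(5)[OF c] basis_L(3) basis_MG(3)[OF b]]
    by (simp add: br_xA[OF a c] br_Ay[OF b c] w_def \<beta>_minus_right basis_L)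
  have "e * b * ei = b"
    by (metis e_cancel(3) e_central)
  then have "br (xx i1 ei) (yy i1 (e * b)) = br (xx i1 1) (yy i1 b)"
    by (simp add: br_xy[OF ei_even e_V(1)[OF b]] br_xy[OF V_one b] e_cancel)
  then have "w i2 i1 (1 * c) b + w i1 i2 1 (bar c * b) = w i2 i1 (ei * c) (e * b) + w i1 i2 ei (bar c * (e * b))"
    using R[OF V_one b] R[OF ei_even e_V(1)[OF b]] by simp
  moreover have "bar c * (e * b) = e * (bar c * b)"
    by (metis e_central mult.assoc)
  ultimately have "w i2 i1 c b + w i1 i2 1 (bar c * b) = w i2 i1 (c * ei) (e * b) + w i1 i2 ei (e * (bar c * b))"
    by (simp add: ei_central)
  then show ?thesis
    by (simp add: m12_def m21_def algebra_simps)
qed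

text \<open>
  On the part of weight $n \<noteq> 0$ a cocycle is the coboundary of $\frac{1}{n} \beta(h, \cdot)$. The last
  three summands of \<open>zeta\<close> are the choices on weight $0$ that make \<open>defect\<close> below vanish.
\<close>

definition zeta :: "'r mat22 \<Rightarrow> 'g" where
  "zeta X = \<beta> hh (xx i1 (X $ i3 $ i1)) + \<beta> hh (xx i2 (X $ i3 $ i2))
     - \<beta> hh (yy i1 (X $ i1 $ i3)) - \<beta> hh (yy i2 (X $ i2 $ i3))
     + \<beta> hh (ZZ (hf (X $ i3 $ i4))) - \<beta> hh (WW (hf (X $ i4 $ i3)))
     + w i1 i1 1 (X $ i3 $ i3) + P (hf (X $ i2 $ i2)) 1 + G (hf (X $ i1 $ i2))"

lemma L_symmetric: "X \<in> L \<Longrightarrow> bar (X $ i3 $ i4) = X $ i3 $ i4" "X \<in> L \<Longrightarrow> bar (X $ i4 $ i3) = X $ i4 $ i3"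
  using L_OT by (auto simp: osp_tilde_iff_entry all_idx osp_entry_idx dest!: subsetD)

lemma zeta_add: "X \<in> L \<Longrightarrow> Y \<in> L \<Longrightarrow> zeta (X + Y) = zeta X + zeta Y"
  using L_symmetric[of X] L_symmetric[of Y]
  by (simp add: zeta_def xx_add yy_add munit_add hf_simps \<beta>_add_right hh_L basis_L ZZ_L WW_L w_simps P_simps G_add)

lemma zeta_zero: "zeta 0 = 0"
  using zeta_add[of 0 0] by simp

lemma zeta_minus: "X \<in> L \<Longrightarrow> zeta (- X) = - zeta X"
  using zeta_add[of X "- X"] by (simp add: L_minus zeta_zero eq_neg_iff_add_eq_0 add.commute)

lemma zeta_signed: "X \<in> L \<Longrightarrow> zeta (signed p X) = signed p (zeta X)"
  by (simp add: signed_def zeta_minus)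

text \<open>On \<open>xx k a\<close> and \<open>yy k b\<close> the supertrace form has two summands,
  which agree by \<open>lam_half_bar\<close>; their sum restores \<open>lam\<close>.\<close>

definition lam_half :: "'r \<Rightarrow> 'r \<Rightarrow> 'g" where
  "lam_half a b = lam (hf a) b"

text \<open>The minus sign matches that of \<open>det_form (xx i1 a) (yy i2 b)\<close>, and the half
  comes from splitting \<open>w i1 i2\<close> into half a sum and half the difference
  \<open>m12\<close>.\<close>

definition M :: "'r \<Rightarrow> 'g" where
  "M c = - m12 1 (hf c)"

lemma biadditive_lam_half: "biadditive lam_half"
  by (simp add: biadditive_def lam_half_def lam_simps hf_simps)

lemma M_add: "M (x + y) = M x + M y"
  by (simp add: M_def m_simps hf_simps)

lemma M_I: "x \<in> I \<Longrightarrow> M x = 0"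
  using subspace_scale[OF subspace_I, of x half] by (simp add: M_def m12_I)

lemma lam_half_swap: "a \<in> V p \<Longrightarrow> b \<in> V q \<Longrightarrow> lam_half b a = - signed (p * q) (lam_half a b)"
  and lam_half_cyclic: "a \<in> V p \<Longrightarrow> b \<in> V q \<Longrightarrow> c \<in> V r \<Longrightarrow>
    signed (p * r) (lam_half (a * b) c) + signed (p * q) (lam_half (b * c) a) + signed (q * r) (lam_half (c * a) b) = 0"
proof -
  \<comment> \<open>The values of \<open>lam\<close> cannot be halved, but additivity moves
    \<open>hf\<close> from one argument to the other.\<close>
  have hf_right: "lam_half a b = lam a (hf b)" for a b
  proof -
    have "lam (hf a) (hf b + hf b) = lam (hf a + hf a) (hf b)"
      by (simp only: lam_simps)
    then show ?thesis
      by (simp add: lam_half_def)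
  qed
  show "lam_half b a = - signed (p * q) (lam_half a b)" if "a \<in> V p" "b \<in> V q"
    using lam_swap[OF scale_V[OF that(1)] that(2)] unfolding hf_right[of b a] by (simp add: lam_half_def)
  show "signed (p * r) (lam_half (a * b) c) + signed (p * q) (lam_half (b * c) a) + signed (q * r) (lam_half (c * a) b) = 0"
    if "a \<in> V p" "b \<in> V q" "c \<in> V r"
    using lam_cyclic[OF scale_V[OF that(1), of half] that(2,3)] unfolding hf_right[of "b * c" a]
    by (simp add: lam_half_def hf_simps)
qed

lemma lam_half_bar: "lam_half (bar a) (bar b) = lam_half a b"
  using lam_bar[of "hf a" b] by (simp add: lam_half_def hf_simps)

lemma lam_half_double: "lam_half a b + lam_half a b = lam a b"
  by (simp add: lam_half_def flip: lam_simps)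

section \<open>The difference between a cocycle and its normal form\<close>

definition defect :: "'r mat22 \<Rightarrow> 'r mat22 \<Rightarrow> 'g" where
  "defect X Y = \<beta> X Y - zeta (br X Y) - strace_form lam_half X Y - M (det_form X Y)"

sublocale M: additive M
  by unfold_locales (rule M_add)

lemma cocycle_defect: "osp22_cocycle sc V bar half e ei defect"
proof
  note sf_simps = biadditive_simps[OF biadditive_strace_form[OF biadditive_lam_half]]
    and df_simps = biadditive_simps[OF biadditive_det_form]
  show "defect (X + X') Y = defect X Y + defect X' Y" if "X \<in> L" "X' \<in> L" "Y \<in> L" for X X' Y
    using that by (simp add: defect_def \<beta>_add_left br_simps zeta_add br_LL sf_simps df_simps M_add)
  show "defect X (Y + Y') = defect X Y + defect X Y'" if "X \<in> L" "Y \<in> L" "Y' \<in> L" for X Y Y'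
    using that by (simp add: defect_def \<beta>_add_right br_simps zeta_add br_LL sf_simps df_simps M_add)
  show "defect X Y + signed (p * q) (defect Y X) = 0"
    if X: "X \<in> L" "X \<in> MG p" and Y: "Y \<in> L" "Y \<in> MG q" for X Y p q
  proof -
    have "zeta (br Y X) = - signed (p * q) (zeta (br X Y))"
      using br_LL[OF X(1) Y(1)] by (simp add: br_swap[OF X(2) Y(2)] zeta_minus zeta_signed L_signed)
    moreover have "strace_form lam_half Y X = - signed (p * q) (strace_form lam_half X Y)"
      by (rule strace_form_swap[OF biadditive_lam_half _ X(2) Y(2)]) (rule lam_half_swap)
    moreover have "M (det_form Y X) = - signed (p * q) (M (det_form X Y))"
      by (rule det_form_swap[where \<kappa> = M, OF M_add M_I X(2) Y(2)])
    ultimately show ?thesis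
      unfolding defect_def \<beta>_swap[OF X Y] by (cases p; cases q; simp)
  qed
  show "signed (p * r) (defect (br X Y) Z) + signed (q * p) (defect (br Y Z) X) + signed (r * q) (defect (br Z X) Y) = 0"
    if X: "X \<in> L" "X \<in> MG p" and Y: "Y \<in> L" "Y \<in> MG q" and Z: "Z \<in> L" "Z \<in> MG r" for X Y Z p q r
  proof -
    have L: "br (br X Y) Z \<in> L" "br (br Y Z) X \<in> L" "br (br Z X) Y \<in> L"
      using X(1) Y(1) Z(1) br_LL by simp_all
    have "zeta (signed (p * r) (br (br X Y) Z) + signed (q * p) (br (br Y Z) X) + signed (r * q) (br (br Z X) Y)) = 0"
      by (simp add: br_cyclic[OF X(2) Y(2) Z(2)] zeta_zero)
    then have "signed (p * r) (zeta (br (br X Y) Z)) + signed (q * p) (zeta (br (br Y Z) X))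
        + signed (r * q) (zeta (br (br Z X) Y)) = 0"
      using L by (simp add: zeta_add zeta_signed L_signed L_add)
    moreover have "(a1 - b1 - c1 - d1) + (a2 - b2 - c2 - d2) + (a3 - b3 - c3 - d3) = 0"
      if "a1 + a2 + a3 = 0" "b1 + b2 + b3 = 0" "c1 + c2 + c3 = 0" "d1 + d2 + d3 = 0"
      for a1 a2 a3 b1 b2 b3 c1 c2 c3 d1 d2 d3 :: 'g
    proof -
      have "(a1 - b1 - c1 - d1) + (a2 - b2 - c2 - d2) + (a3 - b3 - c3 - d3)
          = (a1 + a2 + a3) - (b1 + b2 + b3) - (c1 + c2 + c3) - (d1 + d2 + d3)"
        by (simp add: algebra_simps)
      then show ?thesis
        by (simp only: that diff_0_right)
    qed
    moreover have "signed (p * r) (strace_form lam_half (br X Y) Z) + signed (q * p) (strace_form lam_half (br Y Z) X)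
        + signed (r * q) (strace_form lam_half (br Z X) Y) = 0"
      by (rule strace_form_cyclic[OF biadditive_lam_half _ X(2) Y(2) Z(2)]) (rule lam_half_cyclic)
    moreover have "signed (p * r) (M (det_form (br X Y) Z)) + signed (q * p) (M (det_form (br Y Z) X))
        + signed (r * q) (M (det_form (br Z X) Y)) = 0"
      by (rule det_form_cyclic[where \<kappa> = M, OF M_add M_I X Y Z])
    ultimately show ?thesis
      unfolding defect_def signed_diff using \<beta>_cyclic[OF X Y Z] by blast
  qed
qed

lemma zero_simps: "lam_half 0 a = 0" "lam_half a 0 = 0" "M 0 = 0" "G 0 = 0" "\<beta> hh 0 = 0"
  by (simp_all add: biadditive_simps[OF biadditive_lam_half] M.zero G.zero \<beta>_zero_right hh_L)

lemmas entry_simps = basis_nth munit_nth signed_nth bar.zero rho.zero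

lemma strace_form_xy:
  assumes a: "a \<in> V p" and b: "b \<in> V q" and k: "k \<in> {i1, i2}" and l: "l \<in> {i1, i2}"
  shows "strace_form lam_half (xx k a) (yy l b) = (if k = l then - signed (p + q) (lam a b) else 0)"
proof -
  have "lam_half (rho V (bar a)) (rho V (bar b)) = signed (p + q) (lam_half a b)"
    "lam_half (rho V a) (rho V b) = signed (p + q) (lam_half a b)"
    unfolding rho_homogeneous[OF a] rho_homogeneous[OF b] rho_bar[OF a] rho_bar[OF b]
    by (simp_all add: biadditive_simps[OF biadditive_lam_half] lam_half_bar signed_signed add.commute)
  then show ?thesis
    using k l lam_half_double[of a b]
    by (cases p; cases q; elim insertE emptyE;
        simp add: strace_form_def sum_idx entry_simps zero_simps biadditive_simps[OF biadditive_lam_half];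
        simp add: algebra_simps)
qed

lemma zeta_D: "zeta (DD d) = w i1 i1 1 d"
  and zeta_A22: "zeta (AA i2 i2 c) = P c 1"
  and zeta_A11: "zeta (AA i1 i1 c) = 0"
  and zeta_A12: "zeta (AA i1 i2 c) = G (hf c)"
  and zeta_A21: "zeta (AA i2 i1 c) = - G (hf (bar c))"
proof -
  show "zeta (AA i2 i2 c) = P c 1"
  proof -
    have "P (hf c - hf (bar c)) 1 = P (hf c + hf c) 1"
      using P_bar_one[of "hf c"] by (simp only: P_simps hf_simps) simp
    then show ?thesis
      by (simp add: zeta_def entry_simps zero_simps xx.zero yy.zero w_simps P_simps hf_simps)
  qed
qed (simp_all add: zeta_def entry_simps zero_simps xx.zero yy.zero w_simps P_simps hf_simps G.minus)

lemma defect_xy_homogeneous: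
  assumes a: "a \<in> V p" and b: "b \<in> V q" and k: "k \<in> {i1, i2}" and l: "l \<in> {i1, i2}"
  shows "defect (xx k a) (yy l b) = 0"
proof -
  \<comment> \<open>The value is half the sum plus half the difference. As values cannot be halved,
    \<open>hf a\<close> is inserted and the result is doubled.\<close>
  have half_w: "w i1 i2 a b = G (- signed (p * q + p + q) (hf (bar (b * a)))) + M (- (bar a * b))"
  proof -
    have "w i1 i2 (hf a) b + w i1 i2 (hf a) b = (w i1 i2 (hf a) b + w i1 i2 (hf a * ei) (e * b)) + m12 (hf a) b"
      by (simp add: m12_def)
    also have "\<dots> = G (- signed (p * q + p + q) (hf (bar (b * a)))) + m12 (hf a) b"
      unfolding w12_G[OF scale_V[OF a] b] by (simp add: G.minus G_signed hf_simps)
    also have "m12 (hf a) b = M (- (bar a * b))"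
      unfolding m12_normal[OF scale_V[OF a] b] by (simp add: M_def m_simps hf_simps)
    finally show ?thesis
      by (simp flip: w_simps)
  qed
  have half_w': "w i2 i1 a b = G (signed (p * q + p + q) (hf (b * a))) + M (bar a * b)"
  proof -
    have "w i2 i1 (hf a) b + w i2 i1 (hf a) b = (w i2 i1 (hf a) b + w i2 i1 (hf a * ei) (e * b)) + m21 (hf a) b"
      by (simp add: m21_def)
    also have "\<dots> = G (signed (p * q + p + q) (hf (b * a))) + m21 (hf a) b"
      unfolding w21_G[OF scale_V[OF a] b] by (simp add: G_signed hf_simps)
    also have "m21 (hf a) b = M (bar a * b)"
      unfolding m21_normal[OF scale_V[OF a] b] by (simp add: M_def hf_simps)
    finally show ?thesis
      by (simp flip: w_simps)
  qed
  \<comment> \<open>The two summands need not lie in \<open>L\<close>, so \<open>zeta_add\<close>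
    does not apply. The claim is read off from the definition of \<open>zeta\<close>, where only
    entries of weight 0 contribute.\<close>
  have DA: "zeta (DD (a * b) + signed s (AA k k c)) = zeta (DD (a * b)) + signed s (zeta (AA k k c))"
    if "k \<in> {i1, i2}" for k s c
    unfolding zeta_def
    using that by (elim insertE emptyE; cases s; simp add: entry_simps zero_simps xx.zero yy.zero w_simps P_simps hf_simps G.minus)
  have A: "zeta (signed s (AA i2 i1 c)) = signed s (zeta (AA i2 i1 c))" "zeta (signed s (AA i1 i2 c)) = signed s (zeta (AA i1 i2 c))" for s c
    by (simp_all add: zeta_signed basis_L)
  consider "k = i1" "l = i1" | "k = i2" "l = i2" | "k = i1" "l = i2" | "k = i2" "l = i1"
    using k l by blast
  then show ?thesis
  proof cases
    case 1
    show ?thesis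
      unfolding defect_def strace_form_xy[OF a b k l] br_xy[OF a b k l]
      unfolding 1
      using w11_normal[OF a b]
      by (simp add: det_form_xy zero_simps DA zeta_D zeta_A11 flip: w_def)
  next
    case 2
    show ?thesis
      unfolding defect_def strace_form_xy[OF a b k l] br_xy[OF a b k l]
      unfolding 2
      using w11_normal[OF a b] w22_w11[OF a b]
      by (simp add: det_form_xy zero_simps DA zeta_D zeta_A22 flip: w_def)
  next
    case 3
    show ?thesis
      unfolding defect_def strace_form_xy[OF a b k l] br_xy[OF a b k l]
      unfolding 3
      using half_w
      by (simp add: det_form_xy A zeta_A21 G.minus G_signed signed_minus flip: w_def)
  next
    case 4
    show ?thesis
      unfolding defect_def strace_form_xy[OF a b k l] br_xy[OF a b k l]
      unfolding 4
      using half_w'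
      by (simp add: det_form_xy A zeta_A12 G_signed flip: w_def)
  qed
qed

lemma defect_hh:
  "defect hh (xx i1 a) = 0" "defect hh (xx i2 a) = 0" "defect hh (yy i1 a) = 0" "defect hh (yy i2 a) = 0"
  "bar r = r \<Longrightarrow> defect hh (ZZ r) = 0" "bar r = r \<Longrightarrow> defect hh (WW r) = 0"
proof -
  have "strace_form lam_half hh X = 0 \<and> M (det_form hh X) = 0" if "X \<in> {xx i1 a, xx i2 a, yy i1 a, yy i2 a, ZZ r, WW r}" for X
    using that by (elim insertE emptyE;
        simp add: strace_form_def det_form_def sum_idx entry_simps zero_simps)
  then have form: "strace_form lam_half hh X = 0" "M (det_form hh X) = 0"
    if "X \<in> {xx i1 a, xx i2 a, yy i1 a, yy i2 a, ZZ r, WW r}" for X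
    using that by blast+
  have z: "zeta (xx k a) = \<beta> hh (xx k a)" "zeta (- yy k a) = \<beta> hh (yy k a)" if "k \<in> {i1, i2}" for k
    using that by (elim insertE emptyE;
      simp add: zeta_def entry_simps zero_simps xx.zero yy.zero w_simps P_simps hf_simps xx.minus yy.minus
        \<beta>_minus_right basis_L hh_L)+
  show "defect hh (xx i1 a) = 0" "defect hh (xx i2 a) = 0" "defect hh (yy i1 a) = 0" "defect hh (yy i2 a) = 0"
    unfolding defect_def by (simp_all add: form br_hx br_hy z)
  show "defect hh (ZZ r) = 0" if "bar r = r"
    using that unfolding defect_def br_hZ
    by (simp add: form zeta_def entry_simps zero_simps xx.zero yy.zero w_simps P_simps hf_simps)
  show "defect hh (WW r) = 0" if "bar r = r"
    using that hf_double[of "- r"] unfolding defect_def br_hW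
    by (simp add: form zeta_def entry_simps zero_simps xx.zero yy.zero w_simps P_simps hf_simps
        munit_minus \<beta>_minus_right hh_L WW_L)
qed

theorem cocycle_normal_form:
  assumes "X \<in> L" "Y \<in> L"
  shows "\<beta> X Y = zeta (br X Y) + strace_form lam_half X Y + M (det_form X Y)"
proof -
  interpret defect: osp22_cocycle sc V bar half e ei defect
    by (rule cocycle_defect)
  have xy: "defect (xx k a) (yy l b) = 0" if kl: "k \<in> {i1, i2}" "l \<in> {i1, i2}" for k l a b
  proof (induction a rule: homogeneous_induct)
    case a: (homogeneous p a)
    show ?case
      by (induction b rule: homogeneous_induct)
        (use defect_xy_homogeneous[OF a _ kl] kl in \<open>simp_all only: yy_add defect.\<beta>_add_right xx_L yy_L add_0_left\<close>)
  qed (use kl in \<open>simp only: xx_add defect.\<beta>_add_left xx_L yy_L add_0_left\<close>)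
  have "defect X Y = 0"
    by (rule defect.cocycle_vanishes[OF xy _ _ _ _ assms]) (auto simp: defect_hh)
  then show ?thesis
    by (simp add: defect_def algebra_simps)
qed

end

section \<open>The second homology\<close>

lemma (in module_hom) free_lift: "f (free_lift s1 b z) = free_lift s2 (\<lambda>x y. f (b x y)) z"
  by (simp add: free_lift_def sum scale case_prod_unfold)

lemma (in Modules.module) free_lift_in_subspace:
  assumes "subspace S" and "\<And>x y. (x, y) \<in> Poly_Mapping.keys z \<Longrightarrow> b x y \<in> S"
  shows "free_lift scale b z \<in> S"
  unfolding free_lift_def using assms by (intro subspace_sum) (auto intro: subspace_scale)

lemma (in Modules.module) free_lift_diff_function:
  "free_lift scale (\<lambda>x y. b x y - c x y) z = free_lift scale b z - free_lift scale c z"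
  by (simp add: free_lift_def case_prod_unfold scale_right_diff_distrib sum_subtractf)

lemma free_lift_gen_self: "free_lift free_scale gen z = z"
  unfolding free_lift_def by (rule free_square_expand[symmetric])

lemma subspace_free_square:
  fixes L :: "'a set"
  shows "free.subspace (free_square L :: ('a \<times> 'a \<Rightarrow>\<^sub>0 'k::comm_ring_1) set)"
  unfolding free.subspace_def free_square_def
proof (intro conjI ballI allI; clarsimp)
  fix f g :: "'a \<times> 'a \<Rightarrow>\<^sub>0 'k" and x y
  assume "Poly_Mapping.keys f \<subseteq> L \<times> L" "Poly_Mapping.keys g \<subseteq> L \<times> L" "(x, y) \<in> Poly_Mapping.keys (f + g)"
  then show "x \<in> L \<and> y \<in> L"
    using keys_add[of f g] by blast
next
  fix c :: 'k and f :: "'a \<times> 'a \<Rightarrow>\<^sub>0 'k" and x y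
  assume "Poly_Mapping.keys f \<subseteq> L \<times> L" "(x, y) \<in> Poly_Mapping.keys (free_scale c f)"
  then show "x \<in> L \<and> y \<in> L"
    by (metis in_keys_iff lookup_free_scale mem_Sigma_iff mult_zero_right subsetD)
qed

lemma gen_free_square: "x \<in> L \<Longrightarrow> y \<in> L \<Longrightarrow> gen x y \<in> free_square L"
  by (auto simp: gen_def free_square_def)

text \<open>
  A linear map out of the free module whose target carries no scalar multiplication: it is given by
  its values \<open>g c x y\<close> on the multiples \<open>c\<close> of the generators.
\<close>

definition additive_lift :: "('k \<Rightarrow> 'a \<Rightarrow> 'a \<Rightarrow> 'g) \<Rightarrow> ('a \<times> 'a \<Rightarrow>\<^sub>0 'k::comm_ring_1) \<Rightarrow> 'g::ab_group_add" where
  "additive_lift g f = (\<Sum>(x, y)\<in>Poly_Mapping.keys f. g (Poly_Mapping.lookup f (x, y)) x y)"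

lemma additive_lift_add:
  assumes "\<And>c d x y. g (c + d) x y = g c x y + g d x y"
  shows "additive_lift g (f + f') = additive_lift g f + additive_lift g f'"
proof -
  have zero: "g 0 x y = 0" for x y
    using assms[of 0 0 x y] by simp
  have superset: "additive_lift g f = (\<Sum>(x, y)\<in>K. g (Poly_Mapping.lookup f (x, y)) x y)"
    if "finite K" "Poly_Mapping.keys f \<subseteq> K" for f K
    unfolding additive_lift_def using that
    by (intro sum.mono_neutral_left) (auto simp: in_keys_iff zero)
  let ?K = "Poly_Mapping.keys f \<union> Poly_Mapping.keys f'"
  have "additive_lift g (f + f') = (\<Sum>(x, y)\<in>?K. g (Poly_Mapping.lookup (f + f') (x, y)) x y)"
    by (rule superset) (auto intro!: keys_add)
  also have "\<dots> = additive_lift g f + additive_lift g f'"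
    by (subst (1 2) superset[where K = ?K]) (auto simp: lookup_add assms sum.distrib case_prod_unfold)
  finally show ?thesis .
qed

lemma additive_lift_gen:
  assumes "\<And>c d x y. g (c + d) x y = g c x y + g d x y"
  shows "additive_lift g (free_scale c (gen x y)) = g c x y"
proof -
  have "g 0 x y = 0"
    using assms[of 0 0 x y] by simp
  then show ?thesis
    by (cases "c = 0") (simp_all add: additive_lift_def free_scale_gen)
qed

context osp22
begin

lemma strace_form_hom:
  assumes "additive h"
  shows "h (strace_form f X Y) = strace_form (\<lambda>a b. h (f a b)) X Y"
proof -
  interpret h: additive h by fact
  show ?thesis
    unfolding strace_form_def h.sum by (intro sum.cong refl) (simp add: h.minus)
qed

lemma strace_form_diff:
  "strace_form (\<lambda>a b. f a b - f' a b) X Y = strace_form f X Y - strace_form f' X Y"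
  unfolding strace_form_def sum_subtractf[symmetric] by (intro sum.cong refl) simp

lemma strace_form_in_subgroup:
  assumes "add_subgroup S" "\<And>a b. f a b \<in> S"
  shows "strace_form f X Y \<in> S"
  unfolding strace_form_def sum_idx
  by (intro add_subgroup_add[OF assms(1)]) (simp_all add: assms add_subgroup_minus[OF assms(1)])

lemma strace_form_scale_left:
  "strace_form f (msc c X) Y = strace_form (\<lambda>a b. f (sc c a) b) X Y"
  and strace_form_scale_right:
  "strace_form f X (msc c Y) = strace_form (\<lambda>a b. f a (sc c b)) X Y"
  by (simp_all add: strace_form_def matrix_scale_def rho_scale cong: if_cong)

lemma det_form_scale:
  "det_form (msc c X) Y = sc c (det_form X Y)" "det_form X (msc c Y) = sc c (det_form X Y)"
  by (simp_all add: det_form_def matrix_scale_def rho_scale scale_mult_left scale_mult_right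
      scale_right_distrib scale_right_diff_distrib)

sublocale str: module_hom "msc" sc str
  by unfold_locales (simp_all add: str_add str_scale)

section \<open>The two comparison maps on the homology\<close>

definition dihedral_span :: "('r \<times> 'r \<Rightarrow>\<^sub>0 'k) set" where
  "dihedral_span = free.span (bilinear_relations sc UNIV \<union> skew_dihedral_relations V bar)"

definition homology_span :: "('r mat22 \<times> 'r mat22 \<Rightarrow>\<^sub>0 'k) set" where
  "homology_span = free.span (bilinear_relations msc L \<union> lie_homology_relations MG br L)"

text \<open>The values lie in the free module on pairs from \<open>R\<close> and not in its
  quotient, so that the map is linear for \<open>free_scale\<close>; the relations hold modulo
  \<open>dihedral_span\<close> and are tested with \<open>residue_class\<close>.\<close>

definition trace_map :: "('r mat22 \<times> 'r mat22 \<Rightarrow>\<^sub>0 'k) \<Rightarrow> ('r \<times> 'r \<Rightarrow>\<^sub>0 'k)" where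
  "trace_map = free_lift free_scale (strace_form gen)"

definition det_map :: "('r mat22 \<times> 'r mat22 \<Rightarrow>\<^sub>0 'k) \<Rightarrow> 'r" where
  "det_map = free_lift sc det_form"

sublocale trace_map: module_hom free_scale free_scale trace_map
  unfolding trace_map_def by (rule free.module_hom_free_lift)

sublocale det_map: module_hom free_scale sc det_map
  unfolding det_map_def by (rule module_hom_free_lift)

lemma trace_map_gen: "trace_map (gen X Y) = strace_form gen X Y"
  and det_map_gen: "det_map (gen X Y) = det_form X Y"
  by (simp_all add: trace_map_def det_map_def free.free_lift_gen)

lemma subgroup_dihedral: "add_subgroup dihedral_span"
  and subgroup_homology: "add_subgroup homology_span"
  unfolding dihedral_span_def homology_span_def by (intro free.add_subgroup_subspace free.subspace_span)+

definition pairing :: "'r \<Rightarrow> 'r \<Rightarrow> ('r \<times> 'r \<Rightarrow>\<^sub>0 'k) all_quotients" where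
  "pairing a b = residue_class dihedral_span (gen a b)"

lemma residue_class_signed: "residue_class N (signed p x) = signed p (residue_class N x)"
  by (simp add: signed_def residue_class_minus)

lemma dihedral_span_relation:
  "f \<in> bilinear_relations sc UNIV \<union> skew_dihedral_relations V bar \<Longrightarrow> residue_class dihedral_span f = 0"
  unfolding residue_class_eq_0_iff[OF subgroup_dihedral] unfolding dihedral_span_def by (rule free.span_base)

lemma biadditive_pairing: "biadditive pairing"
proof -
  have "residue_class dihedral_span (gen (x + x') y - gen x y - gen x' y) = 0"
    "residue_class dihedral_span (gen x (y + y') - gen x y - gen x y') = 0" for x x' y y'
    by (intro dihedral_span_relation; unfold bilinear_relations_def; blast)+
  then show ?thesis
    unfolding biadditive_def pairing_def by (simp add: residue_class_diff diff_eq_eq add.commute)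
qed

lemmas pairing_simps = biadditive_simps[OF biadditive_pairing]

lemma pairing_bar: "pairing (bar a) (bar b) = pairing a b"
proof -
  have "residue_class dihedral_span (gen a b - gen (bar a) (bar b)) = 0"
    by (intro dihedral_span_relation) (unfold skew_dihedral_relations_def, blast)
  then show ?thesis
    by (simp add: pairing_def residue_class_diff)
qed

lemma pairing_swap: "a \<in> V p \<Longrightarrow> b \<in> V q \<Longrightarrow> pairing b a = - signed (p * q) (pairing a b)"
proof -
  assume "a \<in> V p" "b \<in> V q"
  then have "residue_class dihedral_span (gen b a + signed (q * p) (gen a b)) = 0"
    by (intro dihedral_span_relation) (unfold skew_dihedral_relations_def, blast)
  then show ?thesis
    by (simp add: pairing_def residue_class_add residue_class_signed eq_neg_iff_add_eq_0 mult.commute)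
qed

lemma pairing_cyclic:
  assumes "a \<in> V p" "b \<in> V q" "c \<in> V r"
  shows "signed (p * r) (pairing (a * b) c) + signed (p * q) (pairing (b * c) a) + signed (q * r) (pairing (c * a) b) = 0"
proof -
  have "residue_class dihedral_span (signed (p * r) (gen (a * b) c) + signed (p * q) (gen (b * c) a)
      + signed (q * r) (gen (c * a) b)) = 0"
    using assms by (intro dihedral_span_relation) (unfold skew_dihedral_relations_def, blast)
  then show ?thesis
    by (simp add: pairing_def residue_class_add residue_class_signed)
qed

text \<open>In the cyclic relation for 1, 1, \<open>c\<close>, two terms are the negative of the
  third by skewness, so \<open>pairing 1 c\<close> remains up to sign.\<close>

lemma pairing_one: "pairing 1 c = 0"
proof (induction c rule: homogeneous_induct)
  case (homogeneous r c)
  show ?case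
    using pairing_cyclic[OF V_one V_one homogeneous] pairing_swap[OF V_one homogeneous] by simp
qed (simp add: pairing_simps)

lemma residue_class_trace_map_gen:
  "residue_class dihedral_span (trace_map (gen X Y)) = strace_form pairing X Y"
  unfolding trace_map_gen pairing_def
  by (rule strace_form_hom) (unfold_locales, rule residue_class_add)

lemma trace_map_signed: "trace_map (signed p z) = signed p (trace_map z)"
  and det_map_signed: "det_map (signed p z) = signed p (det_map z)"
  by (simp_all add: signed_def trace_map.neg det_map.neg)

lemma lie_homology_relations_cases:
  assumes "f \<in> lie_homology_relations MG br L"
  obtains (skew) X Y p q where "X \<in> L" "X \<in> MG p" "Y \<in> L" "Y \<in> MG q" "f = gen X Y + signed (p * q) (gen Y X)"
  | (cyclic) X Y Z p q r where "X \<in> L" "X \<in> MG p" "Y \<in> L" "Y \<in> MG q" "Z \<in> L" "Z \<in> MG r"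
    "f = signed (p * r) (gen (br X Y) Z) + signed (q * p) (gen (br Y Z) X) + signed (r * q) (gen (br Z X) Y)"
  using assms unfolding lie_homology_relations_def by blast

lemma bilinear_relations_cases:
  assumes "f \<in> bilinear_relations s A"
  obtains (left) x x' y where "x \<in> A" "x' \<in> A" "y \<in> A" "f = gen (x + x') y - gen x y - gen x' y"
  | (right) x y y' where "x \<in> A" "y \<in> A" "y' \<in> A" "f = gen x (y + y') - gen x y - gen x y'"
  | (scale_left) c x y where "x \<in> A" "y \<in> A" "f = gen (s c x) y - free_scale c (gen x y)"
  | (scale_right) c x y where "x \<in> A" "y \<in> A" "f = gen x (s c y) - free_scale c (gen x y)"
  using assms unfolding bilinear_relations_def by blast

lemma trace_map_homology:
  assumes "z \<in> homology_span"
  shows "trace_map z \<in> dihedral_span"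
proof -
  note simps = biadditive_simps[OF biadditive_strace_form[OF biadditive_pairing]]
  have linear: "strace_form gen (msc c X) Y - free_scale c (strace_form gen X Y) \<in> dihedral_span"
    "strace_form gen X (msc c Y) - free_scale c (strace_form gen X Y) \<in> dihedral_span" for c X Y
  proof -
    have 1: "free_scale c (strace_form gen X Y) = strace_form (\<lambda>a b. free_scale c (gen a b)) X Y"
      by (rule strace_form_hom) (unfold_locales, rule free.scale_right_distrib)
    have "gen (sc c a) b - free_scale c (gen a b) \<in> bilinear_relations sc UNIV"
      "gen a (sc c b) - free_scale c (gen a b) \<in> bilinear_relations sc UNIV" for a b
      unfolding bilinear_relations_def by blast+
    then have "gen (sc c a) b - free_scale c (gen a b) \<in> dihedral_span"
      "gen a (sc c b) - free_scale c (gen a b) \<in> dihedral_span" for a b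
      unfolding dihedral_span_def by (simp_all add: free.span_base)
    then show "strace_form gen (msc c X) Y - free_scale c (strace_form gen X Y) \<in> dihedral_span"
      "strace_form gen X (msc c Y) - free_scale c (strace_form gen X Y) \<in> dihedral_span"
      unfolding 1 strace_form_scale_left strace_form_scale_right strace_form_diff[symmetric]
      by (simp_all add: strace_form_in_subgroup[OF subgroup_dihedral])
  qed
  have sub: "free.subspace {z. trace_map z \<in> dihedral_span}"
    by (rule trace_map.subspace_linear_preimage) (simp add: dihedral_span_def)
  have "bilinear_relations msc L \<subseteq> {z. trace_map z \<in> dihedral_span}"
  proof (intro subsetI CollectI)
    fix f :: "'r mat22 \<times> 'r mat22 \<Rightarrow>\<^sub>0 'k" assume "f \<in> bilinear_relations msc L"
    then show "trace_map f \<in> dihedral_span"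
    proof (cases rule: bilinear_relations_cases)
      case (left x x' y)
      then show ?thesis
        unfolding residue_class_eq_0_iff[OF subgroup_dihedral, symmetric]
        by (simp add: trace_map.diff residue_class_diff residue_class_trace_map_gen simps)
    next
      case (right x y y')
      then show ?thesis
        unfolding residue_class_eq_0_iff[OF subgroup_dihedral, symmetric]
        by (simp add: trace_map.diff residue_class_diff residue_class_trace_map_gen simps)
    next
      case (scale_left c x y)
      then show ?thesis
        using linear by (simp add: trace_map.diff trace_map.scale trace_map_gen)
    next
      case (scale_right c x y)
      then show ?thesis
        using linear by (simp add: trace_map.diff trace_map.scale trace_map_gen)
    qed
  qed
  moreover have "lie_homology_relations MG br L \<subseteq> {z. trace_map z \<in> dihedral_span}"
  proof (intro subsetI CollectI)
    fix f :: "'r mat22 \<times> 'r mat22 \<Rightarrow>\<^sub>0 'k" assume "f \<in> lie_homology_relations MG br L"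
    then show "trace_map f \<in> dihedral_span"
      unfolding residue_class_eq_0_iff[OF subgroup_dihedral, symmetric]
    proof (cases rule: lie_homology_relations_cases)
      case (skew X Y p q)
      have "strace_form pairing Y X = - signed (p * q) (strace_form pairing X Y)"
        by (rule strace_form_swap[OF biadditive_pairing _ skew(2,4)]) (rule pairing_swap)
      then show "residue_class dihedral_span (trace_map f) = 0"
        unfolding skew(5) trace_map.add trace_map_signed residue_class_add residue_class_signed residue_class_trace_map_gen
        by (cases p; cases q; simp)
    next
      case (cyclic X Y Z p q r)
      show "residue_class dihedral_span (trace_map f) = 0"
        unfolding cyclic(7) trace_map.add trace_map_signed residue_class_add residue_class_signed residue_class_trace_map_gen
        by (rule strace_form_cyclic[OF biadditive_pairing _ cyclic(2,4,6)]) (rule pairing_cyclic)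
    qed
  qed
  ultimately show ?thesis
    using assms free.span_minimal[OF _ sub] unfolding homology_span_def by blast
qed

lemma det_map_homology:
  assumes "z \<in> homology_span"
  shows "det_map z \<in> I"
proof -
  note simps = biadditive_simps[OF biadditive_det_form]
  have sI: "add_subgroup I"
    by (rule add_subgroup_subspace[OF subspace_I])
  have sub: "free.subspace {z. det_map z \<in> I}"
    by (rule det_map.subspace_linear_preimage[OF subspace_I])
  have "bilinear_relations msc L \<subseteq> {z. det_map z \<in> I}"
  proof (intro subsetI CollectI)
    fix f :: "'r mat22 \<times> 'r mat22 \<Rightarrow>\<^sub>0 'k" assume "f \<in> bilinear_relations msc L"
    then have "det_map f = 0"
      by (cases rule: bilinear_relations_cases)
        (simp_all add: det_map.diff det_map.scale det_map_gen simps det_form_scale)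
    then show "det_map f \<in> I"
      by (simp add: subspace_0[OF subspace_I])
  qed
  moreover have "lie_homology_relations MG br L \<subseteq> {z. det_map z \<in> I}"
  proof (intro subsetI CollectI)
    fix f :: "'r mat22 \<times> 'r mat22 \<Rightarrow>\<^sub>0 'k" assume "f \<in> lie_homology_relations MG br L"
    then show "det_map f \<in> I"
      unfolding residue_class_eq_0_iff[OF sI, symmetric]
    proof (cases rule: lie_homology_relations_cases)
      case (skew X Y p q)
      have "residue_class I (det_form Y X) = - signed (p * q) (residue_class I (det_form X Y))"
        by (rule det_form_swap[OF _ _ skew(2,4)]) (simp_all add: residue_class_add residue_class_eq_0_iff[OF sI])
      then show "residue_class I (det_map f) = 0"
        unfolding skew(5) det_map.add det_map_signed residue_class_add residue_class_signed det_map_gen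
        by (cases p; cases q; simp)
    next
      case (cyclic X Y Z p q r)
      show "residue_class I (det_map f) = 0"
        unfolding cyclic(7) det_map.add det_map_signed residue_class_add residue_class_signed det_map_gen
        by (rule det_form_cyclic[OF _ _ cyclic(1-6)]) (simp_all add: residue_class_add residue_class_eq_0_iff[OF sI])
    qed
  qed
  ultimately show ?thesis
    using assms free.span_minimal[OF _ sub] unfolding homology_span_def by blast
qed

section \<open>The universal cocycle\<close>

definition homology_cocycle :: "'r mat22 \<Rightarrow> 'r mat22 \<Rightarrow> ('r mat22 \<times> 'r mat22 \<Rightarrow>\<^sub>0 'k) all_quotients" where
  "homology_cocycle X Y = residue_class homology_span (gen X Y)"

lemma homology_span_relation:
  "f \<in> bilinear_relations msc L \<union> lie_homology_relations MG br L \<Longrightarrow> residue_class homology_span f = 0"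
  unfolding residue_class_eq_0_iff[OF subgroup_homology] unfolding homology_span_def by (rule free.span_base)

lemma homology_cocycle_scale:
  assumes "X \<in> L" "Y \<in> L"
  shows "homology_cocycle (msc c X) Y = residue_class homology_span (free_scale c (gen X Y))"
    "homology_cocycle X (msc c Y) = residue_class homology_span (free_scale c (gen X Y))"
proof -
  have "residue_class homology_span (gen (msc c X) Y - free_scale c (gen X Y)) = 0"
    "residue_class homology_span (gen X (msc c Y) - free_scale c (gen X Y)) = 0"
    by (rule homology_span_relation, unfold bilinear_relations_def, use assms in blast)+
  then show "homology_cocycle (msc c X) Y = residue_class homology_span (free_scale c (gen X Y))"
    "homology_cocycle X (msc c Y) = residue_class homology_span (free_scale c (gen X Y))"
    by (simp_all add: homology_cocycle_def residue_class_diff)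
qed

end

context osp22_unit
begin

lemma osp22_homology_cocycle: "osp22_cocycle sc V bar half e ei homology_cocycle"
proof
  fix X X' Y assume "X \<in> L" "X' \<in> L" "Y \<in> L"
  then have "residue_class homology_span (gen (X + X') Y - gen X Y - gen X' Y) = 0"
    by (intro homology_span_relation) (unfold bilinear_relations_def, blast)
  then show "homology_cocycle (X + X') Y = homology_cocycle X Y + homology_cocycle X' Y"
    by (simp add: homology_cocycle_def residue_class_diff diff_eq_eq add.commute)
next
  fix X Y Y' assume "X \<in> L" "Y \<in> L" "Y' \<in> L"
  then have "residue_class homology_span (gen X (Y + Y') - gen X Y - gen X Y') = 0"
    by (intro homology_span_relation) (unfold bilinear_relations_def, blast)
  then show "homology_cocycle X (Y + Y') = homology_cocycle X Y + homology_cocycle X Y'"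
    by (simp add: homology_cocycle_def residue_class_diff diff_eq_eq add.commute)
next
  fix X Y p q assume "X \<in> L" "X \<in> MG p" "Y \<in> L" "Y \<in> MG q"
  then have "residue_class homology_span (gen X Y + signed (p * q) (gen Y X)) = 0"
    by (intro homology_span_relation) (unfold lie_homology_relations_def, blast)
  then show "homology_cocycle X Y + signed (p * q) (homology_cocycle Y X) = 0"
    by (simp add: homology_cocycle_def residue_class_add residue_class_signed)
next
  fix X Y Z p q r
  assume "X \<in> L" "X \<in> MG p" "Y \<in> L" "Y \<in> MG q" "Z \<in> L" "Z \<in> MG r"
  then have "residue_class homology_span
      (signed (p * r) (gen (br X Y) Z) + signed (q * p) (gen (br Y Z) X) + signed (r * q) (gen (br Z X) Y)) = 0"
    by (intro homology_span_relation) (unfold lie_homology_relations_def, blast)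
  then show "signed (p * r) (homology_cocycle (br X Y) Z) + signed (q * p) (homology_cocycle (br Y Z) X)
      + signed (r * q) (homology_cocycle (br Z X) Y) = 0"
    by (simp add: homology_cocycle_def residue_class_add residue_class_signed)
qed

text \<open>The normal form of the universal cocycle writes the class of \<open>z\<close> as a sum
  of three terms. They vanish because the bracket is 0, because the trace is in
  \<open>dihedral_span\<close> and because the determinant is in \<open>I\<close>.\<close>

lemma homology_span_kernel:
  assumes z: "z \<in> free_square L" "free_lift msc br z = 0"
    and trace: "trace_map z \<in> dihedral_span" and det: "det_map z \<in> I"
  shows "z \<in> homology_span"
proof -
  let ?q = "residue_class homology_span"
  interpret q: additive ?q
    by unfold_locales (rule residue_class_add)
  interpret b: osp22_cocycle sc V bar half e ei homology_cocycle
    by (rule osp22_homology_cocycle)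
  \<comment> \<open>A scalar in either argument gives the class of the same multiple of a generator.
    This replaces linearity of \<open>b.P\<close> and makes \<Lambda> compatible with the bilinear
    relations.\<close>
  have P_scale: "b.P (sc c x) y = b.P x (sc c y)" for c x y
    unfolding b.P_def AA_scale by (simp add: homology_cocycle_scale basis_L)
  have lam_scale: "b.lam_half (sc c x) y = b.lam_half x (sc c y)" for c x y
    by (simp add: b.lam_half_def b.lam_def P_scale scale_mult_left scale_mult_right mult.commute)
  note lam_simps = biadditive_simps[OF b.biadditive_lam_half]
  define \<Lambda> where "\<Lambda> = additive_lift (\<lambda>c x y. b.lam_half (sc c x) y)"
  have \<Lambda>_gen: "\<Lambda> (free_scale c (gen x y)) = b.lam_half (sc c x) y" for c x y
    unfolding \<Lambda>_def by (rule additive_lift_gen) (simp add: scale_left_distrib lam_simps)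
  interpret \<Lambda>: additive \<Lambda>
    unfolding \<Lambda>_def by unfold_locales (rule additive_lift_add, simp add: scale_left_distrib lam_simps)
  have \<Lambda>_signed: "\<Lambda> (free_scale c (signed p f)) = signed p (\<Lambda> (free_scale c f))" for c p f
    by (simp add: signed_def \<Lambda>.minus free.scale_minus_right)
  \<comment> \<open>The quantifier over \<open>c\<close> makes the set closed under scalar
    multiplication, although \<Lambda> is only additive.\<close>
  have "dihedral_span \<subseteq> {f. \<forall>c. \<Lambda> (free_scale c f) = 0}"
    unfolding dihedral_span_def
  proof (rule free.span_minimal)
    show "free.subspace {f. \<forall>c. \<Lambda> (free_scale c f) = 0}"
      unfolding free.subspace_def by (simp add: \<Lambda>.zero \<Lambda>.add free.scale_right_distrib)
    have "\<Lambda> (free_scale c f) = 0" if "f \<in> bilinear_relations sc UNIV" for c f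
      using that
      by (cases rule: bilinear_relations_cases)
        (simp_all add: free.scale_right_diff_distrib \<Lambda>.diff \<Lambda>_gen lam_simps scale_right_distrib,
          simp_all add: lam_scale mult.commute)
    moreover have "\<Lambda> (free_scale c f) = 0" if "f \<in> skew_dihedral_relations V bar" for c f
      using that unfolding skew_dihedral_relations_def
    proof (elim UnE CollectE exE conjE)
      fix x y assume "f = gen x y - gen (bar x) (bar y)"
      then show ?thesis
        using b.lam_half_bar[of "sc c x" y]
        by (simp add: free.scale_right_diff_distrib \<Lambda>.diff \<Lambda>_gen bar.scale)
    next
      fix x y p q assume f: "f = gen x y + signed (p * q) (gen y x)" and x: "x \<in> V p" and y: "y \<in> V q"
      have "b.lam_half y (sc c x) = - signed (p * q) (b.lam_half (sc c x) y)"
        by (rule b.lam_half_swap[OF scale_V[OF x] y])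
      then show ?thesis
        unfolding f free.scale_right_distrib \<Lambda>.add \<Lambda>_signed \<Lambda>_gen lam_scale[of c y x]
        by (cases p; cases q; simp)
    next
      fix x y w p q r
      assume f: "f = signed (p * r) (gen (x * y) w) + signed (p * q) (gen (y * w) x) + signed (q * r) (gen (w * x) y)"
        and x: "x \<in> V p" and y: "y \<in> V q" and w: "w \<in> V r"
      show ?thesis
        using b.lam_half_cyclic[OF scale_V[OF x, of c] y w]
        unfolding f free.scale_right_distrib \<Lambda>.add \<Lambda>_signed \<Lambda>_gen lam_scale[of c "y * w" x]
          scale_mult_left scale_mult_right .
    qed
    ultimately show "bilinear_relations sc UNIV \<union> skew_dihedral_relations V bar \<subseteq> {f. \<forall>c. \<Lambda> (free_scale c f) = 0}"
      by blast
  qed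
  then have "\<Lambda> (free_scale 1 (trace_map z)) = 0"
    using trace by blast
  then have trace0: "\<Lambda> (trace_map z) = 0"
    by simp
  let ?K = "Poly_Mapping.keys z" and ?c = "Poly_Mapping.lookup z"
  have K: "x \<in> L" "y \<in> L" if "(x, y) \<in> ?K" for x y
    using that z(1) by (auto simp: free_square_def)
  have zeta_sum: "b.zeta (\<Sum>i\<in>A. f i) = (\<Sum>i\<in>A. b.zeta (f i))" if "\<And>i. i \<in> A \<Longrightarrow> f i \<in> L" for A and f :: "'r mat22 \<times> 'r mat22 \<Rightarrow> _"
    using that
  proof (induction A rule: infinite_finite_induct)
    case (insert i A)
    then show ?case
      using mat.subspace_sum[OF subspace_L, of A f] by (simp add: b.zeta_add)
  qed (simp_all add: b.zeta_zero)
  have "?q z = ?q (\<Sum>(x, y)\<in>?K. free_scale (?c (x, y)) (gen x y))"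
    by (subst free_square_expand) (rule refl)
  also have "\<dots> = (\<Sum>(x, y)\<in>?K. homology_cocycle (msc (?c (x, y)) x) y)"
  proof -
    have "?q (free_scale (?c (x, y)) (gen x y)) = homology_cocycle (msc (?c (x, y)) x) y"
      if "(x, y) \<in> ?K" for x y
      using homology_cocycle_scale(1)[OF K[OF that]] by simp
    then show ?thesis
      unfolding q.sum by (intro sum.cong refl) auto
  qed
  also have "\<dots> = (\<Sum>(x, y)\<in>?K. b.zeta (msc (?c (x, y)) (br x y)))
      + (\<Sum>(x, y)\<in>?K. strace_form b.lam_half (msc (?c (x, y)) x) y)
      + (\<Sum>(x, y)\<in>?K. b.M (sc (?c (x, y)) (det_form x y)))"
  proof -
    have "homology_cocycle (msc (?c (x, y)) x) y = b.zeta (msc (?c (x, y)) (br x y))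
        + strace_form b.lam_half (msc (?c (x, y)) x) y + b.M (sc (?c (x, y)) (det_form x y))"
      if "(x, y) \<in> ?K" for x y
      using b.cocycle_normal_form[OF L_scale[OF K(1)[OF that]] K(2)[OF that]]
      by (simp add: br_scale_left det_form_scale)
    then show ?thesis
      unfolding sum.distrib[symmetric] by (intro sum.cong refl) auto
  qed
  also have "(\<Sum>(x, y)\<in>?K. b.zeta (msc (?c (x, y)) (br x y))) = b.zeta (free_lift msc br z)"
    unfolding free_lift_def by (subst zeta_sum) (auto intro!: L_scale br_LL intro: K sum.cong)
  also have "(\<Sum>(x, y)\<in>?K. b.M (sc (?c (x, y)) (det_form x y))) = b.M (det_map z)"
    unfolding det_map_def free_lift_def by (simp add: b.M.sum case_prod_unfold)
  also have "(\<Sum>(x, y)\<in>?K. strace_form b.lam_half (msc (?c (x, y)) x) y) = \<Lambda> (trace_map z)"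
  proof -
    have "strace_form b.lam_half (msc c x) y = \<Lambda> (free_scale c (strace_form gen x y))" for c x y
    proof -
      have "\<Lambda> (free_scale c (strace_form gen x y)) = strace_form (\<lambda>a b. \<Lambda> (free_scale c (gen a b))) x y"
        by (rule strace_form_hom) (unfold_locales, simp add: free.scale_right_distrib \<Lambda>.add)
      then show ?thesis
        by (simp add: \<Lambda>_gen strace_form_scale_left)
    qed
    then show ?thesis
      unfolding trace_map_def free_lift_def by (simp add: \<Lambda>.sum case_prod_unfold)
  qed
  finally have "?q z = 0"
    using z(2) trace0 b.M_I[OF det] by (simp add: b.zeta_zero)
  then show ?thesis
    by (simp add: residue_class_eq_0_iff[OF subgroup_homology])
qed

text \<open>By \<open>str_br\<close>. Consequently the supercommutators along the image of a cycle
  sum to 0, and the condition that defines HD_1 holds.\<close>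

lemma free_lift_scomm_trace_map: "free_lift sc scomm (trace_map z) = str (free_lift msc br z)"
proof -
  interpret s: module_hom free_scale sc "free_lift sc scomm"
    by (rule module_hom_free_lift)
  have "free_lift sc scomm (strace_form gen X Y) = str (br X Y)" for X Y
    unfolding str_br by (subst strace_form_hom) (unfold_locales, simp_all add: s.add)
  then show ?thesis
    unfolding trace_map_def s.free_lift str.free_lift by simp
qed

section \<open>Cycles that realize both summands\<close>

lemma strace_form_pairing_xy:
  "strace_form pairing (xx i1 (rho V a)) (yy i1 (rho V b)) = - pairing a b - pairing a b"
  "strace_form pairing (xx i1 a) (yy i2 b) = 0"
  using pairing_bar[of a b]
  by (simp_all add: strace_form_def sum_idx basis_nth munit_nth bar_rho rho.zero bar.zero pairing_simps)

lemma half_scale: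
  assumes "Modules.module s"
  shows "s half x + s half x = x"
  using half by (simp add: Modules.module.scale_left_distrib[OF assms, symmetric] Modules.module.scale_one[OF assms])

lemma homology_surjective:
  assumes u: "free_lift sc scomm u = free_lift sc (\<lambda>a b. bar (scomm a b)) u"
  shows "\<exists>z\<in>free_square L. free_lift msc br z = 0 \<and> trace_map z - u \<in> dihedral_span \<and> det_map z = v"
proof -
  interpret B: module_hom free_scale "msc" "free_lift msc br"
    by (rule mat.module_hom_free_lift)
  \<comment> \<open>By \<open>br_xy_corner\<close> the bracket is a multiple of the corner entry
    \<open>scomm a b - bar (scomm a b)\<close>, which the condition on \<open>u\<close> cancels in
    the sum. The trace of the first generator is \<open>- 2\<close> times the class of
    \<open>gen a b\<close> and that of the second is 0 by \<open>pairing_one\<close>, which explains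
    \<open>- half\<close>.\<close>
  define f where "f a b = free_scale (- half) (gen (xx i1 (rho V a)) (yy i1 (rho V b)) - gen (xx i1 1) (yy i1 (rho V (a * b))))" for a b
  define z1 where "z1 = free_lift free_scale f u"
  \<comment> \<open>The brackets of the two generators agree and their traces vanish modulo
    \<open>dihedral_span\<close>. Their determinants are \<open>- v\<close> and \<open>v\<close>, so
    \<open>- half\<close> normalizes the result to \<open>v\<close>.\<close>
  define z2 where "z2 = free_scale (- half) (gen (xx i1 1) (yy i2 v) - gen (xx i1 ei) (yy i2 (e * v)))"
  note in_square = free.subspace_scale[OF subspace_free_square] free.subspace_diff[OF subspace_free_square]
    gen_free_square basis_L
  have "f a b \<in> free_square L" for a b
    unfolding f_def by (intro in_square)
  then have "z1 \<in> free_square L"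
    unfolding z1_def by (intro free.free_lift_in_subspace[OF subspace_free_square])
  moreover have "z2 \<in> free_square L"
    unfolding z2_def by (intro in_square)
  ultimately have 1: "z1 + z2 \<in> free_square L"
    by (rule free.subspace_add[OF subspace_free_square])
  have br1: "free_lift msc br z1 = 0"
  proof -
    interpret c: module_hom sc "msc" "\<lambda>x. msc (- half) (- munit i1 i1 x) :: 'r mat22"
      by unfold_locales (simp_all add: munit_add munit_scale mat.scale_right_distrib mat.scale_right_diff_distrib mult.commute)
    have "free_lift msc br (f a b) = msc (- half) (- munit i1 i1 (scomm a b - bar (scomm a b)))" for a b
      unfolding f_def B.scale B.diff mat.free_lift_gen br_xy_corner[of i1 a b, simplified] ..
    then have "free_lift msc br z1
        = msc (- half) (- munit i1 i1 (free_lift sc (\<lambda>a b. scomm a b - bar (scomm a b)) u))"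
      unfolding z1_def B.free_lift c.free_lift by simp
    then show ?thesis
      using u by (simp add: free_lift_diff_function)
  qed
  have br2: "free_lift msc br z2 = 0"
  proof -
    have "br (xx i1 ei) (yy i2 (e * v)) = br (xx i1 1) (yy i2 v)"
    proof (induction v rule: homogeneous_induct)
      case (homogeneous q v)
      have "e * v * ei = v"
        by (metis e_cancel(3) e_central)
      then show ?case
        by (simp add: br_xy[OF ei_even e_V(1)[OF homogeneous]] br_xy[OF V_one homogeneous])
    qed (simp add: distrib_left yy_add br_simps)
    then show ?thesis
      unfolding z2_def B.scale B.diff mat.free_lift_gen by simp
  qed
  have trace1: "trace_map z1 - u \<in> dihedral_span"
  proof -
    have "trace_map (f a b) - gen a b \<in> dihedral_span" for a b
    proof -
      let ?t = "trace_map (gen (xx i1 (rho V a)) (yy i1 (rho V b)) - gen (xx i1 1) (yy i1 (rho V (a * b))))"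
      have t: "residue_class dihedral_span ?t = - pairing a b - pairing a b"
        using strace_form_pairing_xy(1)[of 1 "a * b"]
        by (simp add: trace_map.diff residue_class_diff residue_class_trace_map_gen
            strace_form_pairing_xy rho_homogeneous[OF V_one] pairing_one)
      have "residue_class dihedral_span (?t + gen a b + gen a b) = 0"
        unfolding residue_class_add t pairing_def by (simp add: algebra_simps)
      then have "free_scale (- half) (?t + gen a b + gen a b) \<in> dihedral_span"
        unfolding residue_class_eq_0_iff[OF subgroup_dihedral] unfolding dihedral_span_def by (rule free.span_scale)
      moreover have "free_scale (- half) (?t + gen a b + gen a b) = - free_scale half ?t - gen a b"
      proof -
        have "free_scale (- half) (?t + gen a b + gen a b)
            = - (free_scale half ?t + (free_scale half (gen a b) + free_scale half (gen a b)))"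
          by (simp only: free.scale_minus_left free.scale_right_distrib add.assoc minus_add_distrib)
        then show ?thesis
          by (simp only: half_scale[OF module_free_scale]) simp
      qed
      moreover have "trace_map (f a b) = - free_scale half ?t"
        by (simp only: f_def free.scale_minus_left trace_map.neg trace_map.scale)
      ultimately show ?thesis
        by simp
    qed
    then have "free_lift free_scale (\<lambda>a b. trace_map (f a b) - gen a b) u \<in> dihedral_span"
      by (intro free.free_lift_in_subspace) (simp_all add: dihedral_span_def)
    then show ?thesis
      unfolding free.free_lift_diff_function free_lift_gen_self z1_def trace_map.free_lift .
  qed
  have trace2: "trace_map z2 \<in> dihedral_span"
  proof -
    have "residue_class dihedral_span (trace_map (gen (xx i1 1) (yy i2 v) - gen (xx i1 ei) (yy i2 (e * v)))) = 0"
      by (simp add: trace_map.diff residue_class_diff residue_class_trace_map_gen strace_form_pairing_xy)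
    then show ?thesis
      unfolding residue_class_eq_0_iff[OF subgroup_dihedral] z2_def trace_map.scale
      unfolding dihedral_span_def by (rule free.span_scale)
  qed
  have det1: "det_map z1 = 0"
  proof -
    have "det_map (f a b) = 0" for a b
      by (simp add: f_def det_map.neg det_map.scale det_map.diff det_map_gen det_form_xy)
    then show ?thesis
      unfolding z1_def det_map.free_lift by (simp add: free_lift_def case_prod_unfold)
  qed
  have det2: "det_map z2 = v"
    unfolding z2_def free.scale_minus_left det_map.neg det_map.scale det_map.diff det_map_gen det_form_xy
    by (simp add: bar_ei e_cancel scale_right_diff_distrib scale_minus_left)
  show ?thesis
  proof (intro bexI[OF _ 1] conjI)
    show "free_lift msc br (z1 + z2) = 0"
      by (simp add: B.add br1 br2)
    show "trace_map (z1 + z2) - u \<in> dihedral_span"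
      using add_subgroup_add[OF subgroup_dihedral trace1 trace2] by (simp add: trace_map.add algebra_simps)
    show "det_map (z1 + z2) = v"
      by (simp add: det_map.add det1 det2)
  qed
qed

theorem osp22_H2:
  "module_isomorphic (lie_H2 msc MG br L)
    (module_direct_sum (skew_dihedral_HD1 sc V bar) (quotient_module sc UNIV I))"
  unfolding lie_H2_def skew_dihedral_HD1_def tensor_square_subquotient_def
    homology_span_def[symmetric] dihedral_span_def[symmetric]
proof (rule module_isomorphic_quotient_direct_sum[OF trace_map.module_hom_axioms det_map.module_hom_axioms _ _ subspace_I])
  show "free.subspace homology_span" "free.subspace dihedral_span"
    unfolding homology_span_def dihedral_span_def by (rule free.subspace_span)+
  interpret B: module_hom free_scale "msc" "free_lift msc br"
    by (rule mat.module_hom_free_lift)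
  show "free.subspace {f \<in> free_square L. free_lift msc br f = 0}"
    using free.subspace_inter[OF subspace_free_square B.subspace_kernel] by (simp add: Int_def)
next
  fix z :: "'r mat22 \<times> 'r mat22 \<Rightarrow>\<^sub>0 'k"
  assume z: "z \<in> {f \<in> free_square L. free_lift msc br f = 0}"
  show "trace_map z \<in> {f. free_lift sc scomm f = free_lift sc (\<lambda>a b. bar (scomm a b)) f}"
    using z free_lift_scomm_trace_map[of z] by (simp add: str.zero flip: bar.free_lift)
  show "det_map z \<in> UNIV"
    by simp
  show "z \<in> homology_span \<longleftrightarrow> trace_map z \<in> dihedral_span \<and> det_map z \<in> I"
    using z homology_span_kernel[of z] trace_map_homology[of z] det_map_homology[of z] by auto
next
  fix u v
  assume "u \<in> {f. free_lift sc scomm f = free_lift sc (\<lambda>a b. bar (scomm a b)) f}"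
  then show "\<exists>z\<in>{f \<in> free_square L. free_lift msc br f = 0}. trace_map z - u \<in> dihedral_span \<and> det_map z - v \<in> I"
    using homology_surjective[of u v] subspace_0[OF subspace_I] by auto
qed

end

theorem corollary6p7:
  fixes sc :: "'k::comm_ring_1 \<Rightarrow> 'r::ring_1 \<Rightarrow> 'r"
    and V :: "bit \<Rightarrow> 'r set" and bar :: "'r \<Rightarrow> 'r"
    and e :: 'r and p :: bit
  assumes two_invertible: "(2::'k) dvd 1"
    and superinvolution: "superinvolution sc V bar"
    and e_homogeneous: "e \<in> V p"
    and e_skew: "bar e = - e"
    and e_central: "\<forall>x. e * x = x * e"
    and e_unit: "\<exists>f. e * f = 1 \<and> f * e = 1"
  shows "module_isomorphic
    (lie_H2 (matrix_scale sc) (matrix_grading V) (matrix_bracket V)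
      (osp sc V bar :: ('r, 2, 1) block_matrix set))
    (module_direct_sum
      (skew_dihedral_HD1 sc V bar)
      (quotient_module sc UNIV (commutator_ideal sc V)))"
proof -
  interpret superinvolution sc V bar
    by fact
  obtain half :: 'k where "1 = 2 * half"
    using two_invertible by (rule dvdE)
  then have half: "half + half = 1"
    by (simp flip: mult_2)
  obtain f where f: "e * f = 1"
    using e_unit by blast
  obtain e' e'' where "e' \<in> V 0" "bar e' = - e'" "\<And>x. e' * x = x * e'" "e' * e'' = 1"
  proof (cases p)
    case zero
    show ?thesis
      by (rule that[of e f]) (use e_homogeneous zero e_skew e_central f in simp_all)
  next
    case one
    \<comment> \<open>The square of an odd \<open>e\<close> is even, and again skew because \<open>bar\<close> reverses odd factors with a sign.\<close>
    show ?thesis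
    proof (rule that[of "e * e" "f * f"])
      show "e * e \<in> V 0" "bar (e * e) = - (e * e)"
        using V_mult[OF e_homogeneous e_homogeneous] bar_mult[OF e_homogeneous e_homogeneous] one
        by (simp_all add: e_skew)
      show "(e * e) * x = x * (e * e)" for x
        using e_central[rule_format, of x] e_central[rule_format, of "e * x"] by (simp add: mult.assoc)
      have "e * (e * f) * f = 1"
        by (simp add: f)
      then show "(e * e) * (f * f) = 1"
        by (simp add: mult.assoc)
    qed
  qed
  then interpret osp22_unit sc V bar half e' e''
    using half by unfold_locales
  show ?thesis
    by (rule osp22_H2)
qed

end
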